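(* Let $\Bbbk$ be a field of characteristic $0$, let $\mathfrak g$ be a finite dimensional Lie algebra over $\Bbbk$, and let $R=U(\mathfrak g)$ be its universal enveloping algebra. Suppose that $\mathfrak g$ is not a semidirect product $\mathfrak g'\ltimes \Bbbk x$ for a Lie subalgebra $\mathfrak g'\subseteq\mathfrak g$ and a $1$-dimensional Lie ideal $\Bbbk x\subseteq\mathfrak g$. Then $R\ast G\cong \operatorname{End}_{R^G}(R)$ (via the natural map) for every finite group $G\subseteq\operatorname{Aut}_{Lie}(\mathfrak g)$.
   Context: $\operatorname{Aut}_{Lie}(\mathfrak g)$ is the group of Lie algebra automorphisms of $\mathfrak g$; it acts on $U(\mathfrak g)$ by algebra automorphisms. Here $\mathfrak g'$ denotes an arbitrary Lie subalgebra complementary to the ideal $\Bbbk x$ (not the derived subalgebra). $R\ast G$ is the skew group algebra, $R^G$ the fixed subring, and $R$ is a right $R^G$-module by multiplication. The natural algebra map is $R\ast G\to\operatorname{End}_{R^G}(R)$, $r\ast g\mapsto (x\mapsto r\,g(x))$. *)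

theory Defs
  imports Complex_Main "HOL-Algebra.QuotRing" "HOL-Library.Poly_Mapping"
begin

section \<open>Lie algebras\<close>

locale lie_algebra = vector_space scale
  for scale :: "'k::field \<Rightarrow> 'g::ab_group_add \<Rightarrow> 'g" (infixr \<open>*s\<close> 75) +
  fixes bracket :: "'g \<Rightarrow> 'g \<Rightarrow> 'g"
  assumes bracket_add_left: "bracket (x + y) z = bracket x z + bracket y z"
    and bracket_add_right: "bracket x (y + z) = bracket x y + bracket x z"
    and bracket_scale_left: "bracket (c *s x) y = c *s bracket x y"
    and bracket_scale_right: "bracket x (c *s y) = c *s bracket x y"
    and bracket_self: "bracket x x = 0"
    and jacobi: "bracket x (bracket y z) + bracket y (bracket z x) + bracket z (bracket x y) = 0"
begin

definition lie_subalgebra :: "'g set \<Rightarrow> bool" where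
  "lie_subalgebra H \<longleftrightarrow> subspace H \<and> (\<forall>x\<in>H. \<forall>y\<in>H. bracket x y \<in> H)"

definition lie_ideal :: "'g set \<Rightarrow> bool" where
  "lie_ideal I \<longleftrightarrow> subspace I \<and> (\<forall>x. \<forall>y\<in>I. bracket x y \<in> I)"

definition semidirect_product :: "'g set \<Rightarrow> 'g set \<Rightarrow> bool" where
  "semidirect_product H I \<longleftrightarrow> lie_subalgebra H \<and> lie_ideal I \<and>
     H \<inter> I = {0} \<and> (\<forall>z. \<exists>h\<in>H. \<exists>i\<in>I. z = h + i)"

definition lie_aut_group :: "('g \<Rightarrow> 'g) monoid" where
  "lie_aut_group =
     \<lparr>carrier = {\<sigma>. Vector_Spaces.linear scale scale \<sigma> \<and> bij \<sigma> \<and>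
                    (\<forall>x y. \<sigma> (bracket x y) = bracket (\<sigma> x) (\<sigma> y))},
      mult = (\<circ>), one = id\<rparr>"

end


section \<open>Free associative algebras\<close>

text \<open>
  The multiplication of \<open>w \<Rightarrow>\<^sub>0 k\<close> is the convolution along the addition of \<open>w\<close>. With
  concatenation as the addition of words, \<open>g fword \<Rightarrow>\<^sub>0 k\<close> is therefore the free associative
  unital \<open>k\<close>-algebra on the set \<open>g\<close>.
\<close>

datatype 'a fword = FWord "'a list"

instantiation fword :: (type) monoid_add
begin

definition zero_fword :: "'a fword" where
  "0 = FWord []"

fun plus_fword :: "'a fword \<Rightarrow> 'a fword \<Rightarrow> 'a fword" where
  "FWord xs + FWord ys = FWord (xs @ ys)"

instance
proof
  fix a b c :: "'a fword"
  show "a + b + c = a + (b + c)" by (cases a; cases b; cases c) simp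
  show "0 + a = a" by (cases a) (simp add: zero_fword_def)
  show "a + 0 = a" by (cases a) (simp add: zero_fword_def)
qed

end

definition free_algebra :: "('g fword \<Rightarrow>\<^sub>0 'k::field) ring" where
  "free_algebra = \<lparr>carrier = UNIV, mult = (*), one = 1, zero = 0, add = (+)\<rparr>"

definition free_gen :: "'g \<Rightarrow> ('g fword \<Rightarrow>\<^sub>0 'k::field)" where
  "free_gen x = Poly_Mapping.single (FWord [x]) 1"

definition free_scalar :: "'k \<Rightarrow> ('g fword \<Rightarrow>\<^sub>0 'k::field)" where
  "free_scalar c = Poly_Mapping.single 0 c"

definition free_map :: "('g \<Rightarrow> 'g) \<Rightarrow> ('g fword \<Rightarrow>\<^sub>0 'k::field) \<Rightarrow> ('g fword \<Rightarrow>\<^sub>0 'k)" where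
  "free_map \<sigma> p =
     (\<Sum>w\<in>Poly_Mapping.keys p. Poly_Mapping.single (map_fword \<sigma> w) (Poly_Mapping.lookup p w))"


section \<open>Universal enveloping algebras\<close>

text \<open>
  The free algebra on the \<^emph>\<open>set\<close> \<open>g\<close> modulo the first two families of relations is the
  tensor algebra of the \<^emph>\<open>vector space\<close> \<open>g\<close>; the third family then gives
  \<open>U(g) = T(g) / (x \<otimes> y - y \<otimes> x - [x, y])\<close>.
\<close>

context lie_algebra
begin

definition enveloping_relations :: "('g fword \<Rightarrow>\<^sub>0 'k) set" where
  "enveloping_relations =
     {free_gen (x + y) - free_gen x - free_gen y | x y. True} \<union>
     {free_gen (c *s x) - free_scalar c * free_gen x | c x. True} \<union>
     {free_gen x * free_gen y - free_gen y * free_gen x - free_gen (bracket x y) | x y. True}"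

definition enveloping_ideal :: "('g fword \<Rightarrow>\<^sub>0 'k) set" where
  "enveloping_ideal = Idl\<^bsub>free_algebra\<^esub> enveloping_relations"

definition enveloping_algebra :: "('g fword \<Rightarrow>\<^sub>0 'k) set ring" where
  "enveloping_algebra = free_algebra Quot enveloping_ideal"

end

text \<open>
  The elements of the enveloping algebra are cosets. A Lie algebra automorphism \<open>\<sigma>\<close> induces
  an automorphism of the free algebra that preserves the ideal, so the induced automorphism
  of the quotient takes a coset to its image.
\<close>

definition enveloping_action ::
    "('g \<Rightarrow> 'g) \<Rightarrow> ('g fword \<Rightarrow>\<^sub>0 'k::field) set \<Rightarrow> ('g fword \<Rightarrow>\<^sub>0 'k) set" where
  "enveloping_action \<sigma> u = free_map \<sigma> ` u"


section \<open>Skew group rings and the natural map\<close>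

text \<open>
  Here \<open>\<phi> g\<close> is the action of \<open>g \<in> G\<close> on \<open>R\<close> by ring automorphisms.
\<close>

definition fixed_subring :: "'r ring \<Rightarrow> 'h monoid \<Rightarrow> ('h \<Rightarrow> 'r \<Rightarrow> 'r) \<Rightarrow> 'r set" where
  "fixed_subring R G \<phi> = {r \<in> carrier R. \<forall>g\<in>carrier G. \<phi> g r = r}"

text \<open>
  For a finite group \<open>G\<close>: the function \<open>a\<close> stands for the formal sum of the \<open>a g * g\<close>, and the
  product comes from \<open>(r * g) (s * h) = r \<phi>\<^sub>g(s) * g h\<close>.
\<close>

definition skew_group_ring ::
    "'r ring \<Rightarrow> 'h monoid \<Rightarrow> ('h \<Rightarrow> 'r \<Rightarrow> 'r) \<Rightarrow> ('h \<Rightarrow> 'r) ring" where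
  "skew_group_ring R G \<phi> =
     \<lparr>carrier = carrier G \<rightarrow>\<^sub>E carrier R,
      mult = (\<lambda>a b. \<lambda>k\<in>carrier G.
                \<Oplus>\<^bsub>R\<^esub>g\<in>carrier G. a g \<otimes>\<^bsub>R\<^esub> \<phi> g (b (inv\<^bsub>G\<^esub> g \<otimes>\<^bsub>G\<^esub> k))),
      one = (\<lambda>k\<in>carrier G. if k = \<one>\<^bsub>G\<^esub> then \<one>\<^bsub>R\<^esub> else \<zero>\<^bsub>R\<^esub>),
      zero = (\<lambda>k\<in>carrier G. \<zero>\<^bsub>R\<^esub>),
      add = (\<lambda>a b. \<lambda>k\<in>carrier G. a k \<oplus>\<^bsub>R\<^esub> b k)\<rparr>"

text \<open>Endomorphisms of \<open>R\<close> as a right module over a subring \<open>S\<close>.\<close>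

definition right_End :: "'r ring \<Rightarrow> 'r set \<Rightarrow> ('r \<Rightarrow> 'r) ring" where
  "right_End R S =
     \<lparr>carrier = {f \<in> carrier R \<rightarrow>\<^sub>E carrier R.
                  (\<forall>x\<in>carrier R. \<forall>y\<in>carrier R. f (x \<oplus>\<^bsub>R\<^esub> y) = f x \<oplus>\<^bsub>R\<^esub> f y) \<and>
                  (\<forall>x\<in>carrier R. \<forall>s\<in>S. f (x \<otimes>\<^bsub>R\<^esub> s) = f x \<otimes>\<^bsub>R\<^esub> s)},
      mult = (\<lambda>f h. compose (carrier R) f h),
      one = (\<lambda>x\<in>carrier R. x),
      zero = (\<lambda>x\<in>carrier R. \<zero>\<^bsub>R\<^esub>),
      add = (\<lambda>f h. \<lambda>x\<in>carrier R. f x \<oplus>\<^bsub>R\<^esub> h x)\<rparr>"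

definition skew_natural_map ::
    "'r ring \<Rightarrow> 'h monoid \<Rightarrow> ('h \<Rightarrow> 'r \<Rightarrow> 'r) \<Rightarrow> ('h \<Rightarrow> 'r) \<Rightarrow> ('r \<Rightarrow> 'r)" where
  "skew_natural_map R G \<phi> a =
     (\<lambda>x\<in>carrier R. \<Oplus>\<^bsub>R\<^esub>g\<in>carrier G. a g \<otimes>\<^bsub>R\<^esub> \<phi> g x)"

end

theory Submission
  imports Defs "HOL-Library.Multiset_Order"
begin

text \<open>
  The proof passes to the associated graded ring of \<open>U(g)\<close>, which is a polynomial ring \<open>S\<close> by the
  Poincare-Birkhoff-Witt theorem. If some \<open>\<sigma> \<in> G\<close> were a reflection on \<open>g\<close>, its fixed points would be a
  subalgebra complementary to the one-dimensional ideal \<open>im (1 - \<sigma>)\<close>; so for \<open>g \<noteq> h\<close> in \<open>G\<close> the linear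
  forms \<open>h y - g y\<close> span at least a plane.

  Let \<open>f\<close> be an \<open>S\<^sup>G\<close>-linear endomorphism of \<open>S\<close>. For \<open>g \<in> G\<close> and linear forms \<open>y\<^sub>h\<close> there are \<open>b\<^sub>i, c\<^sub>i\<close> with
  \<open>\<Sum>\<^sub>i b\<^sub>i k(c\<^sub>i) = \<Prod>\<^sub>h\<^sub>\<noteq>\<^sub>g (h y\<^sub>h - k y\<^sub>h)\<close> for all \<open>k \<in> G\<close>, and this vanishes unless \<open>k = g\<close>. The case \<open>g = 1\<close>
  writes \<open>N f = \<Sum>\<^sub>k e\<^sub>k k\<close> for some invariant \<open>N \<noteq> 0\<close>; the general case shows that \<open>N\<close> divides
  \<open>e\<^sub>g \<Prod>\<^sub>h\<^sub>\<noteq>\<^sub>g (h y\<^sub>h - g y\<^sub>h)\<close>. Varying the \<open>y\<^sub>h\<close>, the linear factors can be cancelled one at a time, and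
  \<open>N\<close> divides \<open>e\<^sub>g\<close>. This is Auslander's theorem for \<open>S\<close>.

  An endomorphism of \<open>U(g)\<close> over its invariants has finite degree with respect to the filtration,
  because \<open>S\<close> is finite over \<open>S\<^sup>G\<close>. Auslander's theorem applied to its leading term lowers the degree, and
  an endomorphism of negative degree vanishes.
\<close>

section \<open>Auslander's theorem for graded commutative domains\<close>

text \<open>Elements of \<open>U(g)\<close> are cosets, so all computation happens on
  representatives in the free algebra, and identities become congruences modulo the enveloping
  ideal. An endomorphism turns into a chosen map on representatives that is additive only up to that
  ideal.

  Symbols are read off from an action of \<open>g\<close> on polynomials: a word acts on
  \<open>1\<close> with leading term the product of its linear forms. Since the relations act as
  zero, symbols are well defined on cosets; sorting words determines their kernel.

  Cancelling linear factors rests on one divisibility: if \<open>u\<close> and \<open>v\<close> are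
  non-proportional linear forms and \<open>u b = v a\<close>, then \<open>u\<close> divides
  \<open>a\<close>. The assumption \<open>no_reflections\<close> records exactly this, and it is
  proved by eliminating one variable.

  Finiteness over the invariants is used in a graded form: from degree |G| on, every form lies in
  the ideal generated by invariants of positive degree. So finitely many degrees bound an
  endomorphism.

  Characteristic 0 makes |G| invertible, which allows averaging, and excludes transvections, which
  would have infinite order.\<close>

locale graded_action = group G for G :: "'h monoid" (structure) +
  fixes S :: "int \<Rightarrow> 's::idom set"
    and \<gamma> :: "'h \<Rightarrow> 's \<Rightarrow> 's"
    and J :: "'j set" and x :: "'j \<Rightarrow> 's"
  assumes finite_G: "finite (carrier G)"
    and S_add: "a \<in> S z \<Longrightarrow> b \<in> S z \<Longrightarrow> a + b \<in> S z"
    and S_uminus: "a \<in> S z \<Longrightarrow> - a \<in> S z"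
    and S_zero: "0 \<in> S z"
    and S_one: "1 \<in> S 0"
    and S_mult: "a \<in> S m \<Longrightarrow> b \<in> S n \<Longrightarrow> a * b \<in> S (m + n)"
    and S_neg: "z < 0 \<Longrightarrow> S z = {0}"
    and \<gamma>_closed: "h \<in> carrier G \<Longrightarrow> a \<in> S z \<Longrightarrow> \<gamma> h a \<in> S z"
    and \<gamma>_add: "h \<in> carrier G \<Longrightarrow> \<gamma> h (a + b) = \<gamma> h a + \<gamma> h b"
    and \<gamma>_mult: "h \<in> carrier G \<Longrightarrow> \<gamma> h (a * b) = \<gamma> h a * \<gamma> h b"
    and \<gamma>_1: "h \<in> carrier G \<Longrightarrow> \<gamma> h 1 = 1"
    and \<gamma>_one: "a \<in> S z \<Longrightarrow> \<gamma> \<one> a = a"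
    and \<gamma>_comp: "g \<in> carrier G \<Longrightarrow> h \<in> carrier G \<Longrightarrow> \<gamma> (g \<otimes> h) a = \<gamma> g (\<gamma> h a)"
    and S_0_fixed: "h \<in> carrier G \<Longrightarrow> a \<in> S 0 \<Longrightarrow> \<gamma> h a = a"
    and S_divide: "a \<in> S z \<Longrightarrow> \<exists>b\<in>S z. of_nat (card (carrier G)) * b = a"
    and finite_J: "finite J"
    and x_in: "j \<in> J \<Longrightarrow> x j \<in> S 1"
    and S_generated: "a \<in> S z \<Longrightarrow> z > 0 \<Longrightarrow>
      \<exists>q. (\<forall>j\<in>J. q j \<in> S (z - 1)) \<and> a = (\<Sum>j\<in>J. x j * q j)"
    and no_reflections: "g \<in> carrier G \<Longrightarrow> h \<in> carrier G \<Longrightarrow> g \<noteq> h \<Longrightarrow>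
      \<exists>y\<in>S 1. \<exists>y'\<in>S 1. \<gamma> h y - \<gamma> g y \<noteq> 0 \<and>
        (\<forall>z. \<forall>a\<in>S z. \<forall>b\<in>S z. (\<gamma> h y - \<gamma> g y) * b = (\<gamma> h y' - \<gamma> g y') * a \<longrightarrow>
          (\<exists>c\<in>S (z - 1). a = (\<gamma> h y - \<gamma> g y) * c))"
begin

lemma \<gamma>_zero: assumes "h \<in> carrier G" shows "\<gamma> h 0 = 0"
  using \<gamma>_add[OF assms, of 0 0] by (metis add.right_neutral add_left_cancel)

lemma \<gamma>_uminus: assumes "h \<in> carrier G" shows "\<gamma> h (- a) = - \<gamma> h a"
  using \<gamma>_add[OF assms, of a "- a"] \<gamma>_zero[OF assms]
  by (metis add.right_inverse minus_unique)

lemma \<gamma>_sum: "h \<in> carrier G \<Longrightarrow> \<gamma> h (sum f K) = (\<Sum>i\<in>K. \<gamma> h (f i))"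
  by (induction K rule: infinite_finite_induct) (auto simp: \<gamma>_zero \<gamma>_add)

lemma \<gamma>_prod: "h \<in> carrier G \<Longrightarrow> \<gamma> h (prod f K) = (\<Prod>i\<in>K. \<gamma> h (f i))"
  by (induction K rule: infinite_finite_induct) (auto simp: \<gamma>_1 \<gamma>_mult)

lemma S_sum: "(\<And>i. i \<in> K \<Longrightarrow> f i \<in> S z) \<Longrightarrow> sum f K \<in> S z"
  by (induction K rule: infinite_finite_induct) (auto simp: S_zero S_add)

lemma S_prod: "finite K \<Longrightarrow> (\<And>i. i \<in> K \<Longrightarrow> f i \<in> S z) \<Longrightarrow> prod f K \<in> S (z * int (card K))"
proof (induction K rule: finite_induct)
  case (insert i K)
  then have "f i * prod f K \<in> S (z + z * int (card K))"
    by (intro S_mult) auto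
  with insert show ?case by (simp add: algebra_simps)
qed (simp add: S_one)

lemma S_diff: "a \<in> S z \<Longrightarrow> b \<in> S z \<Longrightarrow> a - b \<in> S z"
  using S_add[of a z "- b"] S_uminus[of b z] by simp

lemma sum_translate:
  assumes "g \<in> carrier G"
  shows "(\<Sum>h\<in>carrier G. F (g \<otimes> h)) = (\<Sum>h\<in>carrier G. F h :: 'c::comm_monoid_add)"
  by (rule sum.reindex_bij_witness[of _ "\<lambda>h. inv g \<otimes> h" "\<lambda>h. g \<otimes> h"])
     (use assms in \<open>auto simp: m_assoc[symmetric]\<close>)

lemma prod_translate:
  assumes "g \<in> carrier G"
  shows "(\<Prod>h\<in>carrier G. F (g \<otimes> h)) = (\<Prod>h\<in>carrier G. F h :: 'c::comm_monoid_mult)"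
  by (rule prod.reindex_bij_witness[of _ "\<lambda>h. inv g \<otimes> h" "\<lambda>h. g \<otimes> h"])
     (use assms in \<open>auto simp: m_assoc[symmetric]\<close>)

section \<open>Invariants, traces and elements that separate the automorphisms\<close>

definition S_fix :: "int \<Rightarrow> 's set" where
  "S_fix z = {a \<in> S z. \<forall>h\<in>carrier G. \<gamma> h a = a}"

definition trace :: "'s \<Rightarrow> 's" where
  "trace a = (\<Sum>h\<in>carrier G. \<gamma> h a)"

lemma trace_in: "a \<in> S z \<Longrightarrow> trace a \<in> S_fix z"
proof -
  assume a: "a \<in> S z"
  have "\<gamma> g (trace a) = trace a" if "g \<in> carrier G" for g
    unfolding trace_def \<gamma>_sum[OF that]
    by (subst sum_translate[OF that, symmetric], rule sum.cong) (auto simp: \<gamma>_comp that)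
  moreover have "trace a \<in> S z"
    unfolding trace_def by (intro S_sum \<gamma>_closed a)
  ultimately show ?thesis by (simp add: S_fix_def)
qed

text \<open>Expanding \<open>\<Prod>h\<in>A. \<gamma> h (y h) - \<gamma> g (y h)\<close> over the
  set \<open>B\<close> of factors that contribute their first term separates the variables: the part
  from \<open>B\<close> does not involve \<open>g\<close>, and the rest is \<open>\<gamma> g\<close>
  of an element that does not involve \<open>g\<close>. These two parts are the b and c of the
  overview.\<close>

definition sep_left :: "('h \<Rightarrow> 's) \<Rightarrow> 'h set \<Rightarrow> 's" where
  "sep_left y B = (\<Prod>h\<in>B. \<gamma> h (y h))"

definition sep_right :: "'h set \<Rightarrow> ('h \<Rightarrow> 's) \<Rightarrow> 'h set \<Rightarrow> 's" where
  "sep_right A y B = (\<Prod>h\<in>A - B. - y h)"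

lemma sep_identity:
  assumes "A \<subseteq> carrier G" "g \<in> carrier G"
  shows "(\<Sum>B\<in>Pow A. sep_left y B * \<gamma> g (sep_right A y B)) = (\<Prod>h\<in>A. \<gamma> h (y h) - \<gamma> g (y h))"
proof -
  have fin: "finite A" using assms finite_G finite_subset by blast
  have "(\<Prod>h\<in>A. \<gamma> h (y h) - \<gamma> g (y h)) = (\<Prod>h\<in>A. \<gamma> h (y h) + \<gamma> g (- y h))"
    using assms by (simp add: \<gamma>_uminus)
  then show ?thesis
    unfolding prod_add[OF fin] sep_left_def sep_right_def using assms by (simp add: \<gamma>_prod)
qed

lemma sep_in:
  assumes "A \<subseteq> carrier G" "\<And>h. h \<in> A \<Longrightarrow> y h \<in> S 1" "B \<in> Pow A"
  shows "sep_left y B \<in> S (int (card B))"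
    and "sep_right A y B \<in> S (int (card A) - int (card B))"
proof -
  have BA: "B \<subseteq> A" using assms(3) by simp
  have fA: "finite A" by (rule finite_subset[OF assms(1) finite_G])
  then have fB: "finite B" by (rule finite_subset[OF BA])
  have "\<gamma> h (y h) \<in> S 1" if "h \<in> B" for h
    using that BA assms(1,2) \<gamma>_closed by blast
  from S_prod[OF fB this] show "sep_left y B \<in> S (int (card B))"
    unfolding sep_left_def by simp
  have "- y h \<in> S 1" if "h \<in> A - B" for h
    using that assms(2) S_uminus by blast
  from S_prod[of "A - B" "\<lambda>h. - y h" 1, OF finite_Diff[OF fA] this] show "sep_right A y B \<in> S (int (card A) - int (card B))"
    unfolding sep_right_def using card_Diff_subset[OF fB BA] card_mono[OF fA BA] by simp
qed

text \<open>Only \<open>h = g\<close> survives: any other \<open>h\<close> lies in \<open>A\<close>,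
  and the factor with index \<open>k = h\<close> is then
  \<open>\<gamma> h (y h) - \<gamma> h (y h)\<close>.\<close>

lemma sep_extract:
  assumes g: "g \<in> carrier G" and A: "A = carrier G - {g}"
  shows "(\<Sum>B\<in>Pow A. sep_left y B * (\<Sum>h\<in>carrier G. e h * \<gamma> h (sep_right A y B)))
    = e g * (\<Prod>h\<in>A. \<gamma> h (y h) - \<gamma> g (y h))"
proof -
  have fin: "finite A" using A finite_G by blast
  have "(\<Sum>B\<in>Pow A. sep_left y B * (\<Sum>h\<in>carrier G. e h * \<gamma> h (sep_right A y B)))
    = (\<Sum>h\<in>carrier G. e h * (\<Sum>B\<in>Pow A. sep_left y B * \<gamma> h (sep_right A y B)))"
    by (simp add: sum_distrib_left, subst sum.swap) (simp add: mult_ac)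
  also have "\<dots> = (\<Sum>h\<in>carrier G. e h * (\<Prod>k\<in>A. \<gamma> k (y k) - \<gamma> h (y k)))"
    by (intro sum.cong refl arg_cong2[of _ _ _ _ "(*)"] sep_identity) (use A in auto)
  also have "\<dots> = (\<Sum>h\<in>carrier G. if h = g then e g * (\<Prod>k\<in>A. \<gamma> k (y k) - \<gamma> g (y k)) else 0)"
  proof (intro sum.cong refl)
    fix h assume h: "h \<in> carrier G"
    show "e h * (\<Prod>k\<in>A. \<gamma> k (y k) - \<gamma> h (y k)) = (if h = g then e g * (\<Prod>k\<in>A. \<gamma> k (y k) - \<gamma> g (y k)) else 0)"
    proof (cases "h = g")
      case False
      then have "(\<Prod>k\<in>A. \<gamma> k (y k) - \<gamma> h (y k)) = 0"
        using A h fin by (intro prod_zero) auto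
      with False show ?thesis by simp
    qed simp
  qed
  also have "\<dots> = e g * (\<Prod>h\<in>A. \<gamma> h (y h) - \<gamma> g (y h))"
    using g finite_G by simp
  finally show ?thesis .
qed

lemma sep_exists:
  assumes g: "g \<in> carrier G"
  obtains y where "\<And>h. h \<in> carrier G - {g} \<Longrightarrow> y h \<in> S 1"
    and "(\<Prod>h\<in>carrier G - {g}. \<gamma> h (y h) - \<gamma> g (y h)) \<noteq> 0"
proof -
  have "\<forall>h\<in>carrier G - {g}. \<exists>y. y \<in> S 1 \<and> \<gamma> h y - \<gamma> g y \<noteq> 0"
    using no_reflections[OF g] by blast
  then obtain y where "\<forall>h\<in>carrier G - {g}. y h \<in> S 1 \<and> \<gamma> h (y h) - \<gamma> g (y h) \<noteq> 0"
    by metis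
  with that[of y] show ?thesis using finite_G by auto
qed

text \<open>Dedekind's independence of distinct automorphisms. The relation is evaluated at the
  elements \<open>sep_right\<close> and added up with weights \<open>sep_left\<close>; what remains
  is \<open>s g\<close> times a nonzero product in a domain.\<close>

lemma action_independent:
  assumes "\<And>n a. a \<in> S n \<Longrightarrow> (\<Sum>h\<in>carrier G. s h * \<gamma> h a) = 0" and g: "g \<in> carrier G"
  shows "s g = 0"
proof -
  obtain y where y: "\<And>h. h \<in> carrier G - {g} \<Longrightarrow> y h \<in> S 1"
    "(\<Prod>h\<in>carrier G - {g}. \<gamma> h (y h) - \<gamma> g (y h)) \<noteq> 0"
    using sep_exists[OF g] by blast
  have "s g * (\<Prod>h\<in>carrier G - {g}. \<gamma> h (y h) - \<gamma> g (y h)) = 0"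
    unfolding sep_extract[OF g refl, symmetric]
    by (intro sum.neutral ballI, subst assms(1)[OF sep_in(2)]) (use y(1) in auto)
  with y(2) show ?thesis by simp
qed

section \<open>Maps linear over the invariants and their expression through the group\<close>

text \<open>A family indexed by the degree, because it will be fed with symbols: the map in degree
  \<open>n\<close> arises from lifts to the \<open>n\<close>-th filtration step and is meaningful on
  \<open>S n\<close> only.\<close>

definition fixed_linear :: "int \<Rightarrow> (int \<Rightarrow> 's \<Rightarrow> 's) \<Rightarrow> bool" where
  "fixed_linear d f \<longleftrightarrow>
     (\<forall>n. \<forall>a\<in>S n. f n a \<in> S (n + d)) \<and>
     (\<forall>n. \<forall>a\<in>S n. \<forall>b\<in>S n. f n (a + b) = f n a + f n b) \<and>
     (\<forall>n m. \<forall>a\<in>S n. \<forall>t\<in>S_fix m. f (n + m) (a * t) = f n a * t)"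

lemma fixed_linear_sum:
  assumes f: "fixed_linear d f" and "finite K" "\<And>i. i \<in> K \<Longrightarrow> u i \<in> S n"
  shows "f n (sum u K) = (\<Sum>i\<in>K. f n (u i))"
  using assms(2,3)
proof (induction K rule: finite_induct)
  case empty
  have "f n (0 + 0) = f n 0 + f n 0"
    using f S_zero unfolding fixed_linear_def by blast
  then show ?case by (metis add.right_neutral add_left_cancel sum.empty)
next
  case (insert i K)
  then have "f n (u i + sum u K) = f n (u i) + f n (sum u K)"
    using f S_sum[of K u n] unfolding fixed_linear_def by blast
  with insert show ?case by simp
qed

text \<open>The trace form has a dual basis up to the factor \<open>D\<close>:
  \<open>D a = \<Sum>\<^sub>B b\<^sub>B tr (c\<^sub>B a)\<close>. A map that is linear over the invariants is therefore determined
  by its values on the \<open>b\<^sub>B\<close>.\<close>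

lemma fixed_linear_fraction:
  assumes f: "fixed_linear d f"
  obtains N M e where "N \<noteq> 0" "N \<in> S M" "\<And>h. h \<in> carrier G \<Longrightarrow> e h \<in> S (d + M)"
    "\<And>n a. a \<in> S n \<Longrightarrow> N * f n a = (\<Sum>h\<in>carrier G. e h * \<gamma> h a)"
proof -
  let ?A = "carrier G - {\<one>}"
  obtain y where y: "\<And>h. h \<in> ?A \<Longrightarrow> y h \<in> S 1"
    and nz: "(\<Prod>h\<in>?A. \<gamma> h (y h) - \<gamma> \<one> (y h)) \<noteq> 0"
    using sep_exists[OF one_closed] by blast
  define D where "D = (\<Prod>h\<in>?A. \<gamma> h (y h) - \<gamma> \<one> (y h))"
  define m where "m = int (card ?A)"
  define b where "b = sep_left y"
  define c where "c = sep_right ?A y"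
  have fA: "finite ?A" using finite_G by simp
  have b_in: "b B \<in> S (int (card B))" and c_in: "c B \<in> S (m - int (card B))" if "B \<in> Pow ?A" for B
    unfolding b_def c_def m_def using sep_in[OF _ y that] by auto
  have D_in: "D \<in> S m"
    unfolding D_def m_def using S_prod[OF fA, of "\<lambda>h. \<gamma> h (y h) - \<gamma> \<one> (y h)" 1] y
    by (auto intro!: S_diff \<gamma>_closed)
  have dual: "D * a = (\<Sum>B\<in>Pow ?A. b B * trace (c B * a))" if a: "a \<in> S n" for a n
  proof -
    have "(\<Sum>B\<in>Pow ?A. b B * trace (c B * a)) =
      (\<Sum>B\<in>Pow ?A. b B * (\<Sum>h\<in>carrier G. \<gamma> h a * \<gamma> h (c B)))"
      unfolding trace_def by (intro sum.cong refl arg_cong2[of _ _ _ _ "(*)"]) (auto simp: \<gamma>_mult mult_ac)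
    also have "\<dots> = \<gamma> \<one> a * D"
      unfolding b_def c_def D_def by (rule sep_extract) auto
    finally show ?thesis using a by (simp add: \<gamma>_one mult_ac)
  qed
  \<comment> \<open>With \<open>D * a\<close> written in the dual basis, linearity over the traces
    leaves \<open>f\<close> applied to the \<open>b B\<close>. Expanding each trace over the group,
    \<open>e1 h\<close> collects the coefficients of \<open>\<gamma> h a\<close>.\<close>
  define e1 where "e1 h = (\<Sum>B\<in>Pow ?A. f (int (card B)) (b B) * \<gamma> h (c B))" for h
  have e1_in: "e1 h \<in> S (d + m)" if h: "h \<in> carrier G" for h
    unfolding e1_def
  proof (intro S_sum)
    fix B assume B: "B \<in> Pow ?A"
    have "f (int (card B)) (b B) \<in> S (int (card B) + d)"
      using f b_in[OF B] unfolding fixed_linear_def by blast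
    from S_mult[OF this \<gamma>_closed[OF h c_in[OF B]]]
    show "f (int (card B)) (b B) * \<gamma> h (c B) \<in> S (d + m)" by (simp add: add.commute)
  qed
  have fD: "f (n + m) (D * a) = (\<Sum>h\<in>carrier G. e1 h * \<gamma> h a)" if a: "a \<in> S n" for a n
  proof -
    have *: "b B * trace (c B * a) \<in> S (n + m)
        \<and> f (n + m) (b B * trace (c B * a)) = f (int (card B)) (b B) * trace (c B * a)"
      if B: "B \<in> Pow ?A" for B
    proof -
      have t: "trace (c B * a) \<in> S_fix (m - int (card B) + n)"
        by (intro trace_in S_mult c_in B a)
      then have "f (int (card B) + (m - int (card B) + n)) (b B * trace (c B * a)) = f (int (card B)) (b B) * trace (c B * a)"
        using f b_in[OF B] unfolding fixed_linear_def by blast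
      moreover have "b B * trace (c B * a) \<in> S (int (card B) + (m - int (card B) + n))"
        using t b_in[OF B] by (intro S_mult) (auto simp: S_fix_def)
      ultimately show ?thesis by (simp add: add.commute)
    qed
    have "f (n + m) (D * a) = (\<Sum>B\<in>Pow ?A. f (int (card B)) (b B) * trace (c B * a))"
      unfolding dual[OF a] using fA * by (subst fixed_linear_sum[OF f]) auto
    also have "\<dots> = (\<Sum>h\<in>carrier G. e1 h * \<gamma> h a)"
      unfolding trace_def e1_def
      by (simp add: sum_distrib_left sum_distrib_right \<gamma>_mult, subst sum.swap) (simp add: mult_ac)
    finally show ?thesis .
  qed
  \<comment> \<open>\<open>D\<close> is not invariant, so \<open>f\<close> cannot be moved past it.
    Its norm \<open>N\<close> is: \<open>N * f n a\<close> is \<open>f\<close> of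
    \<open>N * a = D * (D' * a)\<close>, to which \<open>fD\<close> applies with
    \<open>D' * a\<close> in place of \<open>a\<close>.\<close>
  define N where "N = (\<Prod>h\<in>carrier G. \<gamma> h D)"
  define D' where "D' = (\<Prod>h\<in>?A. \<gamma> h D)"
  define M where "M = m * int (card (carrier G))"
  have N_split: "N = D * D'"
    unfolding N_def D'_def by (subst prod.remove[OF finite_G one_closed]) (simp add: \<gamma>_one[OF D_in])
  have N_in: "N \<in> S M"
    unfolding N_def M_def by (intro S_prod finite_G \<gamma>_closed D_in)
  have "\<gamma> g N = N" if "g \<in> carrier G" for g
    unfolding N_def \<gamma>_prod[OF that]
    by (subst prod_translate[OF that, symmetric], rule prod.cong) (auto simp: \<gamma>_comp that)
  then have N_fix: "N \<in> S_fix M" using N_in by (simp add: S_fix_def)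
  have "int (card ?A) + 1 = int (card (carrier G))"
    using card.remove[OF finite_G one_closed] by simp
  then have "m * int (card ?A) = M - m" unfolding M_def m_def by (simp add: algebra_simps flip: \<open>int (card ?A) + 1 = int (card (carrier G))\<close>)
  then have D'_in: "D' \<in> S (M - m)"
    unfolding D'_def using S_prod[OF fA, of "\<lambda>h. \<gamma> h D" m] D_in \<gamma>_closed by auto
  have N_nz: "N \<noteq> 0"
  proof -
    have "\<gamma> h D \<noteq> 0" if h: "h \<in> carrier G" for h
    proof
      assume "\<gamma> h D = 0"
      then have "\<gamma> (inv h \<otimes> h) D = 0" using h by (subst \<gamma>_comp) (auto simp: \<gamma>_zero)
      then show False using h nz \<gamma>_one[OF D_in] by (simp add: D_def)
    qed
    then show ?thesis unfolding N_def using finite_G by auto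
  qed
  show thesis
  proof (rule that[of N M "\<lambda>h. e1 h * \<gamma> h D'"])
    show "e1 h * \<gamma> h D' \<in> S (d + M)" if "h \<in> carrier G" for h
      using S_mult[OF e1_in[OF that] \<gamma>_closed[OF that D'_in]] by simp
    fix n a assume a: "a \<in> S n"
    have "N * f n a = f (n + M) (a * N)"
      using f a N_fix unfolding fixed_linear_def by (metis mult.commute)
    also have "\<dots> = f ((M - m + n) + m) (D * (D' * a))"
      by (simp add: N_split mult_ac add_ac)
    also have "\<dots> = (\<Sum>h\<in>carrier G. e1 h * \<gamma> h D' * \<gamma> h a)"
      by (subst fD[OF S_mult[OF D'_in a]]) (intro sum.cong refl, simp add: \<gamma>_mult mult_ac)
    finally show "N * f n a = (\<Sum>h\<in>carrier G. e1 h * \<gamma> h D' * \<gamma> h a)" .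
  qed (rule N_nz N_in)+
qed

text \<open>The hypothesis ranges over all \<open>y\<close> because each step compares two choices
  of a single \<open>y k\<close> with the others kept. With \<open>u1\<close>, \<open>u2\<close> the
  two factors at \<open>k\<close> and \<open>P\<close> the remaining product,
  \<open>e u1 P = N q1\<close> and \<open>e u2 P = N q2\<close> give \<open>u1 q2 = u2 q1\<close>.
  Coprimality makes \<open>u1\<close> divide \<open>q1\<close>, and then \<open>u1\<close> cancels
  from the first equation.\<close>

lemma peel_factors:
  assumes g: "g \<in> carrier G" and N: "N \<noteq> 0" and "finite A" "A \<subseteq> carrier G - {g}"
    and "\<And>y. (\<And>h. h \<in> A \<Longrightarrow> y h \<in> S 1) \<Longrightarrow>
      \<exists>q\<in>S (d + int (card A)). e * (\<Prod>h\<in>A. \<gamma> h (y h) - \<gamma> g (y h)) = N * q"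
  shows "\<exists>q\<in>S d. e = N * q"
  using assms(3-)
proof (induction A rule: finite_induct)
  case (insert k A)
  show ?case
  proof (rule insert.IH)
    fix y assume y: "\<And>h. h \<in> A \<Longrightarrow> y h \<in> S 1"
    define P where "P = (\<Prod>h\<in>A. \<gamma> h (y h) - \<gamma> g (y h))"
    have "k \<in> carrier G" "g \<noteq> k" using insert by auto
    from no_reflections[OF g this] obtain y1 y2 where y12: "y1 \<in> S 1" "y2 \<in> S 1" "\<gamma> k y1 - \<gamma> g y1 \<noteq> 0"
      and cop: "\<And>z a b. a \<in> S z \<Longrightarrow> b \<in> S z \<Longrightarrow> (\<gamma> k y1 - \<gamma> g y1) * b = (\<gamma> k y2 - \<gamma> g y2) * a \<Longrightarrow>
          (\<exists>c\<in>S (z - 1). a = (\<gamma> k y1 - \<gamma> g y1) * c)"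
      by meson
    have *: "\<exists>q\<in>S (d + int (card A) + 1). e * ((\<gamma> k y' - \<gamma> g y') * P) = N * q" if "y' \<in> S 1" for y'
    proof -
      have "\<exists>q\<in>S (d + int (card (insert k A))). e * (\<Prod>h\<in>insert k A. \<gamma> h ((y(k := y')) h) - \<gamma> g ((y(k := y')) h)) = N * q"
        by (rule insert.prems) (use that y in auto)
      moreover have "(\<Prod>h\<in>A. \<gamma> h ((y(k := y')) h) - \<gamma> g ((y(k := y')) h)) = P"
        unfolding P_def using insert by (intro prod.cong) auto
      ultimately show ?thesis using insert.hyps by (simp add: ac_simps)
    qed
    from *[OF y12(1)] obtain q1 where q1: "q1 \<in> S (d + int (card A) + 1)" "e * ((\<gamma> k y1 - \<gamma> g y1) * P) = N * q1"
      by blast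
    from *[OF y12(2)] obtain q2 where q2: "q2 \<in> S (d + int (card A) + 1)" "e * ((\<gamma> k y2 - \<gamma> g y2) * P) = N * q2"
      by blast
    have "N * ((\<gamma> k y1 - \<gamma> g y1) * q2) = (\<gamma> k y1 - \<gamma> g y1) * (N * q2)" by (simp only: mult_ac)
    also have "\<dots> = (\<gamma> k y2 - \<gamma> g y2) * (N * q1)"
      unfolding q1(2)[symmetric] q2(2)[symmetric] by (simp only: mult_ac)
    finally have "(\<gamma> k y1 - \<gamma> g y1) * q2 = (\<gamma> k y2 - \<gamma> g y2) * q1"
      using N by (simp only: mult.left_commute[of _ N] mult_cancel_left) simp
    from cop[OF q1(1) q2(1) this] obtain c where c: "c \<in> S (d + int (card A))" "q1 = (\<gamma> k y1 - \<gamma> g y1) * c"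
      by auto
    have "(\<gamma> k y1 - \<gamma> g y1) * (e * P) = (\<gamma> k y1 - \<gamma> g y1) * (N * c)"
      using q1(2) unfolding c(2) by (simp only: mult_ac)
    then have "e * P = N * c" using y12(3) by (simp only: mult_cancel_left) simp
    with c(1) show "\<exists>q\<in>S (d + int (card A)). e * (\<Prod>h\<in>A. \<gamma> h (y h) - \<gamma> g (y h)) = N * q"
      unfolding P_def by blast
  next
    show "A \<subseteq> carrier G - {g}" using insert.prems by blast
  qed
next
  case empty
  from empty.prems(2)[of "\<lambda>_. 0"] show ?case by simp
qed

theorem graded_auslander:
  assumes f: "fixed_linear d f"
  obtains s where "\<And>h. h \<in> carrier G \<Longrightarrow> s h \<in> S d"
    and "\<And>n a. a \<in> S n \<Longrightarrow> f n a = (\<Sum>h\<in>carrier G. s h * \<gamma> h a)"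
proof -
  obtain N M e where N: "N \<noteq> 0" "N \<in> S M" and e: "\<And>h. h \<in> carrier G \<Longrightarrow> e h \<in> S (d + M)"
    and Nf: "\<And>n a. a \<in> S n \<Longrightarrow> N * f n a = (\<Sum>h\<in>carrier G. e h * \<gamma> h a)"
    using fixed_linear_fraction[OF f] by blast
  have "\<exists>q\<in>S d. e g = N * q" if g: "g \<in> carrier G" for g
  proof (rule peel_factors[OF g N(1), of "carrier G - {g}"])
    let ?A = "carrier G - {g}"
    fix y assume y: "\<And>h. h \<in> ?A \<Longrightarrow> y h \<in> S 1"
    let ?b = "sep_left y" and ?c = "sep_right ?A y"
    have in_S: "?b B \<in> S (int (card B))" "?c B \<in> S (int (card ?A) - int (card B))" if "B \<in> Pow ?A" for B
      using sep_in[OF _ y that] by auto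
    \<comment> \<open>The quotient is explicit. Multiplied by \<open>N\<close>, each value of
      \<open>f\<close> at \<open>?c B\<close> becomes a sum of the
      \<open>e h * \<gamma> h (?c B)\<close>, and \<open>sep_extract\<close> collapses the weighted
      total to the term of \<open>g\<close>.\<close>
    let ?q = "\<Sum>B\<in>Pow ?A. ?b B * f (int (card ?A) - int (card B)) (?c B)"
    have "?q \<in> S (d + int (card ?A))"
    proof (intro S_sum)
      fix B assume B: "B \<in> Pow ?A"
      have "f (int (card ?A) - int (card B)) (?c B) \<in> S (int (card ?A) - int (card B) + d)"
        using f in_S(2)[OF B] unfolding fixed_linear_def by blast
      from S_mult[OF in_S(1)[OF B] this]
      show "?b B * f (int (card ?A) - int (card B)) (?c B) \<in> S (d + int (card ?A))"
        by (simp add: add.commute)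
    qed
    moreover have "e g * (\<Prod>h\<in>?A. \<gamma> h (y h) - \<gamma> g (y h)) = N * ?q"
      unfolding sep_extract[OF g refl, symmetric] sum_distrib_left[of N]
      by (intro sum.cong refl) (simp only: Nf[OF in_S(2), symmetric] mult.left_commute)
    ultimately show "\<exists>q\<in>S (d + int (card ?A)). e g * (\<Prod>h\<in>?A. \<gamma> h (y h) - \<gamma> g (y h)) = N * q"
      by blast
  qed (use finite_G in auto)
  then obtain s where s: "\<And>h. h \<in> carrier G \<Longrightarrow> s h \<in> S d \<and> e h = N * s h"
    by metis
  show thesis
  proof (rule that)
    fix n a assume a: "a \<in> S n"
    have "N * f n a = N * (\<Sum>h\<in>carrier G. s h * \<gamma> h a)"
      unfolding Nf[OF a] sum_distrib_left by (intro sum.cong refl) (simp add: s mult.assoc)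
    then show "f n a = (\<Sum>h\<in>carrier G. s h * \<gamma> h a)" using N(1) by simp
  qed (use s in auto)
qed

section \<open>Forms of high degree and finiteness over the invariants\<close>

text \<open>The degree \<open>n\<close> component of the ideal generated by invariants of positive
  degree (the Hilbert ideal). It is built one product at a time so that \<open>endo_bounded\<close>
  can induct over the summands of a symbol.\<close>

inductive_set decomposable :: "int \<Rightarrow> 's set" for n where
  decomposable_zero: "0 \<in> decomposable n"
| decomposable_add: "u \<in> S i \<Longrightarrow> i < n \<Longrightarrow> t \<in> S_fix (n - i) \<Longrightarrow> a \<in> decomposable n \<Longrightarrow> u * t + a \<in> decomposable n"

lemma decomposable_plus: "a \<in> decomposable n \<Longrightarrow> b \<in> decomposable n \<Longrightarrow> a + b \<in> decomposable n"
  by (induction rule: decomposable.induct) (auto simp: add.assoc intro: decomposable_add)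

lemma decomposable_sum: "(\<And>i. i \<in> K \<Longrightarrow> f i \<in> decomposable n) \<Longrightarrow> sum f K \<in> decomposable n"
  by (induction K rule: infinite_finite_induct) (auto intro: decomposable_zero decomposable_plus)

text \<open>Fogarty's argument: for every \<open>g\<close> the product of the \<open>v\<^sub>h - g h\<^sup>-\<^sup>1 v\<^sub>h\<close> vanishes. Expanding
  and summing over \<open>g\<close> expresses \<open>|G| \<Prod>v\<^sub>h\<close> through traces of positive degree.\<close>

lemma prod_in_decomposable:
  assumes v: "\<And>h. h \<in> carrier G \<Longrightarrow> v h \<in> S 1" and q: "q \<in> S (n - int (card (carrier G)))"
  shows "(\<Prod>h\<in>carrier G. v h) * q \<in> decomposable n"
proof -
  \<comment> \<open>Chosen so that \<open>\<gamma> h (y h) = v h\<close>; the full subset then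
    contributes the product of the \<open>v h\<close> themselves.\<close>
  define y where "y h = \<gamma> (inv h) (v h)" for h
  let ?G = "carrier G"
  have y: "y h \<in> S 1" if "h \<in> ?G" for h
    unfolding y_def by (intro \<gamma>_closed v inv_closed that)
  have \<gamma>y: "\<gamma> h (y h) = v h" if "h \<in> ?G" for h
    unfolding y_def using that by (subst \<gamma>_comp[symmetric]) (auto intro!: \<gamma>_one v)
  let ?b = "sep_left y" and ?c = "sep_right ?G y"
  have "(\<Sum>B\<in>Pow ?G. ?b B * trace (?c B)) = (\<Sum>g\<in>?G. \<Sum>B\<in>Pow ?G. ?b B * \<gamma> g (?c B))"
    unfolding trace_def sum_distrib_left by (rule sum.swap)
  also have "\<dots> = 0"
  proof (rule sum.neutral, rule ballI)
    fix g assume g: "g \<in> ?G"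
    have "(\<Sum>B\<in>Pow ?G. ?b B * \<gamma> g (?c B)) = (\<Prod>h\<in>?G. \<gamma> h (y h) - \<gamma> g (y h))"
      by (rule sep_identity) (use g in auto)
    also have "\<dots> = 0" using g finite_G by (intro prod_zero) auto
    finally show "(\<Sum>B\<in>Pow ?G. ?b B * \<gamma> g (?c B)) = 0" .
  qed
  \<comment> \<open>For the full subset \<open>?c ?G\<close> is an empty product and its trace is
    |G|. For every other \<open>B\<close> the trace is an invariant of degree
    \<open>card ?G - card B > 0\<close>.\<close>
  finally have sum0: "?b ?G * trace (?c ?G) + (\<Sum>B\<in>Pow ?G - {?G}. ?b B * trace (?c B)) = 0"
    using finite_G by (subst sum.remove[symmetric]) auto
  have "?b ?G = (\<Prod>h\<in>?G. v h)"
    unfolding sep_left_def by (intro prod.cong refl \<gamma>y)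
  moreover have "trace (?c ?G) = of_nat (card ?G)"
    by (simp add: sep_right_def trace_def \<gamma>_1)
  ultimately have v_eq: "of_nat (card ?G) * (\<Prod>h\<in>?G. v h) = - (\<Sum>B\<in>Pow ?G - {?G}. ?b B * trace (?c B))"
    using sum0 by (simp add: eq_neg_iff_add_eq_0 mult.commute)
  obtain q' where q': "q' \<in> S (n - int (card ?G))" "q = of_nat (card ?G) * q'"
    using S_divide[OF q] by blast
  have "(\<Prod>h\<in>?G. v h) * q = (of_nat (card ?G) * (\<Prod>h\<in>?G. v h)) * q'"
    unfolding q'(2) by (simp only: mult_ac)
  also have "\<dots> = (\<Sum>B\<in>Pow ?G - {?G}. (- ?b B * q') * trace (?c B))"
    unfolding v_eq sum_negf[symmetric] sum_distrib_right by (intro sum.cong refl) (simp add: mult_ac)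
  also have "\<dots> \<in> decomposable n"
  proof (rule decomposable_sum)
    fix B assume B: "B \<in> Pow ?G - {?G}"
    then have "B \<subset> ?G" by auto
    then have lt: "card B < card ?G" using finite_G psubset_card_mono by blast
    have B': "B \<in> Pow ?G" using B by auto
    have "trace (?c B) \<in> S_fix (int (card ?G) - int (card B))"
      by (rule trace_in, rule sep_in) (use B' y in auto)
    moreover have "- ?b B * q' \<in> S (int (card B) + (n - int (card ?G)))"
      by (intro S_mult S_uminus q' sep_in(1)[OF _ _ B']) (use y in auto)
    ultimately have "(- ?b B * q') * trace (?c B) + 0 \<in> decomposable n"
      using lt by (intro decomposable_add[of _ "int (card B) + (n - int (card ?G))"] decomposable_zero) (auto simp: algebra_simps)
    then show "(- ?b B * q') * trace (?c B) \<in> decomposable n" by simp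
  qed
  finally show ?thesis .
qed

text \<open>A form of degree at least |G| is a sum of products of |G| linear forms with some
  cofactor. The claim \<open>P A\<close> descends from \<open>carrier G\<close>, where it is
  \<open>prod_in_decomposable\<close>, to the empty set: the cofactor still has positive degree, so
  \<open>S_generated\<close> splits off a generator \<open>x j\<close>, which takes the place of the
  missing factor at \<open>k\<close>.\<close>

lemma S_subset_decomposable:
  assumes a: "a \<in> S n" and n: "n \<ge> int (card (carrier G))"
  shows "a \<in> decomposable n"
proof -
  define P where "P A \<longleftrightarrow> (\<forall>v q. (\<forall>h\<in>A. v h \<in> S 1) \<longrightarrow> q \<in> S (n - int (card A)) \<longrightarrow>
    (\<Prod>h\<in>A. v h) * q \<in> decomposable n)" for A :: "'h set"
  have "P {}" if "finite A" "A \<subseteq> carrier G" "P A" for A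
    using that
  proof (induction A rule: finite_induct)
    case (insert k A)
    have "P A" unfolding P_def
    proof (intro allI impI)
      fix v q assume v: "\<forall>h\<in>A. v h \<in> S 1" and q: "q \<in> S (n - int (card A))"
      have "card (insert k A) \<le> card (carrier G)"
        using insert finite_G by (intro card_mono) auto
      then have "n - int (card A) > 0" using insert n by simp
      from S_generated[OF q this] obtain r where r: "\<And>j. j \<in> J \<Longrightarrow> r j \<in> S (n - int (card A) - 1)"
        and q_eq: "q = (\<Sum>j\<in>J. x j * r j)" by blast
      have "(\<Prod>h\<in>A. v h) * q = (\<Sum>j\<in>J. (\<Prod>h\<in>insert k A. (v(k := x j)) h) * r j)"
        unfolding q_eq sum_distrib_left
      proof (intro sum.cong refl)
        fix j
        have "(\<Prod>h\<in>A. (v(k := x j)) h) = (\<Prod>h\<in>A. v h)"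
          using insert by (intro prod.cong) auto
        then show "(\<Prod>h\<in>A. v h) * (x j * r j) = (\<Prod>h\<in>insert k A. (v(k := x j)) h) * r j"
          using insert by (simp add: mult_ac)
      qed
      also have "\<dots> \<in> decomposable n"
      proof (rule decomposable_sum)
        fix j assume j: "j \<in> J"
        have "\<forall>h\<in>insert k A. (v(k := x j)) h \<in> S 1" using v x_in[OF j] by auto
        moreover have "r j \<in> S (n - int (card (insert k A)))"
          using r[OF j] insert by (simp add: algebra_simps)
        ultimately show "(\<Prod>h\<in>insert k A. (v(k := x j)) h) * r j \<in> decomposable n"
          using insert.prems unfolding P_def by blast
      qed
      finally show "(\<Prod>h\<in>A. v h) * q \<in> decomposable n" .
    qed
    then show ?case using insert by blast
  qed
  moreover have "P (carrier G)" unfolding P_def using prod_in_decomposable by blast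
  ultimately have "P {}" using finite_G by blast
  then show ?thesis using a unfolding P_def by fastforce
qed

text \<open>Serves to bound an endomorphism in the finitely many degrees that the decomposition of
  high-degree forms does not reach.\<close>

lemma S_finitely_spanned:
  "\<exists>B. finite B \<and> B \<subseteq> S z \<and> (\<forall>a\<in>S z. \<exists>c. (\<forall>b\<in>B. c b \<in> S 0) \<and> a = (\<Sum>b\<in>B. b * c b))"
proof (cases "z < 0")
  case True
  then show ?thesis by (intro exI[of _ "{}"]) (simp add: S_neg)
next
  case False
  have "\<exists>B. finite B \<and> B \<subseteq> S (int n) \<and> (\<forall>a\<in>S (int n). \<exists>c. (\<forall>b\<in>B. c b \<in> S 0) \<and> a = (\<Sum>b\<in>B. b * c b))" for n
  proof (induction n)
    case 0
    have "\<exists>c. (\<forall>b\<in>{1}. c b \<in> S 0) \<and> a = (\<Sum>b\<in>{1}. b * c b)" if "a \<in> S 0" for a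
      by (rule exI[of _ "\<lambda>_. a"]) (simp add: that)
    then show ?case using S_one by (intro exI[of _ "{1}"]) simp
  next
    case (Suc n)
    then obtain B where B: "finite B" "B \<subseteq> S (int n)"
      and sp: "\<And>a. a \<in> S (int n) \<Longrightarrow> \<exists>c. (\<forall>b\<in>B. c b \<in> S 0) \<and> a = (\<Sum>b\<in>B. b * c b)"
      by blast
    let ?B = "(\<lambda>(j, b). x j * b) ` (J \<times> B)"
    have "\<exists>c. (\<forall>b\<in>?B. c b \<in> S 0) \<and> a = (\<Sum>b\<in>?B. b * c b)" if a: "a \<in> S (int (Suc n))" for a
    proof -
      from S_generated[OF a] obtain q where q: "\<And>j. j \<in> J \<Longrightarrow> q j \<in> S (int n)" and a_eq: "a = (\<Sum>j\<in>J. x j * q j)"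
        by auto
      from sp[OF q] have "\<forall>j\<in>J. \<exists>c. (\<forall>b\<in>B. c b \<in> S 0) \<and> q j = (\<Sum>b\<in>B. b * c b)" by blast
      then obtain c where c: "\<And>j b. j \<in> J \<Longrightarrow> b \<in> B \<Longrightarrow> c j b \<in> S 0"
        and q_eq: "\<And>j. j \<in> J \<Longrightarrow> q j = (\<Sum>b\<in>B. b * c j b)"
        by metis
      \<comment> \<open>Different pairs may give the same product \<open>x j * b\<close>, so the
        coefficients over each fibre are added.\<close>
      define c' where "c' p = (\<Sum>(j, b)\<in>{i \<in> J \<times> B. (\<lambda>(j, b). x j * b) i = p}. c j b)" for p
      have "a = (\<Sum>j\<in>J. \<Sum>b\<in>B. (x j * b) * c j b)"
        unfolding a_eq by (intro sum.cong refl) (simp add: q_eq sum_distrib_left mult.assoc)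
      also have "\<dots> = (\<Sum>i\<in>J \<times> B. (case i of (j, b) \<Rightarrow> (x j * b) * c j b))"
        by (simp add: sum.cartesian_product)
      also have "\<dots> = (\<Sum>p\<in>?B. \<Sum>i\<in>{i \<in> J \<times> B. (\<lambda>(j, b). x j * b) i = p}. (case i of (j, b) \<Rightarrow> (x j * b) * c j b))"
        using finite_J B by (intro sum.image_gen) auto
      also have "\<dots> = (\<Sum>p\<in>?B. p * c' p)"
        unfolding c'_def sum_distrib_left by (intro sum.cong refl) auto
      finally have "a = (\<Sum>p\<in>?B. p * c' p)" .
      moreover have "\<forall>p\<in>?B. c' p \<in> S 0"
        unfolding c'_def by (auto intro!: S_sum c)
      ultimately show ?thesis by blast
    qed
    moreover have "?B \<subseteq> S (int (Suc n))"
    proof -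
      have "x j * b \<in> S (1 + int n)" if "j \<in> J" "b \<in> B" for j b
        using that B x_in by (intro S_mult) auto
      then show ?thesis by auto
    qed
    moreover have "finite ?B" using B finite_J by simp
    ultimately show ?case by blast
  qed
  from this[of "nat z"] False show ?thesis by simp
qed

end

section \<open>Lifting along a filtration\<close>

text \<open>
  \<open>E z\<close> is the preimage in the ring \<open>'a\<close> of the \<open>z\<close>-th filtration step of a quotient of \<open>'a\<close>, so
  \<open>E (-1)\<close> is the ideal that is divided out, and \<open>sy z\<close> is the symbol of degree \<open>z\<close>.
\<close>

locale filtered_symbol = graded_action G S \<gamma> J x
  for G :: "'h monoid" (structure) and S :: "int \<Rightarrow> 's::idom set"
    and \<gamma> :: "'h \<Rightarrow> 's \<Rightarrow> 's" and J :: "'j set" and x :: "'j \<Rightarrow> 's" +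
  fixes E :: "int \<Rightarrow> 'a::ring_1 set" and sy :: "int \<Rightarrow> 'a \<Rightarrow> 's" and act :: "'h \<Rightarrow> 'a \<Rightarrow> 'a"
  assumes E_zero: "0 \<in> E z"
    and E_add: "a \<in> E z \<Longrightarrow> b \<in> E z \<Longrightarrow> a + b \<in> E z"
    and E_uminus: "a \<in> E z \<Longrightarrow> - a \<in> E z"
    and E_step: "E z \<subseteq> E (z + 1)"
    and E_mult: "a \<in> E m \<Longrightarrow> b \<in> E n \<Longrightarrow> a * b \<in> E (m + n)"
    and E_neg: "z < 0 \<Longrightarrow> E z = E (-1)"
    and E_exhaust: "\<exists>z. a \<in> E z"
    and sy_in: "a \<in> E z \<Longrightarrow> sy z a \<in> S z"
    and sy_add: "a \<in> E z \<Longrightarrow> b \<in> E z \<Longrightarrow> sy z (a + b) = sy z a + sy z b"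
    and sy_mult: "a \<in> E m \<Longrightarrow> b \<in> E n \<Longrightarrow> sy (m + n) (a * b) = sy m a * sy n b"
    and sy_kernel: "a \<in> E z \<Longrightarrow> sy z a = 0 \<longleftrightarrow> a \<in> E (z - 1)"
    and sy_onto: "s \<in> S z \<Longrightarrow> \<exists>a\<in>E z. sy z a = s"
    and act_add: "h \<in> carrier G \<Longrightarrow> act h (a + b) = act h a + act h b"
    and act_comp: "g \<in> carrier G \<Longrightarrow> h \<in> carrier G \<Longrightarrow> act (g \<otimes> h) a = act g (act h a)"
    and act_mult: "h \<in> carrier G \<Longrightarrow> act h (a * b) = act h a * act h b"
    and act_E: "h \<in> carrier G \<Longrightarrow> a \<in> E z \<Longrightarrow> act h a \<in> E z"
    and sy_act: "h \<in> carrier G \<Longrightarrow> a \<in> E z \<Longrightarrow> sy z (act h a) = \<gamma> h (sy z a)"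
begin

lemma act_zero: assumes "h \<in> carrier G" shows "act h 0 = 0"
  using act_add[OF assms, of 0 0] by (metis add.right_neutral add_left_cancel)

lemma act_sum: "h \<in> carrier G \<Longrightarrow> act h (sum f K) = (\<Sum>i\<in>K. act h (f i))"
  by (induction K rule: infinite_finite_induct) (auto simp: act_zero act_add)

lemma E_mono: "m \<le> n \<Longrightarrow> E m \<subseteq> E n"
proof -
  assume "m \<le> n"
  have "E m \<subseteq> E (m + int k)" for k
  proof (induction k)
    case (Suc k)
    then show ?case using E_step[of "m + int k"] by (auto simp: algebra_simps)
  qed simp
  from this[of "nat (n - m)"] \<open>m \<le> n\<close> show ?thesis by simp
qed

lemma E_least: "E (-1) \<subseteq> E z"
  using E_mono[of "-1" z] E_neg[of z] by (cases "z < 0") auto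

lemma E_diff: "a \<in> E z \<Longrightarrow> b \<in> E z \<Longrightarrow> a - b \<in> E z"
  using E_add[of a z "- b"] E_uminus[of b z] by simp

lemma E_sum: "(\<And>i. i \<in> K \<Longrightarrow> f i \<in> E z) \<Longrightarrow> sum f K \<in> E z"
  by (induction K rule: infinite_finite_induct) (auto simp: E_zero E_add)

lemma E_cong: assumes "a - b \<in> E (-1)" "b \<in> E z" shows "a \<in> E z"
proof -
  have "(a - b) + b \<in> E z" using assms E_least by (intro E_add) auto
  then show ?thesis by simp
qed

lemma E_ideal: "a \<in> E (-1) \<Longrightarrow> a * b \<in> E (-1)" "a \<in> E (-1) \<Longrightarrow> b * a \<in> E (-1)"
proof -
  assume a: "a \<in> E (-1)"
  obtain z where z: "b \<in> E z" using E_exhaust by blast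
  \<comment> \<open>All negative steps coincide with \<open>E (-1)\<close>, so \<open>a\<close> may
    be placed low enough to absorb the degree of \<open>b\<close>; the maximum keeps the chosen
    degree of \<open>a\<close> negative.\<close>
  have z': "b \<in> E (max z 0)" using z E_mono[of z "max z 0"] by auto
  have a': "a \<in> E (- 1 - max z 0)" using a E_neg[of "- 1 - max z 0"] by auto
  from E_mult[OF a' z'] E_mult[OF z' a'] show "a * b \<in> E (-1)" "b * a \<in> E (-1)" by simp_all
qed

lemma sy_zero: "sy z 0 = 0"
  using sy_kernel[OF E_zero] E_zero by blast

lemma sy_diff: assumes "a \<in> E z" "b \<in> E z" shows "sy z (a - b) = sy z a - sy z b"
  using sy_add[OF E_diff[OF assms] assms(2)] by simp

lemma sy_sum: "(\<And>i. i \<in> K \<Longrightarrow> f i \<in> E z) \<Longrightarrow> sy z (sum f K) = (\<Sum>i\<in>K. sy z (f i))"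
proof (induction K rule: infinite_finite_induct)
  case (insert i K)
  then have "sy z (f i + sum f K) = sy z (f i) + sy z (sum f K)"
    by (intro sy_add E_sum) auto
  with insert show ?case by simp
qed (auto simp: sy_zero)

lemma sy_eq_iff: "a \<in> E z \<Longrightarrow> b \<in> E z \<Longrightarrow> sy z a = sy z b \<longleftrightarrow> a - b \<in> E (z - 1)"
  using sy_diff[of a z b] sy_kernel[OF E_diff, of a z b] by auto

lemma sy_cong: assumes "a - b \<in> E (-1)" "b \<in> E z" shows "sy z a = sy z b"
  using sy_eq_iff[OF E_cong[OF assms] assms(2)] assms(1) E_least by blast

section \<open>Endomorphisms over the invariants, on representatives\<close>

definition E_fixed :: "'a set" where
  "E_fixed = {t. \<forall>h\<in>carrier G. act h t - t \<in> E (-1)}"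

text \<open>Averaging: \<open>s\<close> is divided by the group order, lifted, and the translates of
  the lift are added. The sum is fixed exactly; an arbitrary lift of \<open>s\<close> is fixed only
  up to lower degree.\<close>

lemma fixed_lift:
  assumes s: "s \<in> S_fix z"
  obtains t where "t \<in> E z" "t \<in> E_fixed" "sy z t = s"
proof -
  have sz: "s \<in> S z" and fix_s: "\<And>h. h \<in> carrier G \<Longrightarrow> \<gamma> h s = s"
    using s by (auto simp: S_fix_def)
  obtain r where r: "r \<in> S z" "of_nat (card (carrier G)) * r = s" using S_divide[OF sz] by blast
  obtain i :: 's where "of_nat (card (carrier G)) * i = 1" using S_divide[OF S_one] by blast
  then have nz: "of_nat (card (carrier G)) \<noteq> (0 :: 's)" by (metis mult_zero_left zero_neq_one)
  have \<gamma>_nat: "\<gamma> h (of_nat n * r) = of_nat n * \<gamma> h r" if "h \<in> carrier G" for h n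
    by (induction n) (auto simp: \<gamma>_zero \<gamma>_add that algebra_simps)
  have fix_r: "\<gamma> h r = r" if "h \<in> carrier G" for h
    using fix_s[OF that] \<gamma>_nat[OF that, of "card (carrier G)"] r(2) nz mult_left_cancel by metis
  obtain a where a: "a \<in> E z" "sy z a = r" using sy_onto[OF r(1)] by blast
  let ?t = "\<Sum>h\<in>carrier G. act h a"
  show thesis
  proof (rule that)
    show "?t \<in> E z" by (intro E_sum act_E a)
    have "act g ?t = ?t" if "g \<in> carrier G" for g
      unfolding act_sum[OF that]
      by (subst sum_translate[OF that, symmetric], rule sum.cong) (auto simp: act_comp that)
    then show "?t \<in> E_fixed" by (simp add: E_fixed_def E_zero)
    have "sy z ?t = (\<Sum>h\<in>carrier G. \<gamma> h (sy z a))"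
      using a by (subst sy_sum) (auto intro: act_E simp: sy_act)
    also have "\<dots> = (\<Sum>h\<in>carrier G. r)" by (intro sum.cong refl) (simp add: a fix_r)
    finally show "sy z ?t = s" using r(2) by simp
  qed
qed

text \<open>Elements of degree 0 play the part of scalars. Being invariant modulo
  \<open>E (-1)\<close>, they can be pulled out of every map that is linear over the
  invariants.\<close>

lemma E_0_fixed: assumes "t \<in> E 0" shows "t \<in> E_fixed"
proof -
  have "act h t - t \<in> E (0 - 1)" if h: "h \<in> carrier G" for h
    using sy_eq_iff[OF act_E[OF h assms] assms] sy_act[OF h assms] S_0_fixed[OF h sy_in[OF assms]] by simp
  then show ?thesis by (simp add: E_fixed_def)
qed

text \<open>What remains of an endomorphism of the quotient after choosing a representative for each
  value. The second condition says that the class of \<open>F p\<close> depends only on the class of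
  \<open>p\<close>, given additivity.\<close>

definition endo :: "('a \<Rightarrow> 'a) \<Rightarrow> bool" where
  "endo F \<longleftrightarrow> (\<forall>p q. F (p + q) - (F p + F q) \<in> E (-1)) \<and> (\<forall>p\<in>E (-1). F p \<in> E (-1)) \<and>
     (\<forall>p. \<forall>t\<in>E_fixed. F (p * t) - F p * t \<in> E (-1))"

definition degree_le :: "('a \<Rightarrow> 'a) \<Rightarrow> int \<Rightarrow> bool" where
  "degree_le F d \<longleftrightarrow> (\<forall>n. \<forall>a\<in>E n. F a \<in> E (n + d))"

lemma endo_add: "endo F \<Longrightarrow> F (p + q) - (F p + F q) \<in> E (-1)"
  and endo_null: "endo F \<Longrightarrow> p \<in> E (-1) \<Longrightarrow> F p \<in> E (-1)"
  and endo_mult: "endo F \<Longrightarrow> t \<in> E_fixed \<Longrightarrow> F (p * t) - F p * t \<in> E (-1)"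
  by (simp_all add: endo_def)

lemma endo_split: assumes "endo F" shows "F a - (F b + F (a - b)) \<in> E (-1)"
  using endo_add[OF assms, of b "a - b"] by simp

lemma endo_sum:
  assumes F: "endo F"
  shows "F (sum f K) - (\<Sum>i\<in>K. F (f i)) \<in> E (-1)"
proof (induction K rule: infinite_finite_induct)
  case (insert i K)
  have "(F (f i + sum f K) - (F (f i) + F (sum f K))) + (F (sum f K) - (\<Sum>i\<in>K. F (f i))) \<in> E (-1)"
    by (intro E_add endo_add F insert.IH)
  with insert show ?case by (simp add: algebra_simps)
qed (auto simp: endo_null[OF F] E_zero)

text \<open>Modulo the previous step, \<open>E (int n)\<close> is spanned over \<open>E 0\<close> by
  finitely many lifts \<open>u b\<close>, and each \<open>F (u b)\<close> lies in some step; the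
  maximum of these degrees works. The index \<open>int n - 1\<close> lets the induction start at the
  ideal \<open>E (-1)\<close>.\<close>

lemma endo_bounded_below:
  assumes F: "endo F"
  shows "\<exists>d. \<forall>a\<in>E (int n - 1). F a \<in> E d"
proof (induction n)
  case 0
  show ?case by (intro exI[of _ "-1"]) (simp add: endo_null[OF F])
next
  case (Suc n)
  then obtain d where d: "\<And>a. a \<in> E (int n - 1) \<Longrightarrow> F a \<in> E d" by blast
  obtain B where B: "finite B" "B \<subseteq> S (int n)"
    and sp: "\<And>a. a \<in> S (int n) \<Longrightarrow> \<exists>c. (\<forall>b\<in>B. c b \<in> S 0) \<and> a = (\<Sum>b\<in>B. b * c b)"
    using S_finitely_spanned[of "int n"] by blast
  have "\<forall>b\<in>B. \<exists>u. u \<in> E (int n) \<and> sy (int n) u = b" using sy_onto B by blast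
  then obtain u where u: "\<And>b. b \<in> B \<Longrightarrow> u b \<in> E (int n) \<and> sy (int n) (u b) = b" by metis
  have "\<forall>b. \<exists>z. F (u b) \<in> E z" using E_exhaust by blast
  then obtain e where e: "\<And>b. F (u b) \<in> E (e b)" by metis
  define D where "D = Max (insert d (e ` B))"
  have D: "d \<le> D" "\<And>b. b \<in> B \<Longrightarrow> e b \<le> D" unfolding D_def using B by auto
  have "F a \<in> E D" if a: "a \<in> E (int n)" for a
  proof -
    obtain c where c: "\<And>b. b \<in> B \<Longrightarrow> c b \<in> S 0" and a_eq: "sy (int n) a = (\<Sum>b\<in>B. b * c b)"
      using sp[OF sy_in[OF a]] by blast
    have "\<forall>b\<in>B. \<exists>t. t \<in> E 0 \<and> sy 0 t = c b" using sy_onto c by blast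
    then obtain t where t: "\<And>b. b \<in> B \<Longrightarrow> t b \<in> E 0 \<and> sy 0 (t b) = c b" by metis
    let ?r = "\<Sum>b\<in>B. u b * t b"
    have ut: "u b * t b \<in> E (int n)" "sy (int n) (u b * t b) = b * c b" if "b \<in> B" for b
      using E_mult[of "u b" "int n" "t b" 0] sy_mult[of "u b" "int n" "t b" 0] u[OF that] t[OF that] by simp_all
    have r: "?r \<in> E (int n)" by (intro E_sum ut)
    have "sy (int n) a = sy (int n) ?r"
      unfolding a_eq using ut by (simp add: sy_sum)
    then have "F (a - ?r) \<in> E d" using sy_eq_iff[OF a r] d by blast
    then have 1: "F (a - ?r) \<in> E D" using E_mono[OF D(1)] by blast
    have "F (u b * t b) \<in> E D" if b: "b \<in> B" for b
    proof (rule E_cong[OF endo_mult[OF F]])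
      have "F (u b) * t b \<in> E (e b + 0)" using e t[OF b] by (intro E_mult) auto
      then show "F (u b) * t b \<in> E D" using E_mono[OF D(2)[OF b]] by auto
    qed (use t b E_0_fixed in blast)
    then have "F ?r \<in> E D" by (intro E_cong[OF endo_sum[OF F]] E_sum)
    then show "F a \<in> E D" using 1 by (intro E_cong[OF endo_split[OF F, of a ?r]] E_add)
  qed
  then show ?case by (intro exI[of _ D]) simp
qed

text \<open>Below degree |G| the previous bound applies. From there on, the symbol is a sum of
  products \<open>u * t\<close> with \<open>t\<close> invariant of positive degree. Lifted to
  \<open>U * T\<close>, such a product satisfies \<open>F (U * T) = F U * T\<close> modulo the ideal
  with \<open>U\<close> of smaller degree, so the shift \<open>d\<close> does not grow.\<close>

lemma endo_bounded:
  assumes F: "endo F"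
  shows "\<exists>d. degree_le F d"
proof -
  let ?N = "int (card (carrier G))"
  obtain D where D: "\<And>a. a \<in> E (?N - 1) \<Longrightarrow> F a \<in> E D"
    using endo_bounded_below[OF F] by blast
  define d where "d = D + 1"
  have low: "F a \<in> E (n + d)" if "n < ?N" "a \<in> E n" for n a
  proof (cases "n < 0")
    case True
    then show ?thesis using that E_neg endo_null[OF F] E_least by blast
  next
    case False
    have "F a \<in> E D" using that E_mono[of n "?N - 1"] by (intro D) auto
    then show ?thesis using E_mono[of D "n + d"] False unfolding d_def by auto
  qed
  have "\<forall>a\<in>E (int n). F a \<in> E (int n + d)" for n
  proof (induction n rule: less_induct)
    case (less n)
    show ?case
    proof (cases "int n < ?N")
      case False
      have prev: "F a \<in> E (int n + d)" if a: "a \<in> E (int n - 1)" for a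
      proof (cases n)
        case (Suc m)
        then have "F a \<in> E (int m + d)" using less.IH[of m] a by auto
        then show ?thesis using E_mono[of "int m + d" "int n + d"] Suc by auto
      next
        case 0
        then have "F a \<in> E (-1)" using a endo_null[OF F] by auto
        then show ?thesis using E_least by blast
      qed
      \<comment> \<open>Induction over the symbol, for all elements having it: subtracting
        \<open>U * T\<close> changes the element but leaves one with the shorter symbol. When the
        symbol is 0, the element has lower degree and \<open>prev\<close> applies.\<close>
      have "\<forall>a\<in>E (int n). sy (int n) a = s \<longrightarrow> F a \<in> E (int n + d)" if "s \<in> decomposable (int n)" for s
        using that
      proof (induction rule: decomposable.induct)
        case decomposable_zero
        then show ?case using sy_kernel prev by blast
      next
        case (decomposable_add u i t s)
        show ?case
        proof (intro ballI impI)
          fix a assume a: "a \<in> E (int n)" and sa: "sy (int n) a = u * t + s"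
          obtain U where U: "U \<in> E i" "sy i U = u" using sy_onto[OF decomposable_add(1)] by blast
          obtain T where T: "T \<in> E (int n - i)" "T \<in> E_fixed" "sy (int n - i) T = t"
            using fixed_lift[OF decomposable_add(3)] by blast
          have UT: "U * T \<in> E (int n)" "sy (int n) (U * T) = u * t"
            using E_mult[OF U(1) T(1)] sy_mult[OF U(1) T(1)] U T by simp_all
          have "F (a - U * T) \<in> E (int n + d)"
            using decomposable_add.IH E_diff[OF a UT(1)] sy_diff[OF a UT(1)] UT(2) sa by simp
          moreover have "F U \<in> E (i + d)"
          proof (cases "i < 0")
            case True
            then show ?thesis using low U(1) by auto
          next
            case False
            then show ?thesis using less.IH[of "nat i"] decomposable_add(2) U(1) by auto
          qed
          from E_mult[OF this T(1)] have "F U * T \<in> E (int n + d)" by (simp add: algebra_simps)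
          then have "F (U * T) \<in> E (int n + d)"
            by (rule E_cong[OF endo_mult[OF F T(2)]])
          ultimately show "F a \<in> E (int n + d)"
            by (intro E_cong[OF endo_split[OF F, of a "U * T"]] E_add)
        qed
      qed
      moreover have "sy (int n) a \<in> decomposable (int n)" if "a \<in> E (int n)" for a
        using S_subset_decomposable[OF sy_in[OF that]] False by simp
      ultimately show ?thesis by blast
    next
      case True
      then show ?thesis using low by simp
    qed
  qed
  then have "F a \<in> E (n + d)" if "a \<in> E n" for n a
  proof (cases "n < 0")
    case True
    then show ?thesis using low that by auto
  next
    case False
    then have "n = int (nat n)" by simp
    with \<open>\<And>n. \<forall>a\<in>E (int n). F a \<in> E (int n + d)\<close> that show ?thesis by metis
  qed
  then show ?thesis unfolding degree_le_def by blast
qed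

section \<open>Comparison with the skew group ring\<close>

definition skew :: "('h \<Rightarrow> 'a) \<Rightarrow> 'a \<Rightarrow> 'a" where
  "skew a p = (\<Sum>h\<in>carrier G. a h * act h p)"

lemma skew_add: "skew a (p + q) = skew a p + skew a q"
  unfolding skew_def by (simp add: act_add algebra_simps sum.distrib)

lemma skew_null: "p \<in> E (-1) \<Longrightarrow> skew a p \<in> E (-1)"
  unfolding skew_def by (intro E_sum E_ideal(2) act_E)

lemma skew_mult:
  assumes "t \<in> E_fixed"
  shows "skew a (p * t) - skew a p * t \<in> E (-1)"
proof -
  have "skew a (p * t) - skew a p * t = (\<Sum>h\<in>carrier G. (a h * act h p) * (act h t - t))"
    unfolding skew_def sum_distrib_right sum_subtractf[symmetric]
    by (intro sum.cong refl) (simp add: act_mult algebra_simps)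
  also have "\<dots> \<in> E (-1)" using assms by (intro E_sum E_ideal) (simp add: E_fixed_def)
  finally show ?thesis .
qed

lemma skew_degree:
  assumes "\<And>h. h \<in> carrier G \<Longrightarrow> a h \<in> E d" and p: "p \<in> E n"
  shows "skew a p \<in> E (d + n)"
    and "sy (d + n) (skew a p) = (\<Sum>h\<in>carrier G. sy d (a h) * \<gamma> h (sy n p))"
proof -
  have *: "a h * act h p \<in> E (d + n)" if "h \<in> carrier G" for h
    by (intro E_mult assms act_E that)
  then show "skew a p \<in> E (d + n)" unfolding skew_def by (rule E_sum)
  show "sy (d + n) (skew a p) = (\<Sum>h\<in>carrier G. sy d (a h) * \<gamma> h (sy n p))"
    unfolding skew_def using *
    by (subst sy_sum) (auto intro!: sum.cong simp: sy_mult[OF assms(1) act_E] sy_act p)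
qed

lemma endo_minus_skew:
  assumes F: "endo F"
  shows "endo (\<lambda>p. F p - skew a p)"
  unfolding endo_def
proof (intro conjI allI ballI)
  fix p q
  show "F (p + q) - skew a (p + q) - (F p - skew a p + (F q - skew a q)) \<in> E (-1)"
    using endo_add[OF F, of p q] by (simp add: skew_add algebra_simps)
next
  fix p t assume t: "t \<in> E_fixed"
  show "F (p * t) - skew a (p * t) - (F p - skew a p) * t \<in> E (-1)"
    using E_diff[OF endo_mult[OF F t, of p] skew_mult[OF t, of a p]] by (simp add: algebra_simps)
qed (intro E_diff endo_null[OF F] skew_null)

lemma endo_reduce:
  assumes F: "endo F" and d: "degree_le F d"
  obtains a where "\<And>h. h \<in> carrier G \<Longrightarrow> a h \<in> E d" "degree_le (\<lambda>p. F p - skew a p) (d - 1)"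
proof -
  define l where "l n s = (SOME a. a \<in> E n \<and> sy n a = s)" for n s
  have l: "l n s \<in> E n" "sy n (l n s) = s" if "s \<in> S n" for n s
  proof -
    have "\<exists>a. a \<in> E n \<and> sy n a = s" using sy_onto[OF that] by blast
    from someI_ex[OF this] show "l n s \<in> E n" "sy n (l n s) = s" by (auto simp: l_def)
  qed
  define f where "f n s = sy (n + d) (F (l n s))" for n s
  have F_in: "F p \<in> E (n + d)" if "p \<in> E n" for n p using d that unfolding degree_le_def by blast
  \<comment> \<open>The leading term does not depend on the lift: two lifts of a symbol differ by an
    element of \<open>E (n - 1)\<close>, which \<open>F\<close> sends to
    \<open>E (n + d - 1)\<close>, the kernel of the symbol in degree \<open>n + d\<close>.\<close>
  have f_sy: "f n (sy n p) = sy (n + d) (F p)" if p: "p \<in> E n" for n p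
  proof -
    let ?q = "l n (sy n p)"
    have q: "?q \<in> E n" "sy n ?q = sy n p" using l sy_in[OF p] by auto
    then have "?q - p \<in> E (n - 1)" using sy_eq_iff p by blast
    from F_in[OF this] have "F (?q - p) \<in> E (n + d - 1)" by (simp add: algebra_simps)
    moreover have "F ?q - F p - F (?q - p) \<in> E (n + d - 1)"
      using endo_split[OF F, of ?q p] E_least by (auto simp: algebra_simps)
    ultimately have "F ?q - F p \<in> E (n + d - 1)" using E_add by fastforce
    then show ?thesis unfolding f_def using sy_eq_iff[OF F_in[OF q(1)] F_in[OF p]] by simp
  qed
  have "fixed_linear d f"
    unfolding fixed_linear_def
  proof (intro conjI allI ballI)
    fix n s assume "s \<in> S n"
    then show "f n s \<in> S (n + d)" unfolding f_def by (intro sy_in F_in l)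
  next
    fix n s s' assume s: "s \<in> S n" and s': "s' \<in> S n"
    have "f n (s + s') = f n (sy n (l n s + l n s'))"
      using s s' by (simp add: sy_add l)
    also have "\<dots> = sy (n + d) (F (l n s + l n s'))"
      using s s' by (intro f_sy E_add l)
    also have "\<dots> = sy (n + d) (F (l n s) + F (l n s'))"
      using s s' by (intro sy_cong endo_add F E_add F_in l)
    also have "\<dots> = f n s + f n s'"
      unfolding f_def using s s' by (intro sy_add F_in l)
    finally show "f n (s + s') = f n s + f n s'" .
  next
    fix n m s t assume s: "s \<in> S n" and t: "t \<in> S_fix m"
    \<comment> \<open>An invariant symbol must be lifted to an invariant element, since
      \<open>F\<close> is linear only over those.\<close>
    obtain T where T: "T \<in> E m" "T \<in> E_fixed" "sy m T = t" using fixed_lift[OF t] by blast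
    have "f (n + m) (s * t) = f (n + m) (sy (n + m) (l n s * T))"
      using s T by (simp add: sy_mult l)
    also have "\<dots> = sy (n + m + d) (F (l n s * T))"
      using s T by (intro f_sy E_mult l)
    also have "\<dots> = sy (n + d + m) (F (l n s) * T)"
      using E_mult[OF F_in[OF l(1)[OF s]] T(1)]
      by (subst sy_cong[OF endo_mult[OF F T(2)]]) (simp_all add: algebra_simps)
    also have "\<dots> = f n s * t"
      unfolding f_def T(3)[symmetric] using s T by (intro sy_mult F_in l)
    finally show "f (n + m) (s * t) = f n s * t" .
  qed
  then obtain s where s: "\<And>h. h \<in> carrier G \<Longrightarrow> s h \<in> S d"
    and fs: "\<And>n p. p \<in> S n \<Longrightarrow> f n p = (\<Sum>h\<in>carrier G. s h * \<gamma> h p)"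
    using graded_auslander by blast
  show thesis
  proof (rule that[of "\<lambda>h. l d (s h)"])
    show "degree_le (\<lambda>p. F p - skew (\<lambda>h. l d (s h)) p) (d - 1)"
      unfolding degree_le_def
    proof (intro allI ballI)
      fix n p assume p: "p \<in> E n"
      have ls: "l d (s h) \<in> E d" if "h \<in> carrier G" for h using l(1)[OF s[OF that]] .
      have "sy (d + n) (skew (\<lambda>h. l d (s h)) p) = (\<Sum>h\<in>carrier G. sy d (l d (s h)) * \<gamma> h (sy n p))"
        by (rule skew_degree(2)[OF ls p])
      also have "\<dots> = f n (sy n p)"
        unfolding fs[OF sy_in[OF p]] by (intro sum.cong refl) (simp add: l s)
      also have "\<dots> = sy (n + d) (F p)" by (rule f_sy[OF p])
      finally have "sy (n + d) (skew (\<lambda>h. l d (s h)) p) = sy (n + d) (F p)"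
        by (simp add: add.commute)
      moreover have "skew (\<lambda>h. l d (s h)) p \<in> E (n + d)"
        using skew_degree(1)[OF ls p] by (simp add: add.commute)
      ultimately have "F p - skew (\<lambda>h. l d (s h)) p \<in> E (n + d - 1)"
        using sy_eq_iff[OF F_in[OF p], of "skew (\<lambda>h. l d (s h)) p"] by simp
      then show "F p - skew (\<lambda>h. l d (s h)) p \<in> E (n + (d - 1))" by (simp add: algebra_simps)
    qed
  next
    show "l d (s h) \<in> E d" if "h \<in> carrier G" for h using l(1)[OF s[OF that]] .
  qed
qed

theorem endo_is_skew:
  assumes F: "endo F"
  shows "\<exists>a. \<forall>p. F p - skew a p \<in> E (-1)"
proof -
  have "\<exists>a. \<forall>p. F p - skew a p \<in> E (-1)" if "endo F" "degree_le F (int k - 1)" for F k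
    using that
  proof (induction k arbitrary: F)
    case 0
    \<comment> \<open>In negative degree the coefficients produced by \<open>endo_reduce\<close> lie
      in \<open>E (-1)\<close>, so the correction vanishes modulo the ideal and \<open>F\<close>
      itself drops in degree. Repeating this forces \<open>F p\<close> into \<open>E (-1)\<close>
      for every \<open>p\<close>.\<close>
    have "degree_le F (- 1 - int j)" for j
    proof (induction j)
      case (Suc j)
      obtain a where a: "\<And>h. h \<in> carrier G \<Longrightarrow> a h \<in> E (- 1 - int j)"
        and le: "degree_le (\<lambda>p. F p - skew a p) (- 1 - int j - 1)"
        using endo_reduce[OF 0(1) Suc] by blast
      have a': "a h \<in> E (-1)" if "h \<in> carrier G" for h
        using a[OF that] E_neg[of "- 1 - int j"] by auto
      have "F p \<in> E (n + (- 1 - int (Suc j)))" if p: "p \<in> E n" for n p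
      proof (rule E_cong)
        show "F p - (F p - skew a p) \<in> E (-1)"
          unfolding skew_def using a' by (auto intro!: E_sum E_ideal(1))
        show "F p - skew a p \<in> E (n + (- 1 - int (Suc j)))"
          using le p unfolding degree_le_def by (force simp: algebra_simps)
      qed
      then show ?case unfolding degree_le_def by blast
    qed (use 0 in simp)
    then have "F p \<in> E (-1)" for p
    proof -
      obtain n where n: "p \<in> E n" using E_exhaust by blast
      have "F p \<in> E (n + (- 1 - int (nat n)))"
        using \<open>\<And>j. degree_le F (- 1 - int j)\<close> n unfolding degree_le_def by blast
      then show ?thesis using E_neg[of "n + (- 1 - int (nat n))"] by (auto split: if_splits)
    qed
    then show ?case by (intro exI[of _ "\<lambda>_. 0"]) (simp add: skew_def)
  next
    case (Suc k)
    obtain a where "degree_le (\<lambda>p. F p - skew a p) (int (Suc k) - 1 - 1)"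
      using endo_reduce[OF Suc.prems] by blast
    then have "degree_le (\<lambda>p. F p - skew a p) (int k - 1)" by simp
    from Suc.IH[OF endo_minus_skew[OF Suc.prems(1)] this]
    obtain b where b: "\<And>p. F p - skew a p - skew b p \<in> E (-1)" by blast
    have "skew (\<lambda>h. a h + b h) p = skew a p + skew b p" for p
      unfolding skew_def by (simp add: algebra_simps sum.distrib)
    then show ?case using b by (intro exI[of _ "\<lambda>h. a h + b h"]) (simp add: algebra_simps)
  qed
  moreover obtain d where d: "degree_le F d" using endo_bounded[OF F] by blast
  moreover have "degree_le F (int (nat (d + 1)) - 1)"
    unfolding degree_le_def
  proof (intro allI ballI)
    fix n p assume "p \<in> E n"
    then have "F p \<in> E (n + d)" using d unfolding degree_le_def by blast
    moreover have "E (n + d) \<subseteq> E (n + (int (nat (d + 1)) - 1))" by (rule E_mono) simp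
    ultimately show "F p \<in> E (n + (int (nat (d + 1)) - 1))" by blast
  qed
  ultimately show ?thesis using F by blast
qed

text \<open>Injectivity of the natural map, by descent through the filtration: the symbols of the
  \<open>a h\<close> in degree \<open>k\<close> are the coefficients of a vanishing combination of
  the \<open>\<gamma> h\<close>, hence zero, and all \<open>a h\<close> fall into the step
  below.\<close>

theorem skew_independent:
  assumes null: "\<And>p. skew a p \<in> E (-1)" and g: "g \<in> carrier G"
  shows "a g \<in> E (-1)"
proof -
  have "\<forall>h\<in>carrier G. a h \<in> E (-1)" if "\<forall>h\<in>carrier G. a h \<in> E (int k - 1)" for k
    using that
  proof (induction k)
    case (Suc k)
    then have a: "\<And>h. h \<in> carrier G \<Longrightarrow> a h \<in> E (int k)" by simp
    have "a h \<in> E (int k - 1)" if h: "h \<in> carrier G" for h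
    proof -
      have "sy (int k) (a h) = 0"
      proof (rule action_independent[OF _ h])
        fix n s assume s: "s \<in> S n"
        obtain p where p: "p \<in> E n" "sy n p = s" using sy_onto[OF s] by blast
        have "sy (int k + n) (skew a p) = 0"
          using sy_kernel[OF skew_degree(1)[OF a p(1)]] subsetD[OF E_least null[of p]] by simp
        then show "(\<Sum>h\<in>carrier G. sy (int k) (a h) * \<gamma> h s) = 0"
          using skew_degree(2)[OF a p(1)] p(2) by simp
      qed
      then show ?thesis using sy_kernel[OF a[OF h]] by blast
    qed
    then show ?case using Suc.IH by blast
  qed simp
  moreover obtain k where "\<forall>h\<in>carrier G. a h \<in> E (int k - 1)"
  proof -
    have "\<forall>h. \<exists>z. a h \<in> E z" using E_exhaust by blast
    then obtain e where e: "\<And>h. a h \<in> E (e h)" by metis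
    define m where "m = Max (insert 0 (e ` carrier G))"
    have m: "0 \<le> m" "\<And>h. h \<in> carrier G \<Longrightarrow> e h \<le> m"
      unfolding m_def using finite_G by auto
    have "a h \<in> E (int (nat m + 1) - 1)" if "h \<in> carrier G" for h
      using subsetD[OF E_mono[OF m(2)[OF that]] e] m(1) by simp
    then show ?thesis using that by blast
  qed
  ultimately show ?thesis using g by blast
qed

end

section \<open>The Poincare-Birkhoff-Witt representation\<close>

abbreviation (input) const_poly :: "'k::zero \<Rightarrow> ('m::zero \<Rightarrow>\<^sub>0 'k)" where
  "const_poly \<equiv> Poly_Mapping.single 0"

text \<open>One device for the free algebra, with words as monomials, and for polynomials, with
  multisets of variable indices. Scalars are constants multiplied from the left; they are central in
  either algebra.\<close>

definition linear_extension :: "('m \<Rightarrow> ('n::monoid_add \<Rightarrow>\<^sub>0 'k::field)) \<Rightarrow> ('m \<Rightarrow>\<^sub>0 'k) \<Rightarrow> ('n \<Rightarrow>\<^sub>0 'k)" where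
  "linear_extension \<phi> p = (\<Sum>m\<in>Poly_Mapping.keys p. const_poly (Poly_Mapping.lookup p m) * \<phi> m)"

lemma poly_mapping_monomials:
  "p = (\<Sum>m\<in>Poly_Mapping.keys p. Poly_Mapping.single m (Poly_Mapping.lookup p m))"
  by (rule poly_mapping_eqI)
     (auto simp: lookup_sum lookup_single when_def in_keys_iff)

lemma poly_mapping_induct [case_names monomial add]:
  assumes "\<And>m c. P (Poly_Mapping.single m c)" and "\<And>p q. P p \<Longrightarrow> P q \<Longrightarrow> P (p + q)"
  shows "P (p :: 'm \<Rightarrow>\<^sub>0 'k::comm_monoid_add)"
proof -
  have P0: "P 0" using assms(1)[of undefined 0] by simp
  have "P (\<Sum>m\<in>A. Poly_Mapping.single m (Poly_Mapping.lookup p m))" if "finite A" for A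
    using that by (induction A rule: finite_induct) (auto intro: assms P0)
  from this[OF finite_keys[of p]] show ?thesis using poly_mapping_monomials[of p] by simp
qed

lemma const_poly_commute: "const_poly c * p = p * (const_poly c :: 'm::monoid_add \<Rightarrow>\<^sub>0 'k::field)"
  by (induction p rule: poly_mapping_induct) (simp_all add: mult_single algebra_simps)

lemma const_poly_left_commute:
  "p * (const_poly c * q) = const_poly c * (p * q :: 'm::monoid_add \<Rightarrow>\<^sub>0 'k::field)"
  using const_poly_commute[of c p] by (simp add: mult.assoc[symmetric])

lemma const_poly_mult: "const_poly (c * d) = (const_poly c * const_poly d :: 'm::monoid_add \<Rightarrow>\<^sub>0 'k::field)"
  by (simp add: mult_single)

lemma linear_extension_superset:
  assumes "finite A" "Poly_Mapping.keys p \<subseteq> A"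
  shows "linear_extension \<phi> p = (\<Sum>m\<in>A. const_poly (Poly_Mapping.lookup p m) * \<phi> m)"
  unfolding linear_extension_def
  by (rule sum.mono_neutral_left) (use assms in \<open>auto simp: in_keys_iff\<close>)

lemma linear_extension_0 [simp]: "linear_extension \<phi> 0 = 0"
  by (simp add: linear_extension_def)

lemma linear_extension_single [simp]:
  "linear_extension \<phi> (Poly_Mapping.single m c) = const_poly c * \<phi> m"
  by (simp add: linear_extension_def)

lemma linear_extension_1 [simp]: "linear_extension \<phi> 1 = \<phi> 0"
  using linear_extension_single[of \<phi> 0 1] by simp

lemma linear_extension_add:
  "linear_extension \<phi> (p + q) = linear_extension \<phi> p + linear_extension \<phi> q"
proof -
  let ?A = "Poly_Mapping.keys p \<union> Poly_Mapping.keys q"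
  have "Poly_Mapping.keys (p + q) \<subseteq> ?A" by (rule keys_add)
  then show ?thesis
    by (simp add: linear_extension_superset[of ?A] lookup_add single_add algebra_simps sum.distrib)
qed

lemma linear_extension_uminus: "linear_extension \<phi> (- p) = - linear_extension \<phi> p"
  using linear_extension_add[of \<phi> p "- p"] by (simp add: eq_neg_iff_add_eq_0 add.commute)

lemma linear_extension_diff:
  "linear_extension \<phi> (p - q) = linear_extension \<phi> p - linear_extension \<phi> q"
  using linear_extension_add[of \<phi> p "- q"] by (simp add: linear_extension_uminus)

lemma linear_extension_sum: "linear_extension \<phi> (sum f A) = (\<Sum>i\<in>A. linear_extension \<phi> (f i))"
  by (induction A rule: infinite_finite_induct) (auto simp: linear_extension_add)

lemma linear_extension_scale:
  "linear_extension \<phi> (const_poly c * p) = const_poly c * linear_extension \<phi> p"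
  by (induction p rule: poly_mapping_induct)
     (simp_all add: mult_single linear_extension_add distrib_left mult.assoc[symmetric])

lemma linear_extension_cong:
  "(\<And>m. m \<in> Poly_Mapping.keys p \<Longrightarrow> \<phi> m = \<psi> m) \<Longrightarrow> linear_extension \<phi> p = linear_extension \<psi> p"
  unfolding linear_extension_def by (intro sum.cong) auto

lemma linear_extension_mult:
  assumes "\<And>m n. \<phi> (m + n) = \<phi> m * \<phi> n"
  shows "linear_extension \<phi> (p * q) = linear_extension \<phi> p * linear_extension \<phi> q"
proof (induction p rule: poly_mapping_induct)
  case (monomial m c)
  show ?case
  proof (induction q rule: poly_mapping_induct)
    case (monomial n d)
    have "const_poly c * \<phi> m * (const_poly d * \<phi> n) = const_poly c * (const_poly d * (\<phi> m * \<phi> n))"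
      using const_poly_left_commute[of "\<phi> m" d "\<phi> n"] by (simp add: mult.assoc)
    then show ?case
      by (simp add: mult_single assms mult.assoc[symmetric])
  qed (simp add: algebra_simps linear_extension_add)
qed (simp add: algebra_simps linear_extension_add)

text \<open>Used with \<open>word_length\<close> and with \<open>size\<close>. The bound is an
  integer, so that leading terms can be compared in degree \<open>z - 1\<close>; a negative bound
  leaves only 0.\<close>

definition weight_le :: "('m \<Rightarrow> nat) \<Rightarrow> int \<Rightarrow> ('m \<Rightarrow>\<^sub>0 'k::zero) set" where
  "weight_le wt z = {p. \<forall>m\<in>Poly_Mapping.keys p. int (wt m) \<le> z}"

lemma weight_le_zero: "0 \<in> weight_le wt z"
  by (simp add: weight_le_def)

lemma weight_le_add: "p \<in> weight_le wt z \<Longrightarrow> q \<in> weight_le wt z \<Longrightarrow> p + q \<in> weight_le wt z"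
  unfolding weight_le_def using keys_add[of p q] by blast

lemma weight_le_sum: "(\<And>i. i \<in> A \<Longrightarrow> f i \<in> weight_le wt z) \<Longrightarrow> sum f A \<in> weight_le wt z"
  by (induction A rule: infinite_finite_induct) (auto simp: weight_le_zero weight_le_add)

lemma weight_le_mono: "p \<in> weight_le wt y \<Longrightarrow> y \<le> z \<Longrightarrow> p \<in> weight_le wt z"
  unfolding weight_le_def by force

lemma weight_le_single: "int (wt m) \<le> z \<Longrightarrow> Poly_Mapping.single m c \<in> weight_le wt z"
  by (simp add: weight_le_def)

lemma weight_le_mult:
  assumes wt: "\<And>a b. wt (a + b) = wt a + wt b" and "p \<in> weight_le wt y" "q \<in> weight_le wt z"
  shows "p * q \<in> weight_le wt (y + z)"
  unfolding weight_le_def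
proof (clarify)
  fix m assume "m \<in> Poly_Mapping.keys (p * q)"
  then obtain a b where "m = a + b" "a \<in> Poly_Mapping.keys p" "b \<in> Poly_Mapping.keys q"
    using keys_mult[of p q] by blast
  then have "int (wt a) \<le> y" "int (wt b) \<le> z" "m = a + b"
    using assms(2,3) by (auto simp: weight_le_def)
  then show "int (wt m) \<le> y + z" by (simp add: wt)
qed

lemma weight_le_scale:
  assumes "p \<in> weight_le wt z"
  shows "const_poly c * p \<in> weight_le wt z"
  unfolding weight_le_def
proof (clarify)
  fix m assume "m \<in> Poly_Mapping.keys (const_poly c * p)"
  then obtain a b where "m = a + b" "a \<in> Poly_Mapping.keys (const_poly c)" "b \<in> Poly_Mapping.keys p"
    using keys_mult[of "const_poly c" p] by blast
  then show "int (wt m) \<le> z" using assms by (auto simp: weight_le_def split: if_splits)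
qed

lemma weight_le_linear_extension:
  assumes "\<And>m. m \<in> Poly_Mapping.keys p \<Longrightarrow> \<phi> m \<in> weight_le wt z"
  shows "linear_extension \<phi> p \<in> weight_le wt z"
  unfolding linear_extension_def by (intro weight_le_sum weight_le_scale assms)

section \<open>The action of the Lie algebra on polynomials\<close>

locale lie_algebra_basis = lie_algebra scale bracket
  for scale :: "'k::field \<Rightarrow> 'g::ab_group_add \<Rightarrow> 'g" (infixr \<open>*s\<close> 75)
    and bracket :: "'g \<Rightarrow> 'g \<Rightarrow> 'g" +
  fixes e :: "nat \<Rightarrow> 'g" and d :: nat and crd :: "'g \<Rightarrow> nat \<Rightarrow> 'k"
  assumes crd_add: "crd (v + w) i = crd v i + crd w i"
    and crd_scale: "crd (c *s v) i = c * crd v i"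
    and crd_expand: "(\<Sum>i<d. crd v i *s e i) = v"
    and crd_basis: "i < d \<Longrightarrow> j < d \<Longrightarrow> crd (e i) j = (if i = j then 1 else 0)"
begin

lemma crd_zero: "crd 0 i = 0"
  using crd_add[of 0 0 i] by (metis add.right_neutral add_left_cancel)

lemma bracket_zero_right: "bracket x 0 = 0"
  using bracket_add_right[of x 0 0] by simp

lemma bracket_zero_left: "bracket 0 x = 0"
  using bracket_add_left[of 0 0 x] by simp

lemma bracket_antisym: "bracket y x = - bracket x y"
proof -
  have "bracket (x + y) (x + y) = (bracket x x + bracket y y) + (bracket x y + bracket y x)"
    unfolding bracket_add_left bracket_add_right by (simp only: ac_simps)
  then have "bracket x y + bracket y x = 0" unfolding bracket_self by simp
  then show ?thesis by (simp add: eq_neg_iff_add_eq_0 add.commute)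
qed

lemma bracket_sum_right: "bracket x (sum f A) = (\<Sum>i\<in>A. bracket x (f i))"
  by (induction A rule: infinite_finite_induct) (auto simp: bracket_zero_right bracket_add_right)

lemma bracket_sum_left: "bracket (sum f A) x = (\<Sum>i\<in>A. bracket (f i) x)"
  by (induction A rule: infinite_finite_induct) (auto simp: bracket_zero_left bracket_add_left)

lemma bracket_uminus_right: "bracket x (- y) = - bracket x y"
  using bracket_add_right[of x y "- y"] by (simp add: bracket_zero_right eq_neg_iff_add_eq_0 add.commute)

abbreviation mon :: "nat multiset \<Rightarrow> (nat multiset \<Rightarrow>\<^sub>0 'k)" where
  "mon M \<equiv> Poly_Mapping.single M 1"

text \<open>The recursion is on the degree of the monomial \<open>M\<close>. The first argument is fuel, of which
  \<open>size M\<close> suffices; the formula is forced by \<open>x\<^sub>i x\<^sub>j N = x\<^sub>j x\<^sub>i N + [x\<^sub>i, x\<^sub>j] N\<close> for \<open>j < i\<close>.\<close>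

primrec pbw_rec :: "nat \<Rightarrow> nat \<Rightarrow> nat multiset \<Rightarrow> (nat multiset \<Rightarrow>\<^sub>0 'k)" where
  "pbw_rec 0 i M = mon (add_mset i M)"
| "pbw_rec (Suc n) i M =
    (if M = {#} \<or> i \<le> Min_mset M then mon (add_mset i M)
     else let j = Min_mset M; N = M - {#j#} in
       mon (add_mset i M) + linear_extension (pbw_rec n j) (pbw_rec n i N - mon (add_mset i N)) +
       (\<Sum>k<d. const_poly (crd (bracket (e i) (e j)) k) * pbw_rec n k N))"

text \<open>The two claims need each other: the recursion applies \<open>pbw_rec n j\<close> to the
  monomials of a correction term, and only the bound on their degree shows that the fuel still
  suffices for them.\<close>

lemma pbw_rec_stable_degree:
  "size M \<le> n \<Longrightarrow> pbw_rec (Suc n) i M = pbw_rec n i M \<and>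
     pbw_rec n i M - mon (add_mset i M) \<in> weight_le size (int (size M))"
proof (induction n arbitrary: i M)
  case (Suc n)
  have deg: "pbw_rec n i M \<in> weight_le size (int (size M) + 1)" if "size M \<le> n" for i M
  proof -
    have "(pbw_rec n i M - mon (add_mset i M)) + mon (add_mset i M) \<in> weight_le size (int (size M) + 1)"
      using Suc.IH[OF that, of i] by (intro weight_le_add) (auto intro: weight_le_mono weight_le_single)
    then show ?thesis by simp
  qed
  show ?case
  proof (cases "M = {#} \<or> i \<le> Min_mset M")
    case True
    then show ?thesis by (simp add: weight_le_zero)
  next
    case False
    define j where "j = Min_mset M"
    define N where "N = M - {#j#}"
    have "j \<in># M" using False unfolding j_def by (intro Min_in) auto
    then have "M = add_mset j N" unfolding N_def by simp
    then have N: "size N \<le> n" "size M = Suc (size N)" using Suc.prems by auto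
    have e: "pbw_rec (Suc n') i M = mon (add_mset i M) + linear_extension (pbw_rec n' j) (pbw_rec n' i N - mon (add_mset i N)) +
       (\<Sum>k<d. const_poly (crd (bracket (e i) (e j)) k) * pbw_rec n' k N)" for n'
      using False unfolding j_def[symmetric] N_def[symmetric] by (simp add: Let_def j_def N_def)
    let ?w = "pbw_rec n i N - mon (add_mset i N)"
    have w: "?w \<in> weight_le size (int (size N))" using Suc.IH[OF N(1)] by blast
    have w': "size K \<le> size N" if "K \<in> Poly_Mapping.keys ?w" for K
      using w that unfolding weight_le_def by auto
    have "linear_extension (pbw_rec (Suc n) j) ?w = linear_extension (pbw_rec n j) ?w"
    proof (rule linear_extension_cong)
      fix K assume "K \<in> Poly_Mapping.keys ?w"
      then have "size K \<le> n" using w' N by fastforce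
      then show "pbw_rec (Suc n) j K = pbw_rec n j K" using Suc.IH by blast
    qed
    moreover have s: "pbw_rec (Suc n) k N = pbw_rec n k N" for k using Suc.IH[OF N(1)] by blast
    ultimately have 1: "pbw_rec (Suc (Suc n)) i M = pbw_rec (Suc n) i M"
      unfolding e[of "Suc n"] e[of n] s by simp
    have "linear_extension (pbw_rec n j) ?w \<in> weight_le size (int (size M))"
    proof (rule weight_le_linear_extension)
      fix K assume "K \<in> Poly_Mapping.keys ?w"
      then have K: "size K \<le> size N" using w' by blast
      then have "pbw_rec n j K \<in> weight_le size (int (size K) + 1)" using deg N by simp
      then show "pbw_rec n j K \<in> weight_le size (int (size M))"
        by (rule weight_le_mono) (use K N in simp)
    qed
    moreover have "(\<Sum>k<d. const_poly (crd (bracket (e i) (e j)) k) * pbw_rec n k N) \<in> weight_le size (int (size M))"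
    proof (intro weight_le_sum weight_le_scale)
      fix k
      show "pbw_rec n k N \<in> weight_le size (int (size M))"
        using deg[OF N(1), of k] by (rule weight_le_mono) (use N in simp)
    qed
    ultimately show ?thesis
      using 1 unfolding e[of n] by (simp add: algebra_simps weight_le_add)
  qed
qed (simp add: weight_le_zero)

definition pbw :: "nat \<Rightarrow> (nat multiset \<Rightarrow>\<^sub>0 'k) \<Rightarrow> (nat multiset \<Rightarrow>\<^sub>0 'k)" where
  "pbw i = linear_extension (\<lambda>M. pbw_rec (size M) i M)"

definition rep :: "'g \<Rightarrow> (nat multiset \<Rightarrow>\<^sub>0 'k) \<Rightarrow> (nat multiset \<Rightarrow>\<^sub>0 'k)" where
  "rep v p = (\<Sum>k<d. const_poly (crd v k) * pbw k p)"

lemma pbw_rec_eq: "size M \<le> n \<Longrightarrow> pbw_rec n i M = pbw_rec (size M) i M"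
proof (induction n)
  case (Suc n)
  show ?case
  proof (cases "size M = Suc n")
    case False
    then have "size M \<le> n" using Suc.prems by simp
    then show ?thesis using Suc.IH pbw_rec_stable_degree[of M n i] by simp
  qed simp
qed simp

lemma pbw_mon: "pbw i (mon M) = pbw_rec (size M) i M"
  by (simp add: pbw_def)

lemma pbw_add: "pbw i (p + q) = pbw i p + pbw i q"
  and pbw_diff: "pbw i (p - q) = pbw i p - pbw i q"
  and pbw_scale: "pbw i (const_poly c * p) = const_poly c * pbw i p"
  and pbw_sum: "pbw i (sum f A) = (\<Sum>j\<in>A. pbw i (f j))"
  by (simp_all add: pbw_def linear_extension_add linear_extension_diff linear_extension_scale linear_extension_sum)

lemma rep_add: "rep v (p + q) = rep v p + rep v q"
  and rep_diff: "rep v (p - q) = rep v p - rep v q"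
  by (simp_all add: rep_def pbw_add pbw_diff algebra_simps sum.distrib sum_subtractf)

lemma rep_zero: "rep v 0 = 0"
  using rep_diff[of v 0 0] by simp

lemma rep_scale: "rep v (const_poly c * p) = const_poly c * rep v p"
  by (simp add: rep_def pbw_scale sum_distrib_left mult.left_commute)

lemma rep_add_vector: "rep (v + w) p = rep v p + rep w p"
  by (simp add: rep_def crd_add single_add algebra_simps sum.distrib)

lemma rep_scale_vector: "rep (c *s v) p = const_poly c * rep v p"
  by (simp add: rep_def crd_scale const_poly_mult mult.assoc sum_distrib_left)

lemma rep_zero_vector: "rep 0 p = 0"
  by (simp add: rep_def crd_zero)

lemma rep_uminus_vector: "rep (- v) p = - rep v p"
  using rep_add_vector[of v "- v" p] by (simp add: rep_zero_vector eq_neg_iff_add_eq_0 add.commute)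

lemma rep_sum_vector: "rep (sum f A) p = (\<Sum>i\<in>A. rep (f i) p)"
  by (induction A rule: infinite_finite_induct) (auto simp: rep_zero_vector rep_add_vector)

lemma pbw_ordered:
  assumes "\<And>j. j \<in># M \<Longrightarrow> i \<le> j"
  shows "pbw i (mon M) = mon (add_mset i M)"
proof (cases "M = {#}")
  case False
  then have "i \<le> Min_mset M" using assms by simp
  moreover obtain n where "size M = Suc n" using False by (cases "size M") auto
  ultimately show ?thesis by (simp add: pbw_mon)
qed (simp add: pbw_def)

lemma pbw_leading:
  assumes "p \<in> weight_le size z"
  shows "pbw i p - mon {#i#} * p \<in> weight_le size z"
proof -
  have "pbw i p - mon {#i#} * p = linear_extension (\<lambda>M. pbw_rec (size M) i M - mon (add_mset i M)) p"
    unfolding pbw_def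
    by (induction p rule: poly_mapping_induct)
       (simp_all add: linear_extension_add algebra_simps mult_single)
  also have "\<dots> \<in> weight_le size z"
  proof (rule weight_le_linear_extension)
    fix M assume "M \<in> Poly_Mapping.keys p"
    then have "int (size M) \<le> z" using assms by (simp add: weight_le_def)
    then show "pbw_rec (size M) i M - mon (add_mset i M) \<in> weight_le size z"
      using pbw_rec_stable_degree[of M "size M" i] weight_le_mono by blast
  qed
  finally show ?thesis .
qed

text \<open>The recursion treats the leading monomial \<open>add_mset i N\<close> separately from
  the correction. Since \<open>j\<close> is minimal, \<open>pbw j\<close> of that monomial is
  \<open>mon (add_mset i (add_mset j N))\<close>, and both pieces combine to \<open>pbw j\<close> of
  the whole of \<open>pbw i (mon N)\<close>.\<close>

lemma pbw_unordered:
  assumes ji: "j < i" and N: "\<And>k. k \<in># N \<Longrightarrow> j \<le> k"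
  shows "pbw i (mon (add_mset j N)) = pbw j (pbw i (mon N)) + rep (bracket (e i) (e j)) (mon N)"
proof -
  let ?M = "add_mset j N" and ?n = "size N"
  have min: "Min_mset ?M = j" using N by (intro Min_eqI) auto
  let ?w = "pbw i (mon N) - mon (add_mset i N)"
  have w: "?w \<in> weight_le size (int ?n)"
    using pbw_rec_stable_degree[of N ?n i] by (simp add: pbw_mon)
  have "pbw i (mon ?M) = mon (add_mset i ?M) + linear_extension (pbw_rec ?n j) ?w +
       (\<Sum>k<d. const_poly (crd (bracket (e i) (e j)) k) * pbw_rec ?n k N)"
    using ji min by (simp add: pbw_mon Let_def)
  also have "linear_extension (pbw_rec ?n j) ?w = pbw j ?w"
    unfolding pbw_def using w by (intro linear_extension_cong pbw_rec_eq) (simp add: weight_le_def pbw_def)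
  also have "\<dots> = pbw j (pbw i (mon N)) - mon (add_mset i ?M)"
    using N ji by (subst pbw_diff, subst pbw_ordered) (auto simp: add_mset_commute)
  also have "(\<Sum>k<d. const_poly (crd (bracket (e i) (e j)) k) * pbw_rec ?n k N) = rep (bracket (e i) (e j)) (mon N)"
    by (simp add: rep_def pbw_mon)
  finally show ?thesis by simp
qed

section \<open>The commutation relations of the action\<close>

definition commutes_on :: "(nat multiset \<Rightarrow>\<^sub>0 'k) \<Rightarrow> bool" where
  "commutes_on p \<longleftrightarrow> (\<forall>i j. pbw i (pbw j p) - pbw j (pbw i p) = rep (bracket (e i) (e j)) p)"

lemma commutes_on_single: assumes "commutes_on (mon M)" shows "commutes_on (Poly_Mapping.single M c)"
proof -
  have "commutes_on (const_poly c * mon M)"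
    unfolding commutes_on_def
  proof (intro allI)
    fix i j
    have "pbw i (pbw j (const_poly c * mon M)) - pbw j (pbw i (const_poly c * mon M))
        = const_poly c * (pbw i (pbw j (mon M)) - pbw j (pbw i (mon M)))"
      unfolding pbw_scale by (rule right_diff_distrib[symmetric])
    also have "pbw i (pbw j (mon M)) - pbw j (pbw i (mon M)) = rep (bracket (e i) (e j)) (mon M)"
      using assms unfolding commutes_on_def by blast
    finally show "pbw i (pbw j (const_poly c * mon M)) - pbw j (pbw i (const_poly c * mon M))
        = rep (bracket (e i) (e j)) (const_poly c * mon M)"
      unfolding rep_scale .
  qed
  moreover have "const_poly c * mon M = Poly_Mapping.single M c" by (simp add: mult_single)
  ultimately show ?thesis by metis
qed

lemma commutes_on_add: "commutes_on p \<Longrightarrow> commutes_on q \<Longrightarrow> commutes_on (p + q)"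
  unfolding commutes_on_def by (simp add: pbw_add rep_add add_diff_add)

lemma commutes_on_degree:
  assumes "\<And>M. int (size M) \<le> z \<Longrightarrow> commutes_on (mon M)" and p: "p \<in> weight_le size z"
  shows "commutes_on p"
proof -
  have "commutes_on (\<Sum>M\<in>A. Poly_Mapping.single M (Poly_Mapping.lookup p M))"
    if "finite A" "A \<subseteq> Poly_Mapping.keys p" for A
    using that
  proof (induction A rule: finite_induct)
    case empty
    then show ?case using commutes_on_single[of "{#}" 0] by (simp add: commutes_on_def rep_def pbw_def)
  next
    case (insert M A)
    then have "commutes_on (mon M)" using p by (intro assms(1)) (simp add: weight_le_def)
    then show ?case using insert by (simp add: commutes_on_add commutes_on_single)
  qed
  from this[OF finite_keys subset_refl] show ?thesis using poly_mapping_monomials[of p] by simp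
qed

lemma commutes_on_rep:
  assumes "commutes_on p"
  shows "pbw i (rep v p) = rep v (pbw i p) + rep (bracket (e i) v) p"
proof -
  have "pbw i (rep v p) - rep v (pbw i p) = (\<Sum>k<d. const_poly (crd v k) * (pbw i (pbw k p) - pbw k (pbw i p)))"
    by (simp add: rep_def pbw_sum pbw_scale sum_subtractf right_diff_distrib)
  also have "\<dots> = (\<Sum>k<d. const_poly (crd v k) * rep (bracket (e i) (e k)) p)"
    using assms by (simp add: commutes_on_def)
  also have "\<dots> = rep (\<Sum>k<d. crd v k *s bracket (e i) (e k)) p"
    by (simp add: rep_sum_vector rep_scale_vector)
  also have "(\<Sum>k<d. crd v k *s bracket (e i) (e k)) = bracket (e i) (\<Sum>k<d. crd v k *s e k)"
    by (simp add: bracket_sum_right bracket_scale_right)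
  finally show ?thesis by (simp add: crd_expand algebra_simps)
qed

text \<open>If the smaller of the two indices is at most every variable of \<open>N\<close>, the
  relation is the defining recursion. Otherwise \<open>N\<close> has a minimal variable
  \<open>k\<close> below both; writing \<open>mon N = pbw k (mon L)\<close> and moving
  \<open>pbw k\<close> outwards produces double brackets, which the Jacobi identity turns into the
  missing commutator with \<open>e k\<close>.\<close>

lemma commutes_on_mon: "commutes_on (mon N)"
proof (induction "size N" arbitrary: N rule: less_induct)
  case less
  have ordered: "pbw i (pbw j (mon L)) - pbw j (pbw i (mon L)) = rep (bracket (e i) (e j)) (mon L)"
    if "j < i" "\<And>k. k \<in># L \<Longrightarrow> j \<le> k" for i j L
    using pbw_unordered[OF that] pbw_ordered[of L j] that by simp
  have main: "pbw i (pbw j (mon N)) - pbw j (pbw i (mon N)) = rep (bracket (e i) (e j)) (mon N)"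
    if ji: "j < i" for i j
  proof (cases "\<forall>k\<in>#N. j \<le> k")
    case True
    then show ?thesis using ordered ji by blast
  next
    case False
    define k where "k = Min_mset N"
    define L where "L = N - {#k#}"
    have "N \<noteq> {#}" using False by auto
    then have "k \<in># N" unfolding k_def by (intro Min_in) auto
    then have NL: "N = add_mset k L" unfolding L_def by simp
    have kmin: "k \<le> l" if "l \<in># N" for l unfolding k_def using that by (intro Min_le) auto
    then have kL: "k \<le> l" if "l \<in># L" for l using that NL by auto
    have "k < j" using False kmin by force
    have IH: "commutes_on (mon K)" if "size K \<le> size L" for K
      using less.hyps[of K] that NL by simp
    have kN: "pbw k (mon L) = mon N" using pbw_ordered[OF kL] NL by simp
    \<comment> \<open>\<open>pbw b (mon L)\<close> has the degree of \<open>N\<close>, beyond the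
      induction hypothesis. Only its remainder \<open>?w\<close> is covered; its leading monomial is
      handled by \<open>ordered\<close>, because \<open>k\<close> is minimal there.\<close>
    have swap: "pbw a (pbw k (pbw b (mon L))) = pbw k (pbw a (pbw b (mon L))) + rep (bracket (e a) (e k)) (pbw b (mon L))"
      if "k < a" "k < b" for a b
    proof -
      let ?w = "pbw b (mon L) - mon (add_mset b L)"
      have "?w \<in> weight_le size (int (size L))"
        using pbw_rec_stable_degree[of L "size L" b] by (simp add: pbw_mon)
      then have "commutes_on ?w" by (rule commutes_on_degree[rotated]) (use IH in simp)
      then have w: "pbw a (pbw k ?w) - pbw k (pbw a ?w) = rep (bracket (e a) (e k)) ?w"
        by (simp add: commutes_on_def)
      have "pbw a (pbw k (mon (add_mset b L))) - pbw k (pbw a (mon (add_mset b L))) = rep (bracket (e a) (e k)) (mon (add_mset b L))"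
        using that kL by (intro ordered) auto
      with w show ?thesis by (simp add: pbw_diff rep_diff algebra_simps)
    qed
    have L: "commutes_on (mon L)" by (rule IH) simp
    have step: "pbw a (pbw b (mon N)) = pbw k (pbw a (pbw b (mon L))) + rep (bracket (e a) (e k)) (pbw b (mon L))
        + rep (bracket (e b) (e k)) (pbw a (mon L)) + rep (bracket (e a) (bracket (e b) (e k))) (mon L)"
      if "k < a" "k < b" for a b
    proof -
      have "pbw b (mon N) = pbw k (pbw b (mon L)) + rep (bracket (e b) (e k)) (mon L)"
        unfolding NL by (rule pbw_unordered[OF that(2) kL])
      then show ?thesis by (simp add: pbw_add swap[OF that] commutes_on_rep[OF L])
    qed
    have "k < i" using \<open>k < j\<close> ji by simp
    have jac: "bracket (e i) (bracket (e j) (e k)) - bracket (e j) (bracket (e i) (e k)) = - bracket (e k) (bracket (e i) (e j))"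
      using jacobi[of "e i" "e j" "e k"] bracket_antisym[of "e k" "e i"]
      by (simp add: bracket_uminus_right algebra_simps eq_neg_iff_add_eq_0)
    have "pbw i (pbw j (mon N)) - pbw j (pbw i (mon N)) =
      pbw k (pbw i (pbw j (mon L)) - pbw j (pbw i (mon L))) +
      rep (bracket (e i) (bracket (e j) (e k)) + - bracket (e j) (bracket (e i) (e k))) (mon L)"
      unfolding step[OF \<open>k < i\<close> \<open>k < j\<close>] step[OF \<open>k < j\<close> \<open>k < i\<close>] rep_add_vector rep_uminus_vector pbw_diff
      by (simp add: algebra_simps)
    also have "pbw i (pbw j (mon L)) - pbw j (pbw i (mon L)) = rep (bracket (e i) (e j)) (mon L)"
      using L by (simp add: commutes_on_def)
    also have "pbw k (rep (bracket (e i) (e j)) (mon L)) = rep (bracket (e i) (e j)) (mon N) + rep (bracket (e k) (bracket (e i) (e j))) (mon L)"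
      by (simp add: commutes_on_rep[OF L] kN)
    finally show ?thesis using jac by (simp add: rep_uminus_vector)
  qed
  show ?case
    unfolding commutes_on_def
  proof (intro allI)
    fix i j :: nat
    consider "j < i" | "i = j" | "i < j" by linarith
    then show "pbw i (pbw j (mon N)) - pbw j (pbw i (mon N)) = rep (bracket (e i) (e j)) (mon N)"
    proof cases
      case 3
      then show ?thesis using main[of i j] bracket_antisym[of "e i" "e j"]
        by (simp add: rep_uminus_vector algebra_simps)
    qed (simp_all add: main bracket_self rep_zero_vector)
  qed
qed

lemma rep_bracket: "rep v (rep w p) - rep w (rep v p) = rep (bracket v w) p"
proof -
  have p: "commutes_on p"
    by (induction p rule: poly_mapping_induct) (auto intro: commutes_on_add commutes_on_single commutes_on_mon)
  have rep_sum: "rep w (sum f A) = (\<Sum>i\<in>A. rep w (f i))" for f :: "nat \<Rightarrow> _" and A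
    by (induction A rule: infinite_finite_induct) (auto simp: rep_add rep_zero)
  have "rep v (rep w p) = (\<Sum>k<d. const_poly (crd v k) * (rep w (pbw k p) + rep (bracket (e k) w) p))"
    unfolding rep_def[of v] by (simp only: commutes_on_rep[OF p])
  also have "\<dots> = rep w (rep v p) + (\<Sum>k<d. const_poly (crd v k) * rep (bracket (e k) w) p)"
    unfolding rep_def[of v] rep_sum rep_scale by (simp add: distrib_left sum.distrib)
  also have "(\<Sum>k<d. const_poly (crd v k) * rep (bracket (e k) w) p) = rep (bracket (\<Sum>k<d. crd v k *s e k) w) p"
    by (simp add: bracket_sum_left bracket_scale_left rep_sum_vector rep_scale_vector)
  finally show ?thesis by (simp add: crd_expand)
qed

end

section \<open>Polynomial rings and the enveloping ideal\<close>

definition supported :: "'m set \<Rightarrow> ('m \<Rightarrow>\<^sub>0 'k::zero) set" where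
  "supported A = {p. Poly_Mapping.keys p \<subseteq> A}"

lemma supported_zero: "0 \<in> supported A"
  by (simp add: supported_def)

lemma supported_add: "p \<in> supported A \<Longrightarrow> q \<in> supported A \<Longrightarrow> p + q \<in> supported A"
  unfolding supported_def using keys_add[of p q] by blast

lemma supported_uminus: "p \<in> supported A \<Longrightarrow> - p \<in> supported A"
  for p :: "'m \<Rightarrow>\<^sub>0 'k::ab_group_add"
  unfolding supported_def by simp

lemma supported_sum: "(\<And>i. i \<in> K \<Longrightarrow> f i \<in> supported A) \<Longrightarrow> sum f K \<in> supported A"
  by (induction K rule: infinite_finite_induct) (auto simp: supported_zero supported_add)

lemma supported_single: "m \<in> A \<Longrightarrow> Poly_Mapping.single m c \<in> supported A"
  by (simp add: supported_def)

lemma supported_mono: "p \<in> supported A \<Longrightarrow> A \<subseteq> B \<Longrightarrow> p \<in> supported B"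
  by (auto simp: supported_def)

lemma supported_mult:
  assumes "p \<in> supported A" "q \<in> supported B" "\<And>a b. a \<in> A \<Longrightarrow> b \<in> B \<Longrightarrow> a + b \<in> C"
  shows "p * q \<in> supported C"
  using keys_mult[of p q] assms unfolding supported_def by fastforce

lemma supported_scale: "p \<in> supported A \<Longrightarrow> const_poly c * p \<in> supported A"
  by (rule supported_mult[of _ "{0}"]) (auto intro: supported_single)

lemma supported_linear_extension:
  assumes "\<And>m. m \<in> Poly_Mapping.keys p \<Longrightarrow> \<phi> m \<in> supported A"
  shows "linear_extension \<phi> p \<in> supported A"
  unfolding linear_extension_def by (intro supported_sum supported_scale assms)

lemma linear_extension_id: "linear_extension (\<lambda>m. Poly_Mapping.single m 1) p = p"
  by (induction p rule: poly_mapping_induct) (simp_all add: linear_extension_add mult_single)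

lemma linear_extension_comp:
  "linear_extension \<psi> (linear_extension \<phi> p) = linear_extension (\<lambda>m. linear_extension \<psi> (\<phi> m)) p"
  by (induction p rule: poly_mapping_induct) (simp_all add: linear_extension_add linear_extension_scale)

lemma linear_extension_diff_fun:
  "linear_extension \<phi> p - linear_extension \<psi> p = linear_extension (\<lambda>m. \<phi> m - \<psi> m) p"
  by (simp add: linear_extension_def sum_subtractf right_diff_distrib)

lemma linear_extension_mult_left:
  "q * linear_extension \<phi> p = linear_extension (\<lambda>m. q * \<phi> m) p"
  by (simp add: linear_extension_def sum_distrib_left const_poly_left_commute[of q])

lemma linear_extension_sum_fun:
  "(\<Sum>i\<in>A. linear_extension (\<phi> i) p) = linear_extension (\<lambda>m. \<Sum>i\<in>A. \<phi> i m) p"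
  unfolding linear_extension_def by (subst sum.swap) (simp add: sum_distrib_left)

section \<open>Homogeneous parts and leading terms\<close>

definition homogeneous_part :: "int \<Rightarrow> (nat multiset \<Rightarrow>\<^sub>0 'k::field) \<Rightarrow> (nat multiset \<Rightarrow>\<^sub>0 'k)" where
  "homogeneous_part z = linear_extension (\<lambda>M. if int (size M) = z then Poly_Mapping.single M 1 else 0)"

lemma homogeneous_part_add: "homogeneous_part z (p + q) = homogeneous_part z p + homogeneous_part z q"
  and homogeneous_part_diff: "homogeneous_part z (p - q) = homogeneous_part z p - homogeneous_part z q"
  by (simp_all add: homogeneous_part_def linear_extension_add linear_extension_diff)

lemma homogeneous_part_lower: "p \<in> weight_le size (z - 1) \<Longrightarrow> homogeneous_part z p = 0"
  unfolding homogeneous_part_def linear_extension_def weight_le_def by (intro sum.neutral) auto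

lemma homogeneous_part_leading:
  assumes "p \<in> weight_le size z"
  shows "p - homogeneous_part z p \<in> weight_le size (z - 1)"
proof -
  have "linear_extension (\<lambda>M. Poly_Mapping.single M 1) p - homogeneous_part z p \<in> weight_le size (z - 1)"
    unfolding homogeneous_part_def linear_extension_diff_fun
    by (rule weight_le_linear_extension) (use assms in \<open>auto simp: weight_le_def\<close>)
  then show ?thesis by (simp add: linear_extension_id)
qed

lemma homogeneous_part_eq:
  assumes "p \<in> supported {M. int (size M) = z}"
  shows "homogeneous_part z p = p"
proof -
  have "homogeneous_part z p = linear_extension (\<lambda>M. Poly_Mapping.single M 1) p"
    unfolding homogeneous_part_def
    by (rule linear_extension_cong) (use assms in \<open>auto simp: supported_def\<close>)
  then show ?thesis by (simp add: linear_extension_id)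
qed

lemma homogeneous_part_homogeneous: "homogeneous_part z p \<in> supported {M. int (size M) = z}"
  unfolding homogeneous_part_def
  by (rule supported_linear_extension) (auto simp: supported_single supported_zero)

lemma homogeneous_part_cong:
  assumes "p - q \<in> weight_le size (z - 1)"
  shows "homogeneous_part z p = homogeneous_part z q"
  using homogeneous_part_lower[OF assms] by (simp add: homogeneous_part_diff)

lemma homogeneous_part_supported:
  assumes "p \<in> supported A"
  shows "homogeneous_part z p \<in> supported {M \<in> A. int (size M) = z}"
  unfolding homogeneous_part_def
  by (rule supported_linear_extension)
     (use assms in \<open>auto simp: supported_def\<close>)

lemma supported_weight_le: "p \<in> supported {M. int (size M) = z \<and> P M} \<Longrightarrow> p \<in> weight_le size z"
  by (auto simp: supported_def weight_le_def)

lemma homogeneous_part_mult: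
  assumes p: "p \<in> weight_le size m" and q: "q \<in> weight_le size n"
  shows "homogeneous_part (m + n) (p * q) = homogeneous_part m p * homogeneous_part n q"
proof -
  let ?p = "homogeneous_part m p" and ?q = "homogeneous_part n q"
  have hp: "?p \<in> weight_le size m"
    using homogeneous_part_homogeneous supported_weight_le[of _ m "\<lambda>_. True"] by auto
  have "(p - ?p) * q \<in> weight_le size (m - 1 + n)"
    by (rule weight_le_mult) (auto intro: homogeneous_part_leading p q)
  moreover have "?p * (q - ?q) \<in> weight_le size (m + (n - 1))"
    by (rule weight_le_mult) (auto intro: homogeneous_part_leading hp q)
  ultimately have "(p - ?p) * q + ?p * (q - ?q) \<in> weight_le size (m + n - 1)"
    by (intro weight_le_add) (simp_all add: algebra_simps)
  then have "p * q - ?p * ?q \<in> weight_le size (m + n - 1)" by (simp add: algebra_simps)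
  then have "homogeneous_part (m + n) (p * q) = homogeneous_part (m + n) (?p * ?q)"
    by (rule homogeneous_part_cong)
  also have "\<dots> = ?p * ?q"
    by (rule homogeneous_part_eq, rule supported_mult[OF homogeneous_part_homogeneous homogeneous_part_homogeneous]) auto
  finally show ?thesis .
qed

section \<open>Substitution homomorphisms of polynomials\<close>

definition substitute :: "(nat \<Rightarrow> (nat multiset \<Rightarrow>\<^sub>0 'k::field)) \<Rightarrow> (nat multiset \<Rightarrow>\<^sub>0 'k) \<Rightarrow> (nat multiset \<Rightarrow>\<^sub>0 'k)" where
  "substitute s = linear_extension (\<lambda>M. \<Prod>i\<in>#M. s i)"

lemma substitute_add: "substitute s (p + q) = substitute s p + substitute s q"
  and substitute_diff: "substitute s (p - q) = substitute s p - substitute s q"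
  and substitute_sum: "substitute s (sum f K) = (\<Sum>i\<in>K. substitute s (f i))"
  and substitute_scale: "substitute s (const_poly c * p) = const_poly c * substitute s p"
  by (simp_all add: substitute_def linear_extension_add linear_extension_diff linear_extension_sum linear_extension_scale)

lemma substitute_mult: "substitute s (p * q) = substitute s p * substitute s q"
  unfolding substitute_def by (rule linear_extension_mult) simp

lemma substitute_1: "substitute s 1 = 1"
  by (simp add: substitute_def)

lemma substitute_mon: "substitute s (Poly_Mapping.single M 1) = (\<Prod>i\<in>#M. s i)"
  by (simp add: substitute_def)

lemma substitute_prod_mset: "substitute s (\<Prod>i\<in>#M. f i) = (\<Prod>i\<in>#M. substitute s (f i))"
  by (induction M) (auto simp: substitute_1 substitute_mult)

lemma substitute_comp: "substitute s (substitute t p) = substitute (\<lambda>i. substitute s (t i)) p"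
proof -
  have "substitute s (substitute t p) = linear_extension (\<lambda>M. substitute s (\<Prod>i\<in>#M. t i)) p"
    unfolding substitute_def linear_extension_comp ..
  then show ?thesis by (simp add: substitute_prod_mset) (simp add: substitute_def)
qed

lemma prod_mset_mon: "(\<Prod>i\<in>#M. Poly_Mapping.single {#i#} (1 :: 'k::field)) = Poly_Mapping.single M 1"
  by (induction M) (auto simp: mult_single)

lemma substitute_id:
  assumes "p \<in> supported {M. set_mset M \<subseteq> A}" "\<And>i. i \<in> A \<Longrightarrow> s i = Poly_Mapping.single {#i#} 1"
  shows "substitute s p = p"
proof -
  have "substitute s p = linear_extension (\<lambda>M. Poly_Mapping.single M 1) p"
    unfolding substitute_def
  proof (rule linear_extension_cong)
    fix M assume "M \<in> Poly_Mapping.keys p"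
    then have "set_mset M \<subseteq> A" using assms(1) by (auto simp: supported_def)
    then have "(\<Prod>i\<in>#M. s i) = (\<Prod>i\<in>#M. Poly_Mapping.single {#i#} 1)"
      using assms(2) by (intro arg_cong[of _ _ prod_mset] image_mset_cong) auto
    then show "(\<Prod>i\<in>#M. s i) = Poly_Mapping.single M 1" by (simp add: prod_mset_mon)
  qed
  then show ?thesis by (simp add: linear_extension_id)
qed

lemma substitute_supported:
  assumes s: "\<And>i. s i \<in> supported {M. int (size M) = 1 \<and> set_mset M \<subseteq> A}"
    and p: "p \<in> supported {M. int (size M) = z}"
  shows "substitute s p \<in> supported {M. int (size M) = z \<and> set_mset M \<subseteq> A}"
  unfolding substitute_def
proof (rule supported_linear_extension)
  fix M assume "M \<in> Poly_Mapping.keys p"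
  then have z: "int (size M) = z" using p by (auto simp: supported_def)
  have "(\<Prod>i\<in>#M. s i) \<in> supported {N. int (size N) = int (size M) \<and> set_mset N \<subseteq> A}"
  proof (induction M)
    case empty
    show ?case by (simp add: supported_def)
  next
    case (add i M)
    show ?case unfolding image_mset_add_mset prod_mset.add_mset
      by (rule supported_mult[OF s add.IH]) auto
  qed
  then show "(\<Prod>i\<in>#M. s i) \<in> supported {M. int (size M) = z \<and> set_mset M \<subseteq> A}" using z by simp
qed

section \<open>Words and the induced maps of the free algebra\<close>

fun word_length :: "'a fword \<Rightarrow> nat" where
  "word_length (FWord l) = length l"

lemma word_length_add: "word_length (u + v) = word_length u + word_length v"
  by (cases u; cases v) simp

lemma word_length_0: "word_length 0 = 0"
  by (simp add: zero_fword_def)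

lemma map_fword_add: "map_fword f (u + v) = map_fword f u + map_fword f v"
  by (cases u; cases v) simp

lemma free_map_linear_extension: "free_map \<sigma> = linear_extension (\<lambda>w. Poly_Mapping.single (map_fword \<sigma> w) 1)"
  by (rule ext) (simp add: free_map_def linear_extension_def mult_single)

lemma free_map_add: "free_map \<sigma> (p + q) = free_map \<sigma> p + free_map \<sigma> q"
  and free_map_diff: "free_map \<sigma> (p - q) = free_map \<sigma> p - free_map \<sigma> q"
  and free_map_sum: "free_map \<sigma> (sum f K) = (\<Sum>i\<in>K. free_map \<sigma> (f i))"
  by (simp_all add: free_map_linear_extension linear_extension_add linear_extension_diff linear_extension_sum)

lemma free_map_mult: "free_map \<sigma> (p * q) = free_map \<sigma> p * free_map \<sigma> q"
  unfolding free_map_linear_extension by (rule linear_extension_mult) (simp add: map_fword_add mult_single)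

lemma free_map_gen: "free_map \<sigma> (free_gen x) = free_gen (\<sigma> x)"
  by (simp add: free_map_linear_extension free_gen_def mult_single)

lemma free_map_scalar: "free_map \<sigma> (free_scalar c) = free_scalar c"
  by (simp add: free_map_linear_extension free_scalar_def mult_single zero_fword_def)

lemma free_map_comp: "free_map (\<sigma> \<circ> \<tau>) p = free_map \<sigma> (free_map \<tau> p)"
  by (simp add: free_map_linear_extension linear_extension_comp fword.map_comp)

lemma free_map_id: "free_map id p = p"
  by (simp add: free_map_linear_extension fword.map_id linear_extension_id)

lemma free_algebra_ring: "ring free_algebra"
proof (rule ringI)
  show "abelian_group free_algebra"
  proof (rule abelian_groupI)
    fix x assume "x \<in> carrier free_algebra"
    show "\<exists>y\<in>carrier free_algebra. y \<oplus>\<^bsub>free_algebra\<^esub> x = \<zero>\<^bsub>free_algebra\<^esub>"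
      by (rule bexI[of _ "- x"]) (auto simp: free_algebra_def)
  qed (auto simp: free_algebra_def algebra_simps)
  show "monoid free_algebra" by (rule monoidI) (auto simp: free_algebra_def mult.assoc)
qed (auto simp: free_algebra_def algebra_simps)

lemma free_algebra_simps:
  "carrier free_algebra = UNIV" "x \<oplus>\<^bsub>free_algebra\<^esub> y = x + y" "x \<otimes>\<^bsub>free_algebra\<^esub> y = x * y"
  "\<zero>\<^bsub>free_algebra\<^esub> = 0" "\<one>\<^bsub>free_algebra\<^esub> = 1"
  by (auto simp: free_algebra_def)

lemma free_algebra_minus: "\<ominus>\<^bsub>free_algebra\<^esub> x = - x"
proof -
  interpret ring free_algebra by (rule free_algebra_ring)
  show ?thesis by (rule minus_equality) (auto simp: free_algebra_simps)
qed

text \<open>Passes from ideals of the ring record to closure conditions in the ring type. Closure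
  under negation is multiplication by -1.\<close>

lemma free_algebra_ideal_iff:
  "ideal K free_algebra \<longleftrightarrow> 0 \<in> K \<and> (\<forall>a\<in>K. \<forall>b\<in>K. a + b \<in> K) \<and> (\<forall>a\<in>K. \<forall>r. r * a \<in> K \<and> a * r \<in> K)"
  (is "?L \<longleftrightarrow> ?R")
proof
  assume ?L
  then interpret ideal K free_algebra .
  show ?R
    using additive_subgroup.a_closed[OF additive_subgroup_axioms] additive_subgroup.zero_closed[OF additive_subgroup_axioms]
      I_l_closed I_r_closed by (simp add: free_algebra_simps)
next
  assume R: ?R
  have m: "- a \<in> K" if "a \<in> K" for a
    using R that by (metis mult_minus1)
  show ?L
  proof (rule idealI[OF free_algebra_ring])
    have "inv\<^bsub>add_monoid free_algebra\<^esub> a = - a" for a :: "'a fword \<Rightarrow>\<^sub>0 'b"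
      using free_algebra_minus[of a] by (simp add: a_inv_def)
    then show "subgroup K (add_monoid free_algebra)"
      using R m by (intro subgroup.intro) (auto simp: free_algebra_simps)
  qed (use R in \<open>auto simp: free_algebra_simps\<close>)
qed

section \<open>Arithmetic modulo the enveloping ideal\<close>

context lie_algebra
begin

lemma enveloping_ideal_ideal: "ideal enveloping_ideal free_algebra"
  unfolding enveloping_ideal_def
  by (rule ring.genideal_ideal[OF free_algebra_ring]) (simp add: free_algebra_simps)

lemma enveloping_relations_subset: "enveloping_relations \<subseteq> enveloping_ideal"
  unfolding enveloping_ideal_def
  by (rule ring.genideal_self[OF free_algebra_ring]) (simp add: free_algebra_simps)

lemma enveloping_ideal_least:
  assumes "ideal K free_algebra" "enveloping_relations \<subseteq> K"
  shows "enveloping_ideal \<subseteq> K"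
  unfolding enveloping_ideal_def by (rule ring.genideal_minimal[OF free_algebra_ring assms])

lemma enveloping_ideal_zero: "0 \<in> enveloping_ideal"
  and enveloping_ideal_add: "a \<in> enveloping_ideal \<Longrightarrow> b \<in> enveloping_ideal \<Longrightarrow> a + b \<in> enveloping_ideal"
  and enveloping_ideal_left: "a \<in> enveloping_ideal \<Longrightarrow> r * a \<in> enveloping_ideal"
  and enveloping_ideal_right: "a \<in> enveloping_ideal \<Longrightarrow> a * r \<in> enveloping_ideal"
  using enveloping_ideal_ideal unfolding free_algebra_ideal_iff by blast+

lemma enveloping_ideal_uminus: "a \<in> enveloping_ideal \<Longrightarrow> - a \<in> enveloping_ideal"
  using enveloping_ideal_left[of a "- 1"] by simp

lemma enveloping_ideal_diff: "a \<in> enveloping_ideal \<Longrightarrow> b \<in> enveloping_ideal \<Longrightarrow> a - b \<in> enveloping_ideal"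
  using enveloping_ideal_add[OF _ enveloping_ideal_uminus, of a b] by simp

lemma gen_add_rel: "free_gen (x + y) - free_gen x - free_gen y \<in> enveloping_ideal"
  and gen_scale_rel: "free_gen (c *s x) - free_scalar c * free_gen x \<in> enveloping_ideal"
  and gen_bracket_rel: "free_gen x * free_gen y - free_gen y * free_gen x - free_gen (bracket x y) \<in> enveloping_ideal"
  by (rule subsetD[OF enveloping_relations_subset]; unfold enveloping_relations_def; blast)+

end

section \<open>The symbol map of the enveloping algebra\<close>

context lie_algebra_basis
begin

section \<open>Polynomials as a module over the enveloping algebra\<close>

fun rep_word :: "'g fword \<Rightarrow> (nat multiset \<Rightarrow>\<^sub>0 'k) \<Rightarrow> (nat multiset \<Rightarrow>\<^sub>0 'k)" where
  "rep_word (FWord l) p = foldr rep l p"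

definition rep_free :: "('g fword \<Rightarrow>\<^sub>0 'k) \<Rightarrow> (nat multiset \<Rightarrow>\<^sub>0 'k) \<Rightarrow> (nat multiset \<Rightarrow>\<^sub>0 'k)" where
  "rep_free t p = linear_extension (\<lambda>w. rep_word w p) t"

lemma rep_word_append: "rep_word (u + v) p = rep_word u (rep_word v p)"
  by (cases u; cases v) simp

lemma rep_word_0: "rep_word 0 p = p"
  by (simp add: zero_fword_def)

lemma rep_word_add: "rep_word w (p + q) = rep_word w p + rep_word w q"
proof (cases w)
  case (FWord l)
  have "foldr rep l (p + q) = foldr rep l p + foldr rep l q" by (induction l) (auto simp: rep_add)
  then show ?thesis by (simp add: FWord)
qed

lemma rep_word_scale: "rep_word w (const_poly c * p) = const_poly c * rep_word w p"
proof (cases w)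
  case (FWord l)
  have "foldr rep l (const_poly c * p) = const_poly c * foldr rep l p" by (induction l) (auto simp: rep_scale)
  then show ?thesis by (simp add: FWord)
qed

lemma rep_free_add_left: "rep_free (s + t) p = rep_free s p + rep_free t p"
  and rep_free_diff_left: "rep_free (s - t) p = rep_free s p - rep_free t p"
  by (simp_all add: rep_free_def linear_extension_add linear_extension_diff)

lemma rep_free_add: "rep_free t (p + q) = rep_free t p + rep_free t q"
  by (simp add: rep_free_def linear_extension_def rep_word_add distrib_left sum.distrib)

lemma rep_free_mult: "rep_free (s * t) p = rep_free s (rep_free t p)"
proof (induction s rule: poly_mapping_induct)
  case (monomial u c)
  show ?case
  proof (induction t rule: poly_mapping_induct)
    case (monomial v b)
    show ?case
      by (simp add: rep_free_def mult_single rep_word_append rep_word_scale mult.assoc[symmetric])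
  next
    case (add t t')
    then show ?case by (simp add: distrib_left rep_free_add_left rep_free_add)
  qed
qed (simp add: distrib_right rep_free_add_left)

lemma rep_free_gen: "rep_free (free_gen x) p = rep x p"
  by (simp add: rep_free_def free_gen_def)

lemma rep_free_scalar: "rep_free (free_scalar c) p = const_poly c * p"
  by (simp add: rep_free_def free_scalar_def rep_word_0)

text \<open>The annihilator of the polynomial module is an ideal, and it contains the defining
  relations; for the bracket relations this is \<open>rep_bracket\<close>. So the action descends to
  \<open>U(g)\<close>.\<close>

lemma rep_free_ideal:
  assumes "t \<in> enveloping_ideal"
  shows "rep_free t p = 0"
proof -
  let ?K = "{t. \<forall>p. rep_free t p = 0}"
  have zero: "rep_free t 0 = 0" for t
    using rep_free_add[of t 0 0] by (metis add.right_neutral add_left_cancel)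
  have "ideal ?K free_algebra"
    unfolding free_algebra_ideal_iff
    by (auto simp: rep_free_add_left rep_free_mult zero) (simp add: rep_free_def)
  moreover have "enveloping_relations \<subseteq> ?K"
    by (auto simp: enveloping_relations_def rep_free_diff_left rep_free_mult rep_free_gen rep_free_scalar
        rep_add_vector rep_scale_vector rep_bracket)
  ultimately show ?thesis using enveloping_ideal_least assms by blast
qed

section \<open>Linear forms and the symmetric algebra\<close>

definition lin :: "'g \<Rightarrow> (nat multiset \<Rightarrow>\<^sub>0 'k)" where
  "lin v = (\<Sum>k<d. const_poly (crd v k) * mon {#k#})"

abbreviation forms :: "int \<Rightarrow> (nat multiset \<Rightarrow>\<^sub>0 'k) set" where
  "forms z \<equiv> supported {M. int (size M) = z \<and> set_mset M \<subseteq> {..<d}}"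

lemma lin_add: "lin (v + w) = lin v + lin w"
  by (simp add: lin_def crd_add single_add distrib_right sum.distrib)

lemma lin_scale: "lin (c *s v) = const_poly c * lin v"
  by (simp add: lin_def crd_scale const_poly_mult mult.assoc sum_distrib_left)

lemma lin_zero: "lin 0 = 0"
  by (simp add: lin_def crd_zero)

lemma lin_uminus: "lin (- v) = - lin v"
  using lin_add[of v "- v"] by (simp add: lin_zero eq_neg_iff_add_eq_0 add.commute)

lemma lin_diff: "lin (v - w) = lin v - lin w"
  using lin_add[of v "- w"] by (simp add: lin_uminus)

lemma lin_sum: "lin (sum f A) = (\<Sum>i\<in>A. lin (f i))"
  by (induction A rule: infinite_finite_induct) (auto simp: lin_zero lin_add)

lemma lin_basis: "i < d \<Longrightarrow> lin (e i) = mon {#i#}"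
proof -
  assume i: "i < d"
  have "lin (e i) = (\<Sum>k<d. if k = i then mon {#i#} else 0)"
    unfolding lin_def using i by (intro sum.cong refl) (auto simp: crd_basis)
  then show ?thesis using i by simp
qed

lemma lin_in_forms: "lin v \<in> forms 1"
  unfolding lin_def by (intro supported_sum supported_scale supported_single) auto

lemma lookup_lin: "k < d \<Longrightarrow> Poly_Mapping.lookup (lin v) {#k#} = crd v k"
proof -
  assume k: "k < d"
  have "Poly_Mapping.lookup (lin v) {#k#} = (\<Sum>j<d. if j = k then crd v k else 0)"
    unfolding lin_def lookup_sum by (intro sum.cong refl) (auto simp: mult_single lookup_single)
  then show ?thesis using k by simp
qed

lemma lin_eq_0_iff: "lin v = 0 \<longleftrightarrow> v = 0"
proof
  assume "lin v = 0"
  then have "crd v k = 0" if "k < d" for k using lookup_lin[OF that, of v] by simp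
  then have "(\<Sum>i<d. crd v i *s e i) = 0" by simp
  then show "v = 0" by (simp add: crd_expand)
qed (simp add: lin_zero)

lemma substitute_lin: "substitute s (lin v) = (\<Sum>k<d. const_poly (crd v k) * s k)"
  unfolding lin_def substitute_sum substitute_scale by (simp add: substitute_mon)

fun sym_word :: "'g fword \<Rightarrow> (nat multiset \<Rightarrow>\<^sub>0 'k)" where
  "sym_word (FWord l) = (\<Prod>x\<leftarrow>l. lin x)"

text \<open>The algebra map that forgets the order of the letters: from the free algebra to the
  symmetric algebra of \<open>g\<close>, written in coordinates.\<close>

definition sym :: "('g fword \<Rightarrow>\<^sub>0 'k) \<Rightarrow> (nat multiset \<Rightarrow>\<^sub>0 'k)" where
  "sym = linear_extension sym_word"

lemma sym_word_append: "sym_word (u + v) = sym_word u * sym_word v"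
  by (cases u; cases v) simp

lemma sym_mult: "sym (s * t) = sym s * sym t"
  unfolding sym_def by (rule linear_extension_mult) (rule sym_word_append)

lemma sym_word_in_forms: "sym_word w \<in> forms (int (word_length w))"
proof (cases w)
  case (FWord l)
  have "(\<Prod>x\<leftarrow>l. lin x) \<in> forms (int (length l))"
  proof (induction l)
    case Nil
    show ?case by (simp add: supported_def)
  next
    case (Cons x l)
    have "lin x * (\<Prod>x\<leftarrow>l. lin x) \<in> forms (int (length (x # l)))"
      by (rule supported_mult[OF lin_in_forms Cons.IH]) auto
    then show ?case by simp
  qed
  then show ?thesis by (simp add: FWord)
qed

lemma rep_leading:
  assumes "p \<in> weight_le size z"
  shows "rep v p - lin v * p \<in> weight_le size z"
proof -
  have "rep v p - lin v * p = (\<Sum>k<d. const_poly (crd v k) * (pbw k p - mon {#k#} * p))"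
    by (simp add: rep_def lin_def sum_distrib_right right_diff_distrib sum_subtractf mult.assoc)
  also have "\<dots> \<in> weight_le size z"
    by (intro weight_le_sum weight_le_scale pbw_leading assms)
  finally show ?thesis .
qed

lemma forms_weight_le: "p \<in> forms z \<Longrightarrow> p \<in> weight_le size z"
  by (auto simp: supported_def weight_le_def)

text \<open>By \<open>rep_leading\<close>, each letter acts as multiplication by its linear form up
  to terms that do not raise the degree. Peeling letters off the word, these errors stay at least
  one degree below the product.\<close>

lemma rep_word_leading: "rep_word w 1 - sym_word w \<in> weight_le size (int (word_length w) - 1)"
proof (cases w)
  case (FWord l)
  have "foldr rep l 1 - sym_word (FWord l) \<in> weight_le size (int (length l) - 1)"
  proof (induction l)
    case Nil
    show ?case by (simp add: weight_le_zero)
  next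
    case (Cons x l)
    let ?q = "sym_word (FWord l)" and ?n = "int (length l)"
    let ?r = "foldr rep l 1 - ?q"
    have q: "?q \<in> weight_le size ?n" using forms_weight_le[OF sym_word_in_forms[of "FWord l"]] by simp
    have "lin x * ?r \<in> weight_le size (1 + (?n - 1))"
      by (rule weight_le_mult[OF _ forms_weight_le[OF lin_in_forms] Cons.IH]) simp
    then have lr: "lin x * ?r \<in> weight_le size ?n" by simp
    have r: "rep x ?r - lin x * ?r \<in> weight_le size ?n"
      using rep_leading[OF Cons.IH, of x] by (rule weight_le_mono) simp
    have "(rep x ?q - lin x * ?q) + ((rep x ?r - lin x * ?r) + lin x * ?r) \<in> weight_le size ?n"
      by (intro weight_le_add rep_leading q r lr)
    then show ?case by (simp add: rep_diff)
  qed
  then show ?thesis by (simp add: FWord)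
qed

section \<open>The filtration of the enveloping algebra and its symbols\<close>

abbreviation free_le :: "int \<Rightarrow> ('g fword \<Rightarrow>\<^sub>0 'k) set" where
  "free_le \<equiv> weight_le word_length"

definition filt :: "int \<Rightarrow> ('g fword \<Rightarrow>\<^sub>0 'k) set" where
  "filt z = {t. \<exists>t'\<in>free_le z. t - t' \<in> enveloping_ideal}"

text \<open>Acting on \<open>1\<close> makes the value depend only on the class modulo the
  enveloping ideal. On a representative made of words of length at most \<open>z\<close> it agrees
  with the degree \<open>z\<close> part of \<open>sym\<close>, from which multiplicativity and
  equivariance are read off.\<close>

definition symb :: "int \<Rightarrow> ('g fword \<Rightarrow>\<^sub>0 'k) \<Rightarrow> (nat multiset \<Rightarrow>\<^sub>0 'k)" where
  "symb z t = homogeneous_part z (rep_free t 1)"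

lemma free_le_filt: "t \<in> free_le z \<Longrightarrow> t \<in> filt z"
  unfolding filt_def using enveloping_ideal_zero by force

lemma filt_ideal_cong: assumes "t \<in> filt z" "s - t \<in> enveloping_ideal" shows "s \<in> filt z"
proof -
  obtain t' where t': "t' \<in> free_le z" "t - t' \<in> enveloping_ideal" using assms(1) by (auto simp: filt_def)
  have "(s - t) + (t - t') \<in> enveloping_ideal" by (intro enveloping_ideal_add assms t')
  then show ?thesis using t' by (auto simp: filt_def)
qed

lemma symb_cong: "s - t \<in> enveloping_ideal \<Longrightarrow> symb z s = symb z t"
  using rep_free_ideal[of "s - t" 1] by (simp add: symb_def rep_free_diff_left)

lemma symb_free_le:
  assumes "t \<in> free_le z"
  shows "symb z t = homogeneous_part z (sym t)"
  unfolding symb_def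
proof (rule homogeneous_part_cong)
  show "rep_free t 1 - sym t \<in> weight_le size (z - 1)"
    unfolding rep_free_def sym_def linear_extension_diff_fun
  proof (rule weight_le_linear_extension)
    fix w assume "w \<in> Poly_Mapping.keys t"
    then have "int (word_length w) \<le> z" using assms by (auto simp: weight_le_def)
    then show "rep_word w 1 - sym_word w \<in> weight_le size (z - 1)"
      by (intro weight_le_mono[OF rep_word_leading]) simp
  qed
qed

lemma sym_weight_le:
  assumes "t \<in> free_le z"
  shows "sym t \<in> weight_le size z"
  unfolding sym_def
proof (rule weight_le_linear_extension)
  fix w assume "w \<in> Poly_Mapping.keys t"
  then have "int (word_length w) \<le> z" using assms by (auto simp: weight_le_def)
  then show "sym_word w \<in> weight_le size z"
    by (rule weight_le_mono[OF forms_weight_le[OF sym_word_in_forms]])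
qed

lemma sym_vars: "sym t \<in> supported {M. set_mset M \<subseteq> {..<d}}"
  unfolding sym_def
proof (rule supported_linear_extension)
  fix w
  show "sym_word w \<in> supported {M. set_mset M \<subseteq> {..<d}}"
    by (rule supported_mono[OF sym_word_in_forms]) auto
qed

lemma filt_zero: "0 \<in> filt z"
  by (intro free_le_filt weight_le_zero)

lemma filt_add: assumes "a \<in> filt z" "b \<in> filt z" shows "a + b \<in> filt z"
proof -
  obtain a' b' where "a' \<in> free_le z" "a - a' \<in> enveloping_ideal" "b' \<in> free_le z" "b - b' \<in> enveloping_ideal"
    using assms by (auto simp: filt_def)
  then have "a' + b' \<in> free_le z" "(a - a') + (b - b') \<in> enveloping_ideal"
    by (auto intro: weight_le_add enveloping_ideal_add)
  then show ?thesis by (auto simp: filt_def algebra_simps)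
qed

lemma filt_mult:
  assumes "a \<in> filt m" "b \<in> filt n"
  shows "a * b \<in> filt (m + n)" and "symb (m + n) (a * b) = symb m a * symb n b"
proof -
  obtain a' b' where a': "a' \<in> free_le m" "a - a' \<in> enveloping_ideal" and b': "b' \<in> free_le n" "b - b' \<in> enveloping_ideal"
    using assms by (auto simp: filt_def)
  have ab: "a' * b' \<in> free_le (m + n)" by (rule weight_le_mult[OF word_length_add a'(1) b'(1)])
  have "(a - a') * b + a' * (b - b') \<in> enveloping_ideal"
    by (intro enveloping_ideal_add enveloping_ideal_left enveloping_ideal_right a' b')
  then have "a * b - a' * b' \<in> enveloping_ideal" by (simp add: algebra_simps)
  then show "a * b \<in> filt (m + n)" "symb (m + n) (a * b) = symb m a * symb n b"
    using ab symb_cong[of "a * b" "a' * b'" "m + n"] symb_cong[OF a'(2), of m] symb_cong[OF b'(2), of n]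
      symb_free_le[OF ab] symb_free_le[OF a'(1)] symb_free_le[OF b'(1)]
      homogeneous_part_mult[OF sym_weight_le[OF a'(1)] sym_weight_le[OF b'(1)]]
    by (auto simp: filt_def sym_mult)
qed

lemma filt_scalar: "const_poly c \<in> filt 0"
  by (intro free_le_filt weight_le_single) (simp add: word_length_0)

lemma filt_scale: "a \<in> filt z \<Longrightarrow> const_poly c * a \<in> filt z"
  using filt_mult(1)[OF filt_scalar, of a z c] by simp

lemma filt_uminus: "a \<in> filt z \<Longrightarrow> - a \<in> filt z"
  using filt_scale[of a z "- 1"] by (simp add: single_uminus)

lemma filt_sum: "(\<And>i. i \<in> A \<Longrightarrow> f i \<in> filt z) \<Longrightarrow> sum f A \<in> filt z"
  by (induction A rule: infinite_finite_induct) (auto simp: filt_zero filt_add)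

lemma filt_mono: "a \<in> filt y \<Longrightarrow> y \<le> z \<Longrightarrow> a \<in> filt z"
  unfolding filt_def using weight_le_mono by blast

lemma filt_neg: "z < 0 \<Longrightarrow> filt z = enveloping_ideal"
proof -
  assume "z < 0"
  have "p = 0" if "p \<in> free_le z" for p
  proof -
    have "\<not> int (word_length w) \<le> z" for w :: "'g fword" using \<open>z < 0\<close> by simp
    then have "Poly_Mapping.keys p = {}" using that unfolding weight_le_def by blast
    then show ?thesis by simp
  qed
  then have "free_le z = {0}" using weight_le_zero by auto
  then show ?thesis by (simp add: filt_def)
qed

lemma filt_exhaust: "\<exists>z. t \<in> filt z"
proof
  have "int (word_length w) \<le> int (\<Sum>w\<in>Poly_Mapping.keys t. word_length w)" if "w \<in> Poly_Mapping.keys t" for w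
    using member_le_sum[OF that, of word_length] by (simp only: of_nat_le_iff finite_keys)
  then show "t \<in> filt (int (\<Sum>w\<in>Poly_Mapping.keys t. word_length w))"
    by (intro free_le_filt) (auto simp: weight_le_def)
qed

lemma symb_in_forms: "t \<in> filt z \<Longrightarrow> symb z t \<in> forms z"
proof -
  assume "t \<in> filt z"
  then obtain t' where t': "t' \<in> free_le z" "t - t' \<in> enveloping_ideal" by (auto simp: filt_def)
  have "homogeneous_part z (sym t') \<in> supported {M \<in> {M. set_mset M \<subseteq> {..<d}}. int (size M) = z}"
    by (rule homogeneous_part_supported[OF sym_vars])
  then have "homogeneous_part z (sym t') \<in> forms z" by (rule supported_mono) auto
  then show ?thesis using symb_cong[OF t'(2)] symb_free_le[OF t'(1)] by simp
qed

lemma symb_add: "symb z (a + b) = symb z a + symb z b"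
  by (simp add: symb_def rep_free_add_left homogeneous_part_add)

section \<open>Ordered words and the kernel of the symbol map\<close>

definition ordered_word :: "nat multiset \<Rightarrow> ('g fword \<Rightarrow>\<^sub>0 'k)" where
  "ordered_word M = Poly_Mapping.single (FWord (map e (sorted_list_of_multiset M))) 1"

text \<open>A linear section of \<open>sym\<close> on polynomials in the first \<open>d\<close>
  variables, compatible with multiplication only up to lower degree.\<close>

definition ordered_lift :: "(nat multiset \<Rightarrow>\<^sub>0 'k) \<Rightarrow> ('g fword \<Rightarrow>\<^sub>0 'k)" where
  "ordered_lift = linear_extension ordered_word"

lemma single_word_Cons:
  "Poly_Mapping.single (FWord (x # l)) 1 = free_gen x * Poly_Mapping.single (FWord l) 1"
  by (simp add: free_gen_def mult_single)

lemma single_word_filt: "Poly_Mapping.single (FWord l) c \<in> filt (int (length l))"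
  by (intro free_le_filt weight_le_single) simp

lemma free_gen_filt: "free_gen x \<in> filt 1"
  unfolding free_gen_def using single_word_filt[of "[x]" 1] by simp

text \<open>Every exchange of neighbouring letters costs a bracket, which modulo the ideal is a
  single letter in place of two.\<close>

lemma insort_word:
  "Poly_Mapping.single (FWord (map e (k # l))) 1 - Poly_Mapping.single (FWord (map e (insort k l))) 1 \<in> filt (int (length l))"
proof (induction l)
  case Nil
  show ?case by (simp add: filt_zero)
next
  case (Cons y l)
  let ?W = "\<lambda>l. Poly_Mapping.single (FWord (map e l)) 1"
  show ?case
  proof (cases "k \<le> y")
    case True
    then show ?thesis by (simp add: filt_zero)
  next
    case False
    let ?c = "free_gen (e k) * free_gen (e y) - free_gen (e y) * free_gen (e k)"
    have "?c \<in> filt 1"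
      by (rule filt_ideal_cong[OF free_gen_filt]) (rule gen_bracket_rel)
    from filt_mult(1)[OF this single_word_filt] have 1: "?c * ?W l \<in> filt (1 + int (length l))"
      by (metis length_map)
    have 2: "free_gen (e y) * (?W (k # l) - ?W (insort k l)) \<in> filt (1 + int (length l))"
      by (rule filt_mult(1)[OF free_gen_filt Cons.IH])
    have eq: "?W (k # y # l) - ?W (insort k (y # l)) = ?c * ?W l + free_gen (e y) * (?W (k # l) - ?W (insort k l))"
      using False by (simp add: single_word_Cons algebra_simps)
    have "?W (k # y # l) - ?W (insort k (y # l)) \<in> filt (1 + int (length l))"
      unfolding eq by (rule filt_add[OF 1 2])
    then show ?thesis by (simp only: length_Cons of_nat_Suc add.commute)
  qed
qed

lemma gen_expand: "free_gen x - (\<Sum>k<d. const_poly (crd x k) * free_gen (e k)) \<in> enveloping_ideal"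
proof -
  have zero: "free_gen 0 \<in> enveloping_ideal"
    using enveloping_ideal_uminus[OF gen_add_rel[of 0 0]] by simp
  have "free_gen (\<Sum>k\<in>A. crd x k *s e k) - (\<Sum>k\<in>A. const_poly (crd x k) * free_gen (e k)) \<in> enveloping_ideal"
    if "finite A" for A
    using that
  proof (induction A rule: finite_induct)
    case (insert k A)
    let ?s = "\<Sum>k\<in>A. crd x k *s e k" and ?t = "\<Sum>k\<in>A. const_poly (crd x k) * free_gen (e k)"
    have "(free_gen (crd x k *s e k + ?s) - free_gen (crd x k *s e k) - free_gen ?s)
      + ((free_gen (crd x k *s e k) - free_scalar (crd x k) * free_gen (e k)) + (free_gen ?s - ?t)) \<in> enveloping_ideal"
      by (intro enveloping_ideal_add gen_add_rel gen_scale_rel insert.IH)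
    then show ?case using insert by (simp add: free_scalar_def algebra_simps)
  qed (simp add: zero)
  from this[of "{..<d}"] show ?thesis by (simp add: crd_expand)
qed

lemma ordered_lift_scale: "ordered_lift (const_poly c * p) = const_poly c * ordered_lift p"
  and ordered_lift_sum: "ordered_lift (sum f A) = (\<Sum>i\<in>A. ordered_lift (f i))"
  by (simp_all add: ordered_lift_def linear_extension_add linear_extension_scale linear_extension_sum)

lemma ordered_lift_filt:
  assumes "p \<in> weight_le size z"
  shows "ordered_lift p \<in> free_le z"
  unfolding ordered_lift_def
proof (rule weight_le_linear_extension)
  fix M assume "M \<in> Poly_Mapping.keys p"
  then have "int (size M) \<le> z" using assms by (auto simp: weight_le_def)
  then show "ordered_word M \<in> free_le z"
    unfolding ordered_word_def by (intro weight_le_single) (simp flip: size_mset)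
qed

text \<open>Multiplying by a generator commutes with the ordered lift up to one degree less than the
  product. Expanding \<open>x\<close> and \<open>p\<close> reduces this to inserting one basis
  letter into a sorted word, which is \<open>insort_word\<close>.\<close>

lemma gen_ordered_lift:
  assumes "p \<in> weight_le size z"
  shows "free_gen x * ordered_lift p - ordered_lift (lin x * p) \<in> filt z"
proof -
  have basis: "free_gen (e k) * ordered_word M - ordered_word (add_mset k M) \<in> filt (int (size M))" for k M
    using insort_word[of k "sorted_list_of_multiset M"] 
    by (simp add: ordered_word_def single_word_Cons flip: size_mset)
  have mono: "free_gen x * ordered_word M - ordered_lift (lin x * mon M) \<in> filt (int (size M))" for M
  proof -
    let ?g = "\<Sum>k<d. const_poly (crd x k) * free_gen (e k)"
    have "(free_gen x - ?g) * ordered_word M + (\<Sum>k<d. const_poly (crd x k) * (free_gen (e k) * ordered_word M - ordered_word (add_mset k M))) \<in> filt (int (size M))"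
    proof (intro filt_add filt_sum filt_scale basis)
      have "(free_gen x - ?g) * ordered_word M \<in> enveloping_ideal"
        by (intro enveloping_ideal_right gen_expand)
      then show "(free_gen x - ?g) * ordered_word M \<in> filt (int (size M))"
        by (intro filt_ideal_cong[OF filt_zero]) simp
    qed
    moreover have "ordered_lift (lin x * mon M) = (\<Sum>k<d. const_poly (crd x k) * ordered_word (add_mset k M))"
    proof -
      have "lin x * mon M = (\<Sum>k<d. const_poly (crd x k) * mon (add_mset k M))"
        by (simp add: lin_def sum_distrib_right mult_single)
      then show ?thesis by (simp only: ordered_lift_sum ordered_lift_scale) (simp add: ordered_lift_def)
    qed
    ultimately show ?thesis
      by (simp add: algebra_simps sum_distrib_right sum_subtractf)
  qed
  have "ordered_lift (lin x * p) = ordered_lift (lin x * linear_extension (\<lambda>M. mon M) p)"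
    by (simp add: linear_extension_id)
  also have "\<dots> = linear_extension (\<lambda>M. ordered_lift (lin x * mon M)) p"
    unfolding linear_extension_mult_left ordered_lift_def linear_extension_comp ..
  finally have 1: "ordered_lift (lin x * p) = linear_extension (\<lambda>M. ordered_lift (lin x * mon M)) p" .
  have 2: "free_gen x * ordered_lift p = linear_extension (\<lambda>M. free_gen x * ordered_word M) p"
    unfolding ordered_lift_def by (rule linear_extension_mult_left)
  have "free_gen x * ordered_lift p - ordered_lift (lin x * p)
      = linear_extension (\<lambda>M. free_gen x * ordered_word M - ordered_lift (lin x * mon M)) p"
    unfolding 1 2 by (rule linear_extension_diff_fun)
  also have "\<dots> \<in> filt z"
    unfolding linear_extension_def
  proof (intro filt_sum filt_scale)
    fix M assume "M \<in> Poly_Mapping.keys p"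
    then have "int (size M) \<le> z" using assms by (auto simp: weight_le_def)
    then show "free_gen x * ordered_word M - ordered_lift (lin x * mon M) \<in> filt z"
      using mono filt_mono by blast
  qed
  finally show ?thesis .
qed

text \<open>The spanning half of the Poincare-Birkhoff-Witt theorem: modulo shorter words every word
  is a combination of sorted ones, namely of those prescribed by the commutative product of its
  letters.\<close>

lemma word_ordered_lift:
  "Poly_Mapping.single w 1 - ordered_lift (sym_word w) \<in> filt (int (word_length w) - 1)"
proof (cases w)
  case (FWord l)
  have "Poly_Mapping.single (FWord l) 1 - ordered_lift (sym_word (FWord l)) \<in> filt (int (length l) - 1)"
  proof (induction l)
    case Nil
    show ?case by (simp add: filt_zero ordered_lift_def ordered_word_def)
  next
    case (Cons x l)
    let ?q = "sym_word (FWord l)"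
    have q: "?q \<in> weight_le size (int (length l))"
      using forms_weight_le[OF sym_word_in_forms[of "FWord l"]] by simp
    have "free_gen x * (Poly_Mapping.single (FWord l) 1 - ordered_lift ?q) \<in> filt (1 + (int (length l) - 1))"
      by (rule filt_mult(1)[OF free_gen_filt Cons.IH])
    then have 1: "free_gen x * (Poly_Mapping.single (FWord l) 1 - ordered_lift ?q) \<in> filt (int (length l))" by simp
    have "free_gen x * (Poly_Mapping.single (FWord l) 1 - ordered_lift ?q) + (free_gen x * ordered_lift ?q - ordered_lift (lin x * ?q))
      \<in> filt (int (length l))"
      by (intro filt_add 1 gen_ordered_lift q)
    then show ?case by (simp add: single_word_Cons algebra_simps)
  qed
  then show ?thesis by (simp add: FWord)
qed

text \<open>That lower terms have no symbol comes from the polynomial representation. The converse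
  comes from sorting, by \<open>word_ordered_lift\<close>. Together they identify the associated
  graded ring with polynomials.\<close>

lemma symb_kernel:
  assumes "t \<in> filt z"
  shows "symb z t = 0 \<longleftrightarrow> t \<in> filt (z - 1)"
proof
  assume "t \<in> filt (z - 1)"
  then obtain t' where t': "t' \<in> free_le (z - 1)" "t - t' \<in> enveloping_ideal" by (auto simp: filt_def)
  then have "t' \<in> free_le z" by (auto intro: weight_le_mono)
  then have "symb z t = homogeneous_part z (sym t')" using symb_cong[OF t'(2)] symb_free_le by simp
  then show "symb z t = 0" using homogeneous_part_lower[OF sym_weight_le[OF t'(1)]] by simp
next
  assume 0: "symb z t = 0"
  obtain t' where t': "t' \<in> free_le z" "t - t' \<in> enveloping_ideal" using assms by (auto simp: filt_def)
  have h0: "homogeneous_part z (sym t') = 0" using 0 symb_cong[OF t'(2)] symb_free_le[OF t'(1)] by simp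
  \<comment> \<open>The subtracted term is zero. Inserting it lets every word be paired with the
    ordered lift of its own top part, so that each difference drops in degree separately.\<close>
  have "t' = linear_extension (\<lambda>w. Poly_Mapping.single w 1) t' - ordered_lift (homogeneous_part z (sym t'))"
    by (simp add: h0 linear_extension_id ordered_lift_def)
  also have "\<dots> = linear_extension (\<lambda>w. Poly_Mapping.single w 1 - ordered_lift (homogeneous_part z (sym_word w))) t'"
    unfolding sym_def homogeneous_part_def ordered_lift_def linear_extension_comp linear_extension_diff_fun ..
  also have "\<dots> \<in> filt (z - 1)"
    unfolding linear_extension_def
  proof (intro filt_sum filt_scale)
    fix w assume "w \<in> Poly_Mapping.keys t'"
    then have le: "int (word_length w) \<le> z" using t'(1) by (auto simp: weight_le_def)
    show "Poly_Mapping.single w 1 - ordered_lift (homogeneous_part z (sym_word w)) \<in> filt (z - 1)"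
    proof (cases "int (word_length w) = z")
      case True
      have "homogeneous_part z (sym_word w) = sym_word w"
        by (rule homogeneous_part_eq, rule supported_mono[OF sym_word_in_forms]) (use True in auto)
      then show ?thesis using word_ordered_lift[of w] True by simp
    next
      case False
      have "homogeneous_part z (sym_word w) = 0"
        by (rule homogeneous_part_lower, rule weight_le_mono[OF forms_weight_le[OF sym_word_in_forms]])
          (use False le in simp)
      moreover have "Poly_Mapping.single w 1 \<in> filt (z - 1)"
        by (intro free_le_filt weight_le_single) (use False le in simp)
      ultimately show ?thesis by (simp add: ordered_lift_def)
    qed
  qed
  finally show "t \<in> filt (z - 1)" using t'(2) filt_ideal_cong by blast
qed

lemma symb_onto:
  assumes "s \<in> forms z"
  shows "\<exists>t\<in>filt z. symb z t = s"
proof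
  have le: "ordered_lift s \<in> free_le z" by (rule ordered_lift_filt[OF forms_weight_le[OF assms]])
  then show "ordered_lift s \<in> filt z" by (rule free_le_filt)
  have "sym (ordered_lift s) = linear_extension (\<lambda>M. sym (ordered_word M)) s"
    unfolding sym_def ordered_lift_def linear_extension_comp ..
  also have "\<dots> = linear_extension (\<lambda>M. mon M) s"
  proof (rule linear_extension_cong)
    fix M assume "M \<in> Poly_Mapping.keys s"
    then have M: "set_mset M \<subseteq> {..<d}" using assms by (auto simp: supported_def)
    have "sym (ordered_word M) = (\<Prod>x\<leftarrow>map e (sorted_list_of_multiset M). lin x)"
      by (simp add: sym_def ordered_word_def)
    also have "\<dots> = (\<Prod>k\<leftarrow>sorted_list_of_multiset M. mon {#k#})"
      using M by (auto intro!: arg_cong[of _ _ prod_list] lin_basis)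
    also have "\<dots> = (\<Prod>k\<in>#M. mon {#k#})"
      by (simp add: prod_mset_prod_list[symmetric])
    finally show "sym (ordered_word M) = mon M" by (simp add: prod_mset_mon)
  qed
  finally have "sym (ordered_lift s) = s" by (simp add: linear_extension_id)
  then show "symb z (ordered_lift s) = s"
    using symb_free_le[OF le] homogeneous_part_eq[OF supported_mono[OF assms]] by auto
qed

section \<open>Divisibility by linear forms and generation in degree one\<close>

text \<open>Modulo \<open>lin u\<close> one variable can be eliminated. The eliminating substitution
  kills \<open>lin u\<close> but not \<open>lin v\<close>, so the equation shows in a domain that it
  kills \<open>a\<close>. Every form differs from its image by a multiple of \<open>lin u\<close>,
  hence \<open>a\<close> is such a multiple.\<close>

lemma coprime_linear_forms:
  assumes u: "u \<noteq> 0" and v: "\<And>c. v \<noteq> c *s u" and a: "a \<in> forms z"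
    and ab: "lin u * b = lin v * a"
  shows "\<exists>c\<in>forms (z - 1). a = lin u * c"
proof -
  obtain i where i: "i < d" "crd u i \<noteq> 0"
  proof -
    have "\<exists>i<d. crd u i \<noteq> 0"
    proof (rule ccontr)
      assume "\<not> (\<exists>i<d. crd u i \<noteq> 0)"
      then have "(\<Sum>i<d. crd u i *s e i) = 0" by (intro sum.neutral) simp
      then show False using u by (simp add: crd_expand)
    qed
    then show ?thesis using that by blast
  qed
  \<comment> \<open>Solves \<open>lin u = 0\<close> for the variable \<open>i\<close>; on linear
    forms it is the projection along \<open>u\<close> given in \<open>sub\<close>.\<close>
  define s where "s k = mon {#k#} - (if k = i then const_poly (1 / crd u i) * lin u else 0)" for k
  have sub: "substitute s (lin w) = lin (w - (crd w i / crd u i) *s u)" for w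
  proof -
    have "substitute s (lin w) = lin w - (\<Sum>k<d. const_poly (crd w k) * (if k = i then const_poly (1 / crd u i) * lin u else 0))"
      unfolding substitute_lin s_def by (simp add: right_diff_distrib sum_subtractf lin_def)
    also have "(\<Sum>k<d. const_poly (crd w k) * (if k = i then const_poly (1 / crd u i) * lin u else 0))
      = (\<Sum>k<d. if k = i then const_poly (crd w i) * (const_poly (1 / crd u i) * lin u) else 0)"
      by (intro sum.cong) auto
    also have "\<dots> = const_poly (crd w i / crd u i) * lin u"
      using i by (simp add: mult.assoc[symmetric] mult_single)
    finally show ?thesis by (simp add: lin_diff lin_scale)
  qed
  have "substitute s (lin u) * substitute s b = substitute s (lin v) * substitute s a"
    unfolding substitute_mult[symmetric] ab ..
  moreover have "substitute s (lin u) = 0" using i by (simp add: sub lin_zero)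
  moreover have "substitute s (lin v) \<noteq> 0" using v by (simp add: sub lin_eq_0_iff)
  ultimately have a0: "substitute s a = 0" by simp
  have mono: "\<exists>c\<in>forms (int (size M) - 1). mon M - substitute s (mon M) = lin u * c" if "set_mset M \<subseteq> {..<d}" for M
    using that
  proof (induction M)
    case empty
    show ?case by (intro bexI[of _ 0]) (auto simp: supported_zero substitute_1)
  next
    case (add k M)
    then obtain c where c: "c \<in> forms (int (size M) - 1)" "mon M - substitute s (mon M) = lin u * c" by auto
    have sk: "s k \<in> forms 1"
    proof -
      have 1: "const_poly (1 / crd u i) * lin u \<in> forms 1"
        by (rule supported_scale[OF lin_in_forms])
      have 2: "mon {#k#} \<in> forms 1"
        by (rule supported_single) (use add.prems in simp)
      have "mon {#k#} + - (const_poly (1 / crd u i) * lin u) \<in> forms 1"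
        by (rule supported_add[OF 2 supported_uminus[OF 1]])
      with 2 show ?thesis unfolding s_def by (cases "k = i") simp_all
    qed
    \<comment> \<open>With \<open>x\<close> the variable \<open>k\<close> and \<open>M'\<close> the
      image of \<open>M\<close>, the splitting is
      \<open>x M - s k M' = (x - s k) M + s k (M - M')\<close>. The first bracket is zero unless
      \<open>k = i\<close>, when it is \<open>lin u\<close> divided by
      \<open>crd u i\<close>.\<close>
    let ?c = "(if k = i then const_poly (1 / crd u i) * mon M else 0) + s k * c"
    have "s k * c \<in> forms (int (size M))"
      by (rule supported_mult[OF sk c(1)]) auto
    then have cin: "?c \<in> forms (int (size M))"
      using add.prems by (intro supported_add) (auto intro: supported_scale supported_single supported_zero)
    have ceq: "mon (add_mset k M) - substitute s (mon (add_mset k M)) = lin u * ?c"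
    proof -
      have "mon (add_mset k M) = mon {#k#} * mon M" by (simp add: mult_single)
      then have "mon (add_mset k M) - substitute s (mon (add_mset k M)) = mon {#k#} * mon M - s k * substitute s (mon M)"
        by (simp only: substitute_mult) (simp add: substitute_mon)
      also have "\<dots> = (mon {#k#} - s k) * mon M + s k * (mon M - substitute s (mon M))"
        by (simp only: left_diff_distrib right_diff_distrib) simp
      also have "\<dots> = lin u * ?c"
        unfolding c(2) by (simp add: s_def algebra_simps)
      finally show ?thesis .
    qed
    have sz: "int (size (add_mset k M)) - 1 = int (size M)" by simp
    show ?case unfolding sz by (rule bexI[of _ ?c], rule ceq, rule cin)
  qed
  have "\<forall>M\<in>Poly_Mapping.keys a. \<exists>c. c \<in> forms (z - 1) \<and> mon M - substitute s (mon M) = lin u * c"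
  proof
    fix M assume "M \<in> Poly_Mapping.keys a"
    then have "int (size M) = z" "set_mset M \<subseteq> {..<d}" using a by (auto simp: supported_def)
    with mono[of M] show "\<exists>c. c \<in> forms (z - 1) \<and> mon M - substitute s (mon M) = lin u * c" by blast
  qed
  from bchoice[OF this] obtain c where
    c: "\<forall>M\<in>Poly_Mapping.keys a. c M \<in> forms (z - 1) \<and> mon M - substitute s (mon M) = lin u * c M" ..
  have "a - substitute s a = linear_extension (\<lambda>M. mon M) a - substitute s (linear_extension (\<lambda>M. mon M) a)"
    by (simp add: linear_extension_id)
  also have "\<dots> = linear_extension (\<lambda>M. mon M - substitute s (mon M)) a"
    unfolding substitute_def linear_extension_comp linear_extension_diff_fun ..
  also have "\<dots> = linear_extension (\<lambda>M. lin u * c M) a"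
    by (rule linear_extension_cong) (use c in blast)
  also have "\<dots> = lin u * linear_extension c a" by (rule linear_extension_mult_left[symmetric])
  finally have "a = lin u * linear_extension c a" using a0 by simp
  moreover have "linear_extension c a \<in> forms (z - 1)"
    by (rule supported_linear_extension) (use c in blast)
  ultimately show ?thesis by blast
qed

text \<open>Each monomial is assigned to its smallest variable, so that it is counted once;
  \<open>\<phi> j\<close> removes \<open>j\<close> from the monomials assigned to it.\<close>

lemma forms_generated:
  assumes a: "a \<in> forms z" and z: "z > 0"
  shows "\<exists>q. (\<forall>j\<in>{..<d}. q j \<in> forms (z - 1)) \<and> a = (\<Sum>j<d. mon {#j#} * q j)"
proof -
  define \<phi> where "\<phi> j M = (if M \<noteq> {#} \<and> Min_mset M = j then mon (M - {#j#}) else 0)" for j M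
  have min: "Min_mset M \<in># M" if "M \<noteq> {#}" for M :: "nat multiset"
    using that by (intro Min_in) auto
  have keys: "int (size M) = z" "set_mset M \<subseteq> {..<d}" "M \<noteq> {#}" if "M \<in> Poly_Mapping.keys a" for M
    using a z that by (auto simp: supported_def)
  have q: "linear_extension (\<phi> j) a \<in> forms (z - 1)" for j
  proof (rule supported_linear_extension)
    fix M assume M: "M \<in> Poly_Mapping.keys a"
    show "\<phi> j M \<in> forms (z - 1)"
    proof (cases "Min_mset M = j")
      case True
      then have "j \<in># M" using min keys(3)[OF M] by blast
      then have "int (size (M - {#j#})) = z - 1" using size_Suc_Diff1[of j M] keys(1)[OF M] by linarith
      moreover have "set_mset (M - {#j#}) \<subseteq> {..<d}" using keys(2)[OF M] by (meson in_diffD subset_eq)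
      ultimately show ?thesis unfolding \<phi>_def by (auto intro: supported_single supported_zero)
    qed (simp add: \<phi>_def supported_zero)
  qed
  have "(\<Sum>j<d. mon {#j#} * linear_extension (\<phi> j) a) = linear_extension (\<lambda>M. \<Sum>j<d. mon {#j#} * \<phi> j M) a"
    unfolding linear_extension_mult_left linear_extension_sum_fun ..
  also have "\<dots> = linear_extension (\<lambda>M. mon M) a"
  proof (rule linear_extension_cong)
    fix M assume M: "M \<in> Poly_Mapping.keys a"
    let ?m = "Min_mset M"
    have m: "?m \<in># M" using keys(3)[OF M] by (rule min)
    then have "?m < d" using keys(2)[OF M] by auto
    have "(\<Sum>j<d. mon {#j#} * \<phi> j M) = (\<Sum>j<d. if j = ?m then mon M else 0)"
      by (intro sum.cong refl) (use m keys(3)[OF M] in \<open>auto simp: \<phi>_def mult_single\<close>)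
    then show "(\<Sum>j<d. mon {#j#} * \<phi> j M) = mon M" using \<open>?m < d\<close> by simp
  qed
  finally have "a = (\<Sum>j<d. mon {#j#} * linear_extension (\<phi> j) a)"
    by (simp add: linear_extension_id)
  then show ?thesis
    by (intro exI[of _ "\<lambda>j. linear_extension (\<phi> j) a"] conjI ballI q)
qed

end

section \<open>Lie algebra automorphisms and the enveloping ideal\<close>

context lie_algebra
begin

lemma lie_aut_iff:
  "\<sigma> \<in> carrier lie_aut_group \<longleftrightarrow>
     (\<forall>x y. \<sigma> (x + y) = \<sigma> x + \<sigma> y) \<and> (\<forall>c x. \<sigma> (c *s x) = c *s \<sigma> x) \<and> bij \<sigma> \<and>
     (\<forall>x y. \<sigma> (bracket x y) = bracket (\<sigma> x) (\<sigma> y))"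
  unfolding lie_aut_group_def Vector_Spaces.linear_iff using vector_space_axioms by auto

lemma lie_aut_group_simps:
  "\<sigma> \<otimes>\<^bsub>lie_aut_group\<^esub> \<tau> = \<sigma> \<circ> \<tau>" "\<one>\<^bsub>lie_aut_group\<^esub> = id"
  by (simp_all add: lie_aut_group_def)

lemma lie_aut_add: "\<sigma> \<in> carrier lie_aut_group \<Longrightarrow> \<sigma> (x + y) = \<sigma> x + \<sigma> y"
  and lie_aut_scale: "\<sigma> \<in> carrier lie_aut_group \<Longrightarrow> \<sigma> (c *s x) = c *s \<sigma> x"
  and lie_aut_bij: "\<sigma> \<in> carrier lie_aut_group \<Longrightarrow> bij \<sigma>"
  and lie_aut_bracket: "\<sigma> \<in> carrier lie_aut_group \<Longrightarrow> \<sigma> (bracket x y) = bracket (\<sigma> x) (\<sigma> y)"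
  by (simp_all add: lie_aut_iff)

lemma lie_aut_zero: assumes "\<sigma> \<in> carrier lie_aut_group" shows "\<sigma> 0 = 0"
  using lie_aut_scale[OF assms, of 0 0] by simp

lemma lie_aut_diff: assumes "\<sigma> \<in> carrier lie_aut_group" shows "\<sigma> (x - y) = \<sigma> x - \<sigma> y"
  using lie_aut_add[OF assms, of "x - y" y] by simp

lemma lie_aut_sum: "\<sigma> \<in> carrier lie_aut_group \<Longrightarrow> \<sigma> (sum f A) = (\<Sum>i\<in>A. \<sigma> (f i))"
  by (induction A rule: infinite_finite_induct) (auto simp: lie_aut_zero lie_aut_add)

lemma lie_aut_group_group: "group lie_aut_group"
proof (rule groupI)
  fix \<sigma> assume s: "\<sigma> \<in> carrier lie_aut_group"
  then have b: "bij \<sigma>" by (rule lie_aut_bij)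
  have inv: "\<sigma> (inv_into UNIV \<sigma> x) = x" "inv_into UNIV \<sigma> (\<sigma> x) = x" for x
    using b by (simp_all add: bij_is_surj surj_f_inv_f bij_is_inj)
  have "inv_into UNIV \<sigma> \<in> carrier lie_aut_group"
    unfolding lie_aut_iff
  proof (intro conjI allI)
    fix x y c
    show "inv_into UNIV \<sigma> (x + y) = inv_into UNIV \<sigma> x + inv_into UNIV \<sigma> y"
      using inv lie_aut_add[OF s] by metis
    show "inv_into UNIV \<sigma> (c *s x) = c *s inv_into UNIV \<sigma> x"
      using inv lie_aut_scale[OF s] by metis
    show "inv_into UNIV \<sigma> (bracket x y) = bracket (inv_into UNIV \<sigma> x) (inv_into UNIV \<sigma> y)"
      using inv lie_aut_bracket[OF s] by metis
    show "bij (inv_into UNIV \<sigma>)" by (rule bij_imp_bij_inv[OF b])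
  qed
  moreover have "inv_into UNIV \<sigma> \<circ> \<sigma> = id" using inv by auto
  ultimately show "\<exists>\<tau>\<in>carrier lie_aut_group. \<tau> \<otimes>\<^bsub>lie_aut_group\<^esub> \<sigma> = \<one>\<^bsub>lie_aut_group\<^esub>"
    by (auto simp: lie_aut_group_simps)
qed (auto simp: lie_aut_group_simps lie_aut_iff bij_comp)

lemma free_map_ideal:
  assumes s: "\<sigma> \<in> carrier lie_aut_group" and t: "t \<in> enveloping_ideal"
  shows "free_map \<sigma> t \<in> enveloping_ideal"
proof -
  let ?K = "{t. free_map \<sigma> t \<in> enveloping_ideal}"
  have zero: "free_map \<sigma> 0 = 0" by (simp add: free_map_def)
  have "ideal ?K free_algebra"
    unfolding free_algebra_ideal_iff
    by (auto simp: zero free_map_add free_map_mult enveloping_ideal_zero enveloping_ideal_add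
        enveloping_ideal_left enveloping_ideal_right)
  moreover have "enveloping_relations \<subseteq> ?K"
    by (auto simp: enveloping_relations_def free_map_diff free_map_mult free_map_gen free_map_scalar
        lie_aut_add[OF s] lie_aut_scale[OF s] lie_aut_bracket[OF s] gen_add_rel gen_scale_rel gen_bracket_rel)
  ultimately show ?thesis using enveloping_ideal_least t by blast
qed

end

section \<open>Finite groups of automorphisms\<close>

text \<open>An automorphism \<open>\<sigma>\<close> of finite order for which \<open>id - \<sigma>\<close> has range \<open>k x\<close> is diagonalizable, and
  then its fixed points form a subalgebra complementary to the ideal \<open>k x\<close>.\<close>

lemma no_reflection_automorphisms:
  fixes scale :: "'k::field_char_0 \<Rightarrow> 'g::ab_group_add \<Rightarrow> 'g" (infixr \<open>*s\<close> 75)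
  assumes lie: "lie_algebra scale bracket"
    and not_semidirect: "\<not> (\<exists>H x. x \<noteq> 0 \<and> lie_algebra.semidirect_product scale bracket H (range (\<lambda>c. c *s x)))"
    and s: "\<sigma> \<in> carrier (lie_algebra.lie_aut_group scale bracket)"
    and fin: "finite (range (\<lambda>n. \<sigma> ^^ n))" and ne: "\<sigma> \<noteq> id"
  shows "\<exists>v w. v - \<sigma> v \<noteq> 0 \<and> (\<forall>c. w - \<sigma> w \<noteq> c *s (v - \<sigma> v))"
proof (rule ccontr)
  interpret lie_algebra scale bracket by fact
  note add = lie_aut_add[OF s] and scale = lie_aut_scale[OF s] and diff = lie_aut_diff[OF s]
  assume neg: "\<not> ?thesis"
  obtain v where v: "v - \<sigma> v \<noteq> 0" using ne by (metis eq_id_iff eq_iff_diff_eq_0)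
  define x where "x = v - \<sigma> v"
  have x0: "x \<noteq> 0" using v by (simp add: x_def)
  have "\<forall>w. \<exists>c. w - \<sigma> w = c *s x" using neg v unfolding x_def by blast
  \<comment> \<open>If the claim fails, \<open>id - \<sigma>\<close> has rank one, and
    \<open>l\<close> is the linear functional with \<open>w - \<sigma> w = l w *s x\<close>. Its
    kernel is the space of fixed points.\<close>
  from choice[OF this] obtain l where l: "\<And>w. w - \<sigma> w = l w *s x" by blast
  have cancel: "a = b" if "a *s x = b *s x" for a b using that x0 by simp
  have l_add: "l (u + w) = l u + l w" for u w
    by (rule cancel) (simp add: l[symmetric] add scale_left_distrib algebra_simps)
  have l_scale: "l (c *s w) = c * l w" for c w
    by (rule cancel) (simp add: l[symmetric] scale scale_scale[symmetric] scale_right_diff_distrib del: scale_scale)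
  have \<sigma>_eq: "\<sigma> w = w - l w *s x" for w using l[of w] by (simp add: algebra_simps)
  \<comment> \<open>Otherwise \<open>\<sigma>\<close> is a transvection: its powers move
    \<open>v\<close> by multiples \<open>of_nat n *s x\<close>, which are pairwise distinct in
    characteristic 0, against the finiteness of the set of powers.\<close>
  have lx: "l x \<noteq> 0"
  proof
    assume "l x = 0"
    then have fx: "\<sigma> x = x" using \<sigma>_eq[of x] by simp
    have pow: "(\<sigma> ^^ n) v = v - of_nat n *s x" for n
    proof (induction n)
      case (Suc n)
      have "(\<sigma> ^^ Suc n) v = \<sigma> (v - of_nat n *s x)" using Suc by simp
      also have "\<dots> = \<sigma> v - of_nat n *s x" by (simp add: diff scale fx)
      also have "\<sigma> v = v - x" by (simp add: x_def)
      finally show ?case by (simp add: scale_left_distrib)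
    qed simp
    have "inj (\<lambda>n. \<sigma> ^^ n)"
    proof (rule injI)
      fix m n assume "\<sigma> ^^ m = \<sigma> ^^ n"
      then have "v - of_nat m *s x = v - of_nat n *s x" by (simp only: pow[symmetric])
      then show "m = n" using x0 by auto
    qed
    then show False using fin finite_imageD by blast
  qed
  define H where "H = {w. l w = 0}"
  have H_fix: "w \<in> H \<longleftrightarrow> \<sigma> w = w" for w
    using l[of w] x0 by (auto simp: H_def)
  have "l 0 = 0" using l_scale[of 0 0] by simp
  then have subH: "subspace H" unfolding H_def by (intro subspaceI) (auto simp: l_add l_scale)
  have "lie_subalgebra H"
    unfolding lie_subalgebra_def using subH by (auto simp: H_fix lie_aut_bracket[OF s])
  moreover have "lie_ideal (range (\<lambda>c. c *s x))"
    unfolding lie_ideal_def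
  proof (intro conjI allI ballI)
    show "subspace (range (\<lambda>c. c *s x))"
    proof (rule subspaceI)
      show "0 \<in> range (\<lambda>c. c *s x)" by (rule range_eqI[of _ _ 0]) simp
    next
      fix u w assume "u \<in> range (\<lambda>c. c *s x)" "w \<in> range (\<lambda>c. c *s x)"
      then obtain a b where "u = a *s x" "w = b *s x" by auto
      then show "u + w \<in> range (\<lambda>c. c *s x)" by (intro range_eqI[of _ _ "a + b"]) (simp add: scale_left_distrib)
    next
      fix c u assume "u \<in> range (\<lambda>c. c *s x)"
      then obtain a where "u = a *s x" by auto
      then show "c *s u \<in> range (\<lambda>c. c *s x)" by (intro range_eqI[of _ _ "c * a"]) simp
    qed
  next
    fix y u assume "u \<in> range (\<lambda>c. c *s x)"
    then obtain c where u: "u = c *s x" by auto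
    \<comment> \<open>The component of \<open>y\<close> in the fixed space, taken along
      \<open>x\<close>. As \<open>bracket x x = 0\<close>, only \<open>h\<close> matters, and
      \<open>\<sigma>\<close> multiplies \<open>bracket h x\<close> by \<open>1 - l x\<close>. So
      \<open>l x *s bracket h x\<close> lies in the image of \<open>id - \<sigma>\<close>, which is
      the line of \<open>x\<close>.\<close>
    define h where "h = y - (l y / l x) *s x"
    have "l (h + (l y / l x) *s x) = l y" by (simp add: h_def)
    then have "l h = 0" using lx by (simp add: l_add l_scale)
    then have fh: "\<sigma> h = h" using \<sigma>_eq[of h] by simp
    have yx: "bracket y x = bracket h x"
    proof -
      have "bracket y x = bracket (h + (l y / l x) *s x) x" by (simp add: h_def)
      then show ?thesis by (simp only: bracket_add_left bracket_scale_left bracket_self scale_zero_right add_0_right)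
    qed
    have "\<sigma> (bracket h x) = bracket h (\<sigma> x)" using lie_aut_bracket[OF s] fh by simp
    also have "\<sigma> x = (1 - l x) *s x" using \<sigma>_eq[of x] by (simp add: scale_left_diff_distrib)
    also have "bracket h ((1 - l x) *s x) = (1 - l x) *s bracket h x" by (rule bracket_scale_right)
    finally have "bracket h x - \<sigma> (bracket h x) = l x *s bracket h x"
      by (simp add: scale_left_diff_distrib)
    then have "l x *s bracket h x = l (bracket h x) *s x" using l by simp
    then have "(1 / l x) *s (l x *s bracket h x) = (1 / l x) *s (l (bracket h x) *s x)" by simp
    then have "bracket h x = (l (bracket h x) / l x) *s x" using lx by simp
    then have "bracket y u = (c * (l (bracket h x) / l x)) *s x"
      by (metis u bracket_scale_right yx scale_scale)
    then show "bracket y u \<in> range (\<lambda>c. c *s x)" by blast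
  qed
  moreover have "H \<inter> range (\<lambda>c. c *s x) = {0}"
    using lx \<open>l 0 = 0\<close> by (auto simp: H_def l_scale intro: range_eqI[of _ _ 0])
  moreover have "\<exists>h\<in>H. \<exists>i\<in>range (\<lambda>c. c *s x). z = h + i" for z
  proof (intro bexI)
    show "z = (z - (l z / l x) *s x) + (l z / l x) *s x" by simp
    have "l ((z - (l z / l x) *s x) + (l z / l x) *s x) = l z" by simp
    then show "z - (l z / l x) *s x \<in> H" using lx by (simp only: l_add l_scale) (simp add: H_def)
  qed auto
  ultimately have "semidirect_product H (range (\<lambda>c. c *s x))"
    unfolding semidirect_product_def by blast
  with not_semidirect x0 show False by blast
qed

section \<open>The group action on forms and symbols\<close>

locale lie_group_action = lie_algebra_basis scale bracket e d crd
  for scale :: "'k::field_char_0 \<Rightarrow> 'g::ab_group_add \<Rightarrow> 'g" (infixr \<open>*s\<close> 75)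
    and bracket :: "'g \<Rightarrow> 'g \<Rightarrow> 'g"
    and e :: "nat \<Rightarrow> 'g" and d :: nat and crd :: "'g \<Rightarrow> nat \<Rightarrow> 'k" +
  fixes G :: "('g \<Rightarrow> 'g) set"
  assumes not_semidirect: "\<not> (\<exists>H x. x \<noteq> 0 \<and> semidirect_product H (range (\<lambda>c. c *s x)))"
    and subgroup: "subgroup G lie_aut_group"
    and fin: "finite G"
begin

abbreviation \<Gamma> :: "('g \<Rightarrow> 'g) monoid" where
  "\<Gamma> \<equiv> lie_aut_group\<lparr>carrier := G\<rparr>"

text \<open>The automorphism of the symmetric algebra induced by \<open>\<sigma>\<close>, in
  coordinates. Variables with index at least \<open>d\<close> also go to linear forms in the first
  \<open>d\<close> variables, so every homogeneous polynomial is sent into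
  \<open>forms\<close>.\<close>

definition sym_action :: "('g \<Rightarrow> 'g) \<Rightarrow> (nat multiset \<Rightarrow>\<^sub>0 'k) \<Rightarrow> (nat multiset \<Rightarrow>\<^sub>0 'k)" where
  "sym_action \<sigma> = substitute (\<lambda>i. lin (\<sigma> (e i)))"

lemma G_aut: "\<sigma> \<in> G \<Longrightarrow> \<sigma> \<in> carrier lie_aut_group"
  using subgroup.subset[OF subgroup] by blast

lemma sym_action_lin: assumes s: "\<sigma> \<in> G" shows "sym_action \<sigma> (lin v) = lin (\<sigma> v)"
proof -
  have "lin (\<sigma> v) = lin (\<sigma> (\<Sum>k<d. crd v k *s e k))" by (simp add: crd_expand)
  then show ?thesis
    unfolding sym_action_def substitute_lin
    by (simp add: lie_aut_sum[OF G_aut[OF s]] lie_aut_scale[OF G_aut[OF s]] lin_sum lin_scale)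
qed

lemma sym_action_closed:
  assumes "p \<in> forms z" shows "sym_action \<sigma> p \<in> forms z"
  unfolding sym_action_def
  by (rule substitute_supported[OF lin_in_forms]) (rule supported_mono[OF assms], auto)

lemma sym_free_map: assumes s: "\<sigma> \<in> G" shows "sym (free_map \<sigma> t) = sym_action \<sigma> (sym t)"
proof -
  have w: "sym (Poly_Mapping.single (map_fword \<sigma> w) 1) = sym_action \<sigma> (sym_word w)" for w
  proof (cases w)
    case (FWord l)
    have "(\<Prod>x\<leftarrow>map \<sigma> l. lin x) = sym_action \<sigma> (\<Prod>x\<leftarrow>l. lin x)"
      by (induction l) (auto simp: sym_action_def substitute_1 substitute_mult sym_action_lin[OF s, unfolded sym_action_def])
    then show ?thesis by (simp add: FWord sym_def)
  qed
  have "sym (free_map \<sigma> t) = linear_extension (\<lambda>w. sym (Poly_Mapping.single (map_fword \<sigma> w) 1)) t"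
    unfolding sym_def free_map_linear_extension linear_extension_comp ..
  also have "\<dots> = linear_extension (\<lambda>w. sym_action \<sigma> (sym_word w)) t" by (simp only: w)
  also have "\<dots> = sym_action \<sigma> (sym t)"
    unfolding sym_def sym_action_def substitute_def linear_extension_comp ..
  finally show ?thesis .
qed

lemma sym_action_weight_le:
  assumes "p \<in> weight_le size z" shows "sym_action \<sigma> p \<in> weight_le size z"
  unfolding sym_action_def substitute_def
proof (rule weight_le_linear_extension)
  fix M assume "M \<in> Poly_Mapping.keys p"
  then have M: "int (size M) \<le> z" using assms by (auto simp: weight_le_def)
  have "sym_action \<sigma> (mon M) \<in> forms (int (size M))"
    unfolding sym_action_def by (rule substitute_supported[OF lin_in_forms]) (simp add: supported_single)
  then have "(\<Prod>i\<in>#M. lin (\<sigma> (e i))) \<in> weight_le size (int (size M))"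
    by (intro forms_weight_le) (simp add: sym_action_def substitute_mon)
  then show "(\<Prod>i\<in>#M. lin (\<sigma> (e i))) \<in> weight_le size z" using M by (rule weight_le_mono)
qed

lemma free_map_free_le: "t \<in> free_le z \<Longrightarrow> free_map \<sigma> t \<in> free_le z"
proof -
  assume t: "t \<in> free_le z"
  have len: "word_length (map_fword \<sigma> w) = word_length w" for w by (cases w) simp
  show ?thesis
    unfolding free_map_linear_extension
    by (rule weight_le_linear_extension, rule weight_le_single) (use t in \<open>auto simp: weight_le_def len\<close>)
qed

lemma free_map_filt:
  assumes s: "\<sigma> \<in> G" and t: "t \<in> filt z"
  shows "free_map \<sigma> t \<in> filt z" and "symb z (free_map \<sigma> t) = sym_action \<sigma> (symb z t)"
proof -
  obtain t' where t': "t' \<in> free_le z" "t - t' \<in> enveloping_ideal" using t by (auto simp: filt_def)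
  have i: "free_map \<sigma> t - free_map \<sigma> t' \<in> enveloping_ideal"
    using free_map_ideal[OF G_aut[OF s] t'(2)] by (simp add: free_map_diff)
  then show "free_map \<sigma> t \<in> filt z" using free_map_free_le[OF t'(1)] by (auto simp: filt_def)
  have hom: "sym_action \<sigma> (homogeneous_part z (sym t')) \<in> supported {M. int (size M) = z}"
    unfolding sym_action_def
    by (rule supported_mono[OF substitute_supported[OF lin_in_forms homogeneous_part_homogeneous]]) auto
  have "sym_action \<sigma> (sym t' - homogeneous_part z (sym t')) \<in> weight_le size (z - 1)"
    by (intro sym_action_weight_le homogeneous_part_leading sym_weight_le t')
  then have "homogeneous_part z (sym_action \<sigma> (sym t')) = homogeneous_part z (sym_action \<sigma> (homogeneous_part z (sym t')))"
    by (intro homogeneous_part_cong) (simp add: sym_action_def substitute_diff)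
  also have "\<dots> = sym_action \<sigma> (homogeneous_part z (sym t'))" by (rule homogeneous_part_eq[OF hom])
  finally show "symb z (free_map \<sigma> t) = sym_action \<sigma> (symb z t)"
    using symb_cong[OF i, of z] symb_cong[OF t'(2), of z] symb_free_le[OF t'(1)] symb_free_le[OF free_map_free_le[OF t'(1)]]
    by (simp add: sym_free_map[OF s])
qed

lemma \<Gamma>_group: "group \<Gamma>"
  by (rule subgroup.subgroup_is_group[OF subgroup lie_aut_group_group])

text \<open>With \<open>\<sigma>\<close> the product of the inverse of \<open>g\<close> with
  \<open>h\<close>, one has \<open>h u - g u = - g (u - \<sigma> u)\<close>. The injective linear
  map \<open>g\<close> carries the independence found for \<open>\<sigma>\<close> over to
  \<open>g\<close> and \<open>h\<close>; the powers of \<open>\<sigma>\<close> stay in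
  \<open>G\<close>, hence are finite in number.\<close>

lemma G_no_reflections:
  assumes g: "g \<in> G" and h: "h \<in> G" and gh: "g \<noteq> h"
  shows "\<exists>v w. h v - g v \<noteq> 0 \<and> (\<forall>c. h w - g w \<noteq> c *s (h v - g v))"
proof -
  interpret \<Gamma>: group \<Gamma> by (rule \<Gamma>_group)
  define \<sigma> where "\<sigma> = inv\<^bsub>\<Gamma>\<^esub> g \<otimes>\<^bsub>\<Gamma>\<^esub> h"
  have \<sigma>G: "\<sigma> \<in> G" unfolding \<sigma>_def using \<Gamma>.m_closed[of "inv\<^bsub>\<Gamma>\<^esub> g" h] \<Gamma>.inv_closed[of g] g h by simp
  have "g \<otimes>\<^bsub>\<Gamma>\<^esub> \<sigma> = (g \<otimes>\<^bsub>\<Gamma>\<^esub> inv\<^bsub>\<Gamma>\<^esub> g) \<otimes>\<^bsub>\<Gamma>\<^esub> h"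
    unfolding \<sigma>_def by (rule \<Gamma>.m_assoc[symmetric]) (use g h \<Gamma>.inv_closed[of g] in auto)
  also have "g \<otimes>\<^bsub>\<Gamma>\<^esub> inv\<^bsub>\<Gamma>\<^esub> g = \<one>\<^bsub>\<Gamma>\<^esub>" by (rule \<Gamma>.r_inv) (use g in simp)
  also have "\<one>\<^bsub>\<Gamma>\<^esub> \<otimes>\<^bsub>\<Gamma>\<^esub> h = h" by (rule \<Gamma>.l_one) (use h in simp)
  finally have "g \<otimes>\<^bsub>\<Gamma>\<^esub> \<sigma> = h" .
  then have gs: "g (\<sigma> v) = h v" for v by (auto simp: lie_aut_group_simps)
  have ne: "\<sigma> \<noteq> id" using gs gh by auto
  have "\<sigma> ^^ n \<in> G" for n
  proof (induction n)
    case 0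
    show ?case using \<Gamma>.one_closed by (simp add: lie_aut_group_simps id_def)
  next
    case (Suc n)
    have "\<sigma> \<circ> \<sigma> ^^ n \<in> G"
      using Suc \<Gamma>.m_closed[of \<sigma> "\<sigma> ^^ n"] \<sigma>G by (simp add: lie_aut_group_simps)
    then show ?case by (simp only: funpow.simps)
  qed
  then have "finite (range (\<lambda>n. \<sigma> ^^ n))" using fin by (meson finite_subset image_subsetI)
  from no_reflection_automorphisms[OF lie_algebra_axioms not_semidirect G_aut[OF \<sigma>G] this ne]
  obtain v w where vw: "v - \<sigma> v \<noteq> 0" "\<And>c. w - \<sigma> w \<noteq> c *s (v - \<sigma> v)" by blast
  have inj: "inj g" using lie_aut_bij[OF G_aut[OF g]] by (rule bij_is_inj)
  have eq: "h u - g u = - 1 *s g (u - \<sigma> u)" for u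
    by (simp add: lie_aut_diff[OF G_aut[OF g]] gs)
  have "g (v - \<sigma> v) \<noteq> 0" using vw(1) inj lie_aut_zero[OF G_aut[OF g]] by (metis injD)
  moreover have "g (w - \<sigma> w) \<noteq> c *s g (v - \<sigma> v)" for c
    using vw(2)[of c] inj unfolding lie_aut_scale[OF G_aut[OF g], symmetric] by (metis injD)
  ultimately show ?thesis unfolding eq by (intro exI[of _ v] exI[of _ w]) (simp add: scale_minus_right)
qed

lemma forms_neg: "z < 0 \<Longrightarrow> forms z = {0}"
proof -
  assume "z < 0"
  then have e: "{M. int (size M) = z \<and> set_mset M \<subseteq> {..<d}} = {}" by auto
  show ?thesis unfolding e supported_def by auto
qed

lemma graded: "graded_action \<Gamma> forms sym_action {..<d} (\<lambda>j. mon {#j#})"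
proof (intro graded_action.intro graded_action_axioms.intro \<Gamma>_group)
  show "finite (carrier \<Gamma>)" using fin by simp
  show "a + b \<in> forms z" if "a \<in> forms z" "b \<in> forms z" for a b z using that by (rule supported_add)
  show "- a \<in> forms z" if "a \<in> forms z" for a z using that by (rule supported_uminus)
  show "0 \<in> forms z" for z by (rule supported_zero)
  show "1 \<in> forms 0" by (simp add: supported_def)
  show "a * b \<in> forms (m + n)" if "a \<in> forms m" "b \<in> forms n" for a b m n
    by (rule supported_mult[OF that]) auto
  show "forms z = {0}" if "z < 0" for z using that by (rule forms_neg)
  show "sym_action h a \<in> forms z" if "a \<in> forms z" for h a z using that by (rule sym_action_closed)
  show "sym_action h (a + b) = sym_action h a + sym_action h b" for h a b by (simp add: sym_action_def substitute_add)
  show "sym_action h (a * b) = sym_action h a * sym_action h b" for h a b by (simp add: sym_action_def substitute_mult)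
  show "sym_action h 1 = 1" for h by (simp add: sym_action_def substitute_1)
  show "sym_action \<one>\<^bsub>\<Gamma>\<^esub> a = a" if "a \<in> forms z" for a z
    unfolding sym_action_def
    by (rule substitute_id[of _ "{..<d}"], rule supported_mono[OF that]) (auto simp: lie_aut_group_simps lin_basis)
  show "sym_action (g \<otimes>\<^bsub>\<Gamma>\<^esub> h) a = sym_action g (sym_action h a)" if "g \<in> carrier \<Gamma>" for g h a
  proof -
    have "sym_action g (sym_action h a) = substitute (\<lambda>i. sym_action g (lin (h (e i)))) a"
      unfolding sym_action_def substitute_comp ..
    then show ?thesis using that by (simp add: sym_action_lin) (simp add: sym_action_def lie_aut_group_simps)
  qed
  show "sym_action h a = a" if "a \<in> forms 0" for h a
    unfolding sym_action_def by (rule substitute_id[of _ "{}"], rule supported_mono[OF that]) auto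
  show "\<exists>b\<in>forms z. of_nat (card (carrier \<Gamma>)) * b = a" if a: "a \<in> forms z" for a z
  proof (rule bexI)
    have "card G \<noteq> 0" using fin subgroup.one_closed[OF subgroup] by auto
    then have c: "of_nat (card G) * (1 / of_nat (card G)) = (1 :: 'k)" by simp
    have "const_poly (of_nat (card G)) * const_poly (1 / of_nat (card G)) = (1 :: nat multiset \<Rightarrow>\<^sub>0 'k)"
      unfolding mult_single c by simp
    then have "of_nat (card G) * const_poly (1 / of_nat (card G)) = (1 :: nat multiset \<Rightarrow>\<^sub>0 'k)"
      unfolding single_of_nat .
    then show "of_nat (card (carrier \<Gamma>)) * (const_poly (1 / of_nat (card G)) * a) = a"
      by (simp add: mult.assoc[symmetric])
    show "const_poly (1 / of_nat (card G)) * a \<in> forms z" by (rule supported_scale[OF a])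
  qed
  show "finite {..<d}" by simp
  show "mon {#j#} \<in> forms 1" if "j \<in> {..<d}" for j using that by (simp add: supported_def)
  show "\<exists>q. (\<forall>j\<in>{..<d}. q j \<in> forms (z - 1)) \<and> a = (\<Sum>j<d. mon {#j#} * q j)" if "a \<in> forms z" "z > 0" for a z
    using that by (rule forms_generated)
  show "\<exists>y\<in>forms 1. \<exists>y'\<in>forms 1. sym_action h y - sym_action g y \<noteq> 0 \<and>
        (\<forall>z. \<forall>a\<in>forms z. \<forall>b\<in>forms z. (sym_action h y - sym_action g y) * b = (sym_action h y' - sym_action g y') * a \<longrightarrow>
          (\<exists>c\<in>forms (z - 1). a = (sym_action h y - sym_action g y) * c))"
    if "g \<in> carrier \<Gamma>" "h \<in> carrier \<Gamma>" "g \<noteq> h" for g h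
  proof -
    have gh: "g \<in> G" "h \<in> G" "g \<noteq> h" using that by auto
    obtain v w where vw: "h v - g v \<noteq> 0" "\<And>c. h w - g w \<noteq> c *s (h v - g v)"
      using G_no_reflections[OF gh] by blast
    have eq: "sym_action h (lin u) - sym_action g (lin u) = lin (h u - g u)" for u
      by (simp add: sym_action_lin gh lin_diff)
    show ?thesis
    proof (rule bexI[of _ "lin v"], rule bexI[of _ "lin w"], intro conjI allI ballI impI)
      show "lin v \<in> forms 1" "lin w \<in> forms 1" by (rule lin_in_forms)+
      show "sym_action h (lin v) - sym_action g (lin v) \<noteq> 0" using vw(1) by (simp add: eq lin_eq_0_iff)
      fix z a b assume a: "a \<in> forms z"
        and ab: "(sym_action h (lin v) - sym_action g (lin v)) * b = (sym_action h (lin w) - sym_action g (lin w)) * a"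
      show "\<exists>c\<in>forms (z - 1). a = (sym_action h (lin v) - sym_action g (lin v)) * c"
        using coprime_linear_forms[OF vw a, of b] ab unfolding eq by blast
    qed
  qed
qed

lemma filtered: "filtered_symbol \<Gamma> forms sym_action {..<d} (\<lambda>j. mon {#j#}) filt symb free_map"
proof (intro filtered_symbol.intro filtered_symbol_axioms.intro graded)
  show "filt z \<subseteq> filt (z + 1)" for z using filt_mono by auto
  show "filt z = filt (-1)" if "z < 0" for z using filt_neg[OF that] filt_neg[of "-1"] by simp
  show "free_map (g \<otimes>\<^bsub>\<Gamma>\<^esub> h) a = free_map g (free_map h a)" for g h a
    by (simp add: lie_aut_group_simps free_map_comp)
qed (auto simp: symb_kernel intro: filt_zero filt_add filt_uminus filt_mult filt_exhaust symb_in_forms symb_add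
    symb_onto free_map_add free_map_mult free_map_filt)

end

section \<open>Cosets of the enveloping ideal\<close>

context lie_algebra
begin

text \<open>Presents an element of the quotient record by a representative, so that equations in
  \<open>enveloping_algebra\<close> turn into membership in the ideal.\<close>

definition coset :: "('g fword \<Rightarrow>\<^sub>0 'k) \<Rightarrow> ('g fword \<Rightarrow>\<^sub>0 'k) set" where
  "coset p = {q. q - p \<in> enveloping_ideal}"

lemma coset_eq_iff: "coset p = coset q \<longleftrightarrow> p - q \<in> enveloping_ideal"
proof
  assume "coset p = coset q"
  moreover have "p \<in> coset p" by (simp add: coset_def enveloping_ideal_zero)
  ultimately show "p - q \<in> enveloping_ideal" by (simp add: coset_def)
next
  assume pq: "p - q \<in> enveloping_ideal"
  have "r - p \<in> enveloping_ideal \<longleftrightarrow> r - q \<in> enveloping_ideal" for r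
    using enveloping_ideal_add[OF _ pq, of "r - p"] enveloping_ideal_diff[OF _ pq, of "r - q"] by auto
  then show "coset p = coset q" by (simp add: coset_def)
qed

lemma a_r_coset_coset: "enveloping_ideal +>\<^bsub>free_algebra\<^esub> p = coset p"
proof -
  have "q \<in> enveloping_ideal +>\<^bsub>free_algebra\<^esub> p \<longleftrightarrow> (\<exists>h\<in>enveloping_ideal. q = h + p)" for q
    unfolding a_r_coset_def' by (auto simp: free_algebra_simps)
  also have "(\<exists>h\<in>enveloping_ideal. q = h + p) \<longleftrightarrow> q - p \<in> enveloping_ideal" for q
    by (auto intro: bexI[of _ "q - p"])
  finally show ?thesis by (auto simp: coset_def)
qed

lemma carrier_enveloping_algebra: "carrier enveloping_algebra = range coset"
  unfolding enveloping_algebra_def FactRing_def A_RCOSETS_def'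
  by (auto simp: a_r_coset_coset free_algebra_simps)

lemma coset_hom: "coset \<in> ring_hom free_algebra enveloping_algebra"
  using ideal.rcos_ring_hom[OF enveloping_ideal_ideal]
  unfolding enveloping_algebra_def a_r_coset_coset .

lemma coset_mult: "coset p \<otimes>\<^bsub>enveloping_algebra\<^esub> coset q = coset (p * q)"
  and coset_add: "coset p \<oplus>\<^bsub>enveloping_algebra\<^esub> coset q = coset (p + q)"
  and coset_one: "\<one>\<^bsub>enveloping_algebra\<^esub> = coset 1"
  using ring_hom_mult[OF coset_hom, of p q] ring_hom_add[OF coset_hom, of p q] ring_hom_one[OF coset_hom]
  by (simp_all add: free_algebra_simps)

lemma coset_zero: "\<zero>\<^bsub>enveloping_algebra\<^esub> = coset 0"
  by (simp add: enveloping_algebra_def FactRing_def coset_def)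

lemma enveloping_algebra_ring: "ring enveloping_algebra"
  unfolding enveloping_algebra_def by (rule ideal.quotient_is_ring[OF enveloping_ideal_ideal])

lemma coset_finsum:
  assumes "finite A"
  shows "finsum enveloping_algebra (\<lambda>i. coset (f i)) A = coset (\<Sum>i\<in>A. f i)"
proof -
  interpret ring enveloping_algebra by (rule enveloping_algebra_ring)
  show ?thesis
    using assms
  proof (induction A rule: finite_induct)
    case (insert i A)
    have "(\<lambda>i. coset (f i)) \<in> A \<rightarrow> carrier enveloping_algebra" "coset (f i) \<in> carrier enveloping_algebra"
      by (auto simp: carrier_enveloping_algebra)
    then show ?case using insert by (simp add: finsum_insert coset_add)
  qed (simp add: coset_zero)
qed

end

section \<open>The natural map on cosets\<close>

context lie_group_action
begin

interpretation FS: filtered_symbol \<Gamma> forms sym_action "{..<d}" "\<lambda>j. mon {#j#}" filt symb free_map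
  by (rule filtered)

lemma filt_minus_1: "filt (-1) = enveloping_ideal"
  by (rule filt_neg) simp

text \<open>The action is the image of a set, which a priori only lies inside a coset. That it fills
  the coset needs the inverse automorphism, which preserves the ideal as well.\<close>

lemma enveloping_action_coset:
  assumes s: "\<sigma> \<in> G"
  shows "enveloping_action \<sigma> (coset p) = coset (free_map \<sigma> p)"
proof
  show "enveloping_action \<sigma> (coset p) \<subseteq> coset (free_map \<sigma> p)"
    using free_map_ideal[OF G_aut[OF s]] by (auto simp: enveloping_action_def coset_def free_map_diff[symmetric])
  show "coset (free_map \<sigma> p) \<subseteq> enveloping_action \<sigma> (coset p)"
  proof
    fix q assume q: "q \<in> coset (free_map \<sigma> p)"
    let ?\<tau> = "inv\<^bsub>\<Gamma>\<^esub> \<sigma>"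
    have t: "?\<tau> \<in> G" using FS.inv_closed[of \<sigma>] s by simp
    have c: "\<sigma> \<circ> ?\<tau> = id" "?\<tau> \<circ> \<sigma> = id"
      using FS.r_inv[of \<sigma>] FS.l_inv[of \<sigma>] s by (simp_all add: lie_aut_group_simps)
    have "free_map ?\<tau> (q - free_map \<sigma> p) \<in> enveloping_ideal"
      using q by (intro free_map_ideal G_aut[OF t]) (simp add: coset_def)
    then have "free_map ?\<tau> q \<in> coset p"
      by (simp add: coset_def free_map_diff free_map_comp[symmetric] c free_map_id)
    moreover have "q = free_map \<sigma> (free_map ?\<tau> q)"
      by (simp add: free_map_comp[symmetric] c free_map_id)
    ultimately show "q \<in> enveloping_action \<sigma> (coset p)" unfolding enveloping_action_def by blast
  qed
qed

lemma fixed_subring_coset: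
  "coset t \<in> fixed_subring enveloping_algebra \<Gamma> enveloping_action \<longleftrightarrow> t \<in> FS.E_fixed"
  by (auto simp: fixed_subring_def FS.E_fixed_def carrier_enveloping_algebra enveloping_action_coset
      coset_eq_iff filt_minus_1)

lemma skew_natural_map_coset:
  assumes "\<And>h. h \<in> G \<Longrightarrow> a h = coset (\<alpha> h)"
  shows "skew_natural_map enveloping_algebra \<Gamma> enveloping_action a (coset p) = coset (FS.skew \<alpha> p)"
proof -
  interpret ring enveloping_algebra by (rule enveloping_algebra_ring)
  have "skew_natural_map enveloping_algebra \<Gamma> enveloping_action a (coset p)
    = finsum enveloping_algebra (\<lambda>h. a h \<otimes>\<^bsub>enveloping_algebra\<^esub> enveloping_action h (coset p)) G"
    by (simp add: skew_natural_map_def carrier_enveloping_algebra)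
  also have "\<dots> = finsum enveloping_algebra (\<lambda>h. coset (\<alpha> h * free_map h p)) G"
    by (rule finsum_cong')
       (auto simp: assms enveloping_action_coset coset_mult carrier_enveloping_algebra)
  also have "\<dots> = coset (FS.skew \<alpha> p)"
    using fin by (simp add: coset_finsum FS.skew_def)
  finally show ?thesis .
qed

lemma skew_group_ring_rep:
  assumes "a \<in> carrier (skew_group_ring enveloping_algebra \<Gamma> enveloping_action)"
  obtains \<alpha> where "\<And>h. h \<in> G \<Longrightarrow> a h = coset (\<alpha> h)"
proof -
  have "\<forall>h\<in>G. \<exists>t. a h = coset t"
    using assms by (auto simp: skew_group_ring_def carrier_enveloping_algebra PiE_def Pi_def)
  from bchoice[OF this] show ?thesis using that by blast
qed

lemma skew_group_ring_mult_rep: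
  assumes a: "\<And>h. h \<in> G \<Longrightarrow> a h = coset (\<alpha> h)" and b: "\<And>h. h \<in> G \<Longrightarrow> b h = coset (\<beta> h)"
    and k: "k \<in> G"
  shows "(a \<otimes>\<^bsub>skew_group_ring enveloping_algebra \<Gamma> enveloping_action\<^esub> b) k =
    coset (\<Sum>g\<in>G. \<alpha> g * free_map g (\<beta> (inv\<^bsub>\<Gamma>\<^esub> g \<otimes>\<^bsub>\<Gamma>\<^esub> k)))"
proof -
  interpret ring enveloping_algebra by (rule enveloping_algebra_ring)
  have closed: "inv\<^bsub>\<Gamma>\<^esub> g \<otimes>\<^bsub>\<Gamma>\<^esub> k \<in> G" if "g \<in> G" for g
    using FS.m_closed[of "inv\<^bsub>\<Gamma>\<^esub> g" k] FS.inv_closed[of g] that k by simp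
  have "(a \<otimes>\<^bsub>skew_group_ring enveloping_algebra \<Gamma> enveloping_action\<^esub> b) k =
    finsum enveloping_algebra (\<lambda>g. a g \<otimes>\<^bsub>enveloping_algebra\<^esub> enveloping_action g (b (inv\<^bsub>\<Gamma>\<^esub> g \<otimes>\<^bsub>\<Gamma>\<^esub> k))) G"
    using k by (simp add: skew_group_ring_def)
  also have "\<dots> = finsum enveloping_algebra (\<lambda>g. coset (\<alpha> g * free_map g (\<beta> (inv\<^bsub>\<Gamma>\<^esub> g \<otimes>\<^bsub>\<Gamma>\<^esub> k)))) G"
  proof (rule finsum_cong'[OF refl])
    fix g assume g: "g \<in> G"
    show "a g \<otimes>\<^bsub>enveloping_algebra\<^esub> enveloping_action g (b (inv\<^bsub>\<Gamma>\<^esub> g \<otimes>\<^bsub>\<Gamma>\<^esub> k))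
      = coset (\<alpha> g * free_map g (\<beta> (inv\<^bsub>\<Gamma>\<^esub> g \<otimes>\<^bsub>\<Gamma>\<^esub> k)))"
      unfolding a[OF g] b[OF closed[OF g]] enveloping_action_coset[OF g] coset_mult ..
  qed (auto simp: carrier_enveloping_algebra)
  finally show ?thesis using fin by (simp add: coset_finsum)
qed

lemma skew_convolution:
  "FS.skew (\<lambda>k. \<Sum>g\<in>G. \<alpha> g * free_map g (\<beta> (inv\<^bsub>\<Gamma>\<^esub> g \<otimes>\<^bsub>\<Gamma>\<^esub> k))) p = FS.skew \<alpha> (FS.skew \<beta> p)"
proof -
  have G: "carrier \<Gamma> = G" by simp
  have "FS.skew (\<lambda>k. \<Sum>g\<in>G. \<alpha> g * free_map g (\<beta> (inv\<^bsub>\<Gamma>\<^esub> g \<otimes>\<^bsub>\<Gamma>\<^esub> k))) p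
    = (\<Sum>g\<in>carrier \<Gamma>. \<Sum>k\<in>carrier \<Gamma>. \<alpha> g * free_map g (\<beta> (inv\<^bsub>\<Gamma>\<^esub> g \<otimes>\<^bsub>\<Gamma>\<^esub> k)) * free_map k p)"
    unfolding FS.skew_def sum_distrib_right G by (rule sum.swap)
  \<comment> \<open>The substitution \<open>k = g h\<close>, for fixed \<open>g\<close>, turns the
    convolution product into composition of maps.\<close>
  also have "\<dots> = (\<Sum>g\<in>carrier \<Gamma>. \<Sum>h\<in>carrier \<Gamma>.
      \<alpha> g * free_map g (\<beta> (inv\<^bsub>\<Gamma>\<^esub> g \<otimes>\<^bsub>\<Gamma>\<^esub> (g \<otimes>\<^bsub>\<Gamma>\<^esub> h))) * free_map (g \<otimes>\<^bsub>\<Gamma>\<^esub> h) p)"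
    by (rule sum.cong[OF refl], rule FS.sum_translate[symmetric])
  also have "\<dots> = (\<Sum>g\<in>carrier \<Gamma>. \<Sum>h\<in>carrier \<Gamma>. \<alpha> g * (free_map g (\<beta> h) * free_map g (free_map h p)))"
  proof (intro sum.cong refl)
    fix g h assume gh: "g \<in> carrier \<Gamma>" "h \<in> carrier \<Gamma>"
    have "inv\<^bsub>\<Gamma>\<^esub> g \<otimes>\<^bsub>\<Gamma>\<^esub> (g \<otimes>\<^bsub>\<Gamma>\<^esub> h) = h"
      using gh FS.m_assoc[OF FS.inv_closed[OF gh(1)] gh] FS.l_inv[OF gh(1)] FS.l_one[OF gh(2)] by metis
    moreover have "free_map (g \<otimes>\<^bsub>\<Gamma>\<^esub> h) p = free_map g (free_map h p)"
      by (rule FS.act_comp[OF gh])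
    ultimately show "\<alpha> g * free_map g (\<beta> (inv\<^bsub>\<Gamma>\<^esub> g \<otimes>\<^bsub>\<Gamma>\<^esub> (g \<otimes>\<^bsub>\<Gamma>\<^esub> h))) * free_map (g \<otimes>\<^bsub>\<Gamma>\<^esub> h) p
      = \<alpha> g * (free_map g (\<beta> h) * free_map g (free_map h p))" by (simp only: mult.assoc)
  qed
  also have "\<dots> = FS.skew \<alpha> (FS.skew \<beta> p)"
    unfolding FS.skew_def free_map_sum free_map_mult sum_distrib_left ..
  finally show ?thesis .
qed

text \<open>Multiplicativity is \<open>skew_convolution\<close>, injectivity is
  \<open>skew_independent\<close> applied to a difference of coefficients, and surjectivity is
  \<open>endo_is_skew\<close> applied to a lift of the endomorphism to representatives.\<close>

theorem skew_natural_map_iso: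
  "skew_natural_map enveloping_algebra \<Gamma> enveloping_action
    \<in> ring_iso (skew_group_ring enveloping_algebra \<Gamma> enveloping_action)
        (right_End enveloping_algebra (fixed_subring enveloping_algebra \<Gamma> enveloping_action))"
proof -
  let ?R = enveloping_algebra
  let ?A = "skew_group_ring ?R \<Gamma> enveloping_action"
  let ?S = "fixed_subring ?R \<Gamma> enveloping_action"
  let ?N = "skew_natural_map ?R \<Gamma> enveloping_action"
  have N_ext: "?N a \<in> extensional (range coset)" for a
    by (simp add: skew_natural_map_def carrier_enveloping_algebra)
  have S_sub: "s \<in> ?S \<Longrightarrow> \<exists>t. s = coset t \<and> t \<in> FS.E_fixed" for s
    using fixed_subring_coset by (auto simp: fixed_subring_def carrier_enveloping_algebra)
  have N_closed: "?N a \<in> carrier (right_End ?R ?S)" if a: "a \<in> carrier ?A" for a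
  proof -
    obtain \<alpha> where \<alpha>: "\<And>h. h \<in> G \<Longrightarrow> a h = coset (\<alpha> h)" using skew_group_ring_rep[OF a] by blast
    have N: "?N a (coset p) = coset (FS.skew \<alpha> p)" for p by (rule skew_natural_map_coset[OF \<alpha>])
    have "?N a (coset p \<otimes>\<^bsub>?R\<^esub> s) = ?N a (coset p) \<otimes>\<^bsub>?R\<^esub> s" if s: "s \<in> ?S" for p s
    proof -
      obtain t where t: "s = coset t" "t \<in> FS.E_fixed" using S_sub[OF s] by blast
      show ?thesis unfolding t(1) coset_mult N coset_eq_iff
        using FS.skew_mult[OF t(2), of \<alpha> p] by (simp only: filt_minus_1)
    qed
    then show ?thesis
      using N_ext[of a] by (auto simp: right_End_def carrier_enveloping_algebra PiE_def N coset_add FS.skew_add)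
  qed
  have ext: "f = g" if "f \<in> extensional (range coset)" "g \<in> extensional (range coset)" "\<And>p. f (coset p) = g (coset p)"
    for f g :: "('g fword \<Rightarrow>\<^sub>0 'k) set \<Rightarrow> ('g fword \<Rightarrow>\<^sub>0 'k) set"
    using that by (intro extensionalityI[of f "range coset" g]) auto
  have hom: "?N \<in> ring_hom ?A (right_End ?R ?S)"
  proof (rule ring_hom_memI)
    fix a b assume a: "a \<in> carrier ?A" and b: "b \<in> carrier ?A"
    obtain \<alpha> where \<alpha>: "\<And>h. h \<in> G \<Longrightarrow> a h = coset (\<alpha> h)" using skew_group_ring_rep[OF a] by blast
    obtain \<beta> where \<beta>: "\<And>h. h \<in> G \<Longrightarrow> b h = coset (\<beta> h)" using skew_group_ring_rep[OF b] by blast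
    show "?N (a \<otimes>\<^bsub>?A\<^esub> b) = ?N a \<otimes>\<^bsub>right_End ?R ?S\<^esub> ?N b"
    proof (rule ext[OF N_ext])
      show "?N a \<otimes>\<^bsub>right_End ?R ?S\<^esub> ?N b \<in> extensional (range coset)"
        by (simp add: right_End_def carrier_enveloping_algebra)
      fix p
      have "?N (a \<otimes>\<^bsub>?A\<^esub> b) (coset p) = coset (FS.skew \<alpha> (FS.skew \<beta> p))"
        unfolding skew_convolution[symmetric]
        by (rule skew_natural_map_coset) (rule skew_group_ring_mult_rep[OF \<alpha> \<beta>])
      then show "?N (a \<otimes>\<^bsub>?A\<^esub> b) (coset p) = (?N a \<otimes>\<^bsub>right_End ?R ?S\<^esub> ?N b) (coset p)"
        by (simp add: right_End_def carrier_enveloping_algebra compose_def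
            skew_natural_map_coset[OF \<alpha>] skew_natural_map_coset[OF \<beta>])
    qed
    show "?N (a \<oplus>\<^bsub>?A\<^esub> b) = ?N a \<oplus>\<^bsub>right_End ?R ?S\<^esub> ?N b"
    proof (rule ext[OF N_ext])
      show "?N a \<oplus>\<^bsub>right_End ?R ?S\<^esub> ?N b \<in> extensional (range coset)"
        by (simp add: right_End_def carrier_enveloping_algebra)
      fix p
      have "?N (a \<oplus>\<^bsub>?A\<^esub> b) (coset p) = coset (FS.skew (\<lambda>h. \<alpha> h + \<beta> h) p)"
        by (rule skew_natural_map_coset) (simp add: skew_group_ring_def \<alpha> \<beta> coset_add)
      also have "FS.skew (\<lambda>h. \<alpha> h + \<beta> h) p = FS.skew \<alpha> p + FS.skew \<beta> p"
        by (simp add: FS.skew_def distrib_right sum.distrib)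
      finally show "?N (a \<oplus>\<^bsub>?A\<^esub> b) (coset p) = (?N a \<oplus>\<^bsub>right_End ?R ?S\<^esub> ?N b) (coset p)"
        by (simp add: right_End_def carrier_enveloping_algebra coset_add
            skew_natural_map_coset[OF \<alpha>] skew_natural_map_coset[OF \<beta>])
    qed
  next
    show "?N \<one>\<^bsub>?A\<^esub> = \<one>\<^bsub>right_End ?R ?S\<^esub>"
    proof (rule ext[OF N_ext])
      show "\<one>\<^bsub>right_End ?R ?S\<^esub> \<in> extensional (range coset)"
        by (simp add: right_End_def carrier_enveloping_algebra)
      fix p
      let ?i = "\<lambda>h. if h = \<one>\<^bsub>\<Gamma>\<^esub> then 1 else 0"
      have "?N \<one>\<^bsub>?A\<^esub> (coset p) = coset (FS.skew ?i p)"
        by (rule skew_natural_map_coset) (simp add: skew_group_ring_def coset_one coset_zero)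
      also have "FS.skew ?i p = (\<Sum>h\<in>carrier \<Gamma>. if h = \<one>\<^bsub>\<Gamma>\<^esub> then free_map h p else 0)"
        unfolding FS.skew_def by (intro sum.cong) auto
      also have "\<dots> = free_map \<one>\<^bsub>\<Gamma>\<^esub> p"
        using FS.finite_G FS.one_closed by (simp only: sum.delta if_True)
      also have "\<dots> = p" by (simp add: lie_aut_group_simps free_map_id)
      finally show "?N \<one>\<^bsub>?A\<^esub> (coset p) = \<one>\<^bsub>right_End ?R ?S\<^esub> (coset p)"
        by (simp add: right_End_def carrier_enveloping_algebra)
    qed
  qed (rule N_closed)
  have inj: "inj_on ?N (carrier ?A)"
  proof (rule inj_onI)
    fix a b assume a: "a \<in> carrier ?A" and b: "b \<in> carrier ?A" and eq: "?N a = ?N b"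
    obtain \<alpha> where \<alpha>: "\<And>h. h \<in> G \<Longrightarrow> a h = coset (\<alpha> h)" using skew_group_ring_rep[OF a] by blast
    obtain \<beta> where \<beta>: "\<And>h. h \<in> G \<Longrightarrow> b h = coset (\<beta> h)" using skew_group_ring_rep[OF b] by blast
    have null: "FS.skew (\<lambda>h. \<alpha> h - \<beta> h) p \<in> filt (-1)" for p
    proof -
      have "coset (FS.skew \<alpha> p) = ?N a (coset p)" by (rule skew_natural_map_coset[OF \<alpha>, symmetric])
      also have "\<dots> = coset (FS.skew \<beta> p)" unfolding eq by (rule skew_natural_map_coset[OF \<beta>])
      finally have "FS.skew \<alpha> p - FS.skew \<beta> p \<in> enveloping_ideal" by (simp add: coset_eq_iff)
      moreover have "FS.skew (\<lambda>h. \<alpha> h - \<beta> h) p = FS.skew \<alpha> p - FS.skew \<beta> p"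
        by (simp add: FS.skew_def left_diff_distrib sum_subtractf)
      ultimately show ?thesis by (simp only: filt_minus_1)
    qed
    have "a h = b h" if "h \<in> G" for h
      using FS.skew_independent[OF null, of h] that by (simp add: \<alpha> \<beta> coset_eq_iff filt_minus_1)
    then show "a = b"
      using a b by (intro extensionalityI[of a G b]) (auto simp: skew_group_ring_def PiE_def)
  qed
  have surj: "f \<in> ?N ` carrier ?A" if f: "f \<in> carrier (right_End ?R ?S)" for f
  proof -
    have f_add: "f (coset p \<oplus>\<^bsub>?R\<^esub> coset q) = f (coset p) \<oplus>\<^bsub>?R\<^esub> f (coset q)" for p q
      using f by (simp add: right_End_def carrier_enveloping_algebra)
    have f_mult: "f (coset p \<otimes>\<^bsub>?R\<^esub> coset t) = f (coset p) \<otimes>\<^bsub>?R\<^esub> coset t" if "t \<in> FS.E_fixed" for p t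
      using f that by (simp add: right_End_def carrier_enveloping_algebra fixed_subring_coset)
    have f_ext: "f \<in> extensional (range coset)"
      using f by (simp add: right_End_def carrier_enveloping_algebra PiE_def)
    have "f (coset p) \<in> range coset" for p
      using f by (simp add: right_End_def carrier_enveloping_algebra PiE_def Pi_def)
    then have "\<forall>p. \<exists>q. f (coset p) = coset q" by blast
    \<comment> \<open>An arbitrary choice of representatives: \<open>F\<close> need be neither
      additive nor linear in the free algebra, which is why \<open>endo\<close> asks for congruences
      only.\<close>
    from choice[OF this] obtain F where F: "\<And>p. f (coset p) = coset (F p)" by blast
    have "FS.endo F"
      unfolding FS.endo_def filt_minus_1
    proof (intro conjI allI ballI)
      show "F (p + q) - (F p + F q) \<in> enveloping_ideal" for p q
        using f_add[of p q] by (simp add: coset_add F coset_eq_iff)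
      show "F (p * t) - F p * t \<in> enveloping_ideal" if "t \<in> FS.E_fixed" for p t
        using f_mult[OF that, of p] by (simp add: coset_mult F coset_eq_iff)
      fix p assume p: "p \<in> enveloping_ideal"
      have "F (0 + 0) - (F 0 + F 0) \<in> enveloping_ideal"
        using f_add[of 0 0] by (simp add: coset_add F coset_eq_iff)
      then have F0: "F 0 \<in> enveloping_ideal" using enveloping_ideal_uminus[of "- F 0"] by simp
      have "coset p = coset 0" using p by (simp add: coset_eq_iff)
      then have "F p - F 0 \<in> enveloping_ideal" using F by (metis coset_eq_iff)
      then show "F p \<in> enveloping_ideal" using enveloping_ideal_add[OF _ F0] by fastforce
    qed
    then obtain \<alpha> where \<alpha>: "\<And>p. F p - FS.skew \<alpha> p \<in> enveloping_ideal"
      using FS.endo_is_skew unfolding filt_minus_1 by blast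
    define a where "a = (\<lambda>h\<in>G. coset (\<alpha> h))"
    have "a \<in> carrier ?A" by (auto simp: skew_group_ring_def a_def carrier_enveloping_algebra)
    moreover have "f = ?N a"
    proof (rule ext[OF f_ext N_ext])
      fix p
      have "?N a (coset p) = coset (FS.skew \<alpha> p)"
        by (rule skew_natural_map_coset) (simp add: a_def)
      then show "f (coset p) = ?N a (coset p)" using \<alpha>[of p] by (simp add: F coset_eq_iff)
    qed
    ultimately show ?thesis by blast
  qed
  have "?N ` carrier ?A = carrier (right_End ?R ?S)"
    using N_closed surj by blast
  then show ?thesis using hom inj by (simp add: ring_iso_def bij_betw_def)
qed

end

theorem corollary0p5:
  fixes scale :: "'k::field_char_0 \<Rightarrow> 'g::ab_group_add \<Rightarrow> 'g"
    and bracket :: "'g \<Rightarrow> 'g \<Rightarrow> 'g"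
    and Basis :: "'g set"
    and G :: "('g \<Rightarrow> 'g) set"
  defines "R \<equiv> lie_algebra.enveloping_algebra scale bracket"
    and "\<Gamma> \<equiv> (lie_algebra.lie_aut_group scale bracket)\<lparr>carrier := G\<rparr>"
    and "\<phi> \<equiv> enveloping_action"
  assumes lie: "lie_algebra scale bracket"
    and fin_dim: "finite_dimensional_vector_space scale Basis"
    and not_semidirect: "\<not> (\<exists>H x. x \<noteq> 0 \<and>
      lie_algebra.semidirect_product scale bracket H (range (\<lambda>c. scale c x)))"
    and subgroup: "subgroup G (lie_algebra.lie_aut_group scale bracket)"
    and fin: "finite G"
  shows "skew_natural_map R \<Gamma> \<phi>
    \<in> ring_iso (skew_group_ring R \<Gamma> \<phi>) (right_End R (fixed_subring R \<Gamma> \<phi>))"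
proof -
  interpret fd: finite_dimensional_vector_space scale Basis by (rule fin_dim)
  obtain e where e: "bij_betw e {..<card Basis} Basis"
    using ex_bij_betw_nat_finite[OF fd.finite_Basis] by (auto simp: atLeast0LessThan)
  \<comment> \<open>For \<open>i\<close> from \<open>card Basis\<close> on, \<open>e i\<close> is
    arbitrary, but the coefficient at a fixed vector is still additive and homogeneous in
    \<open>v\<close>; the remaining axioms concern indices below the dimension.\<close>
  define crd where "crd v i = fd.representation Basis v (e i)" for v i
  have span: "v \<in> fd.span Basis" for v using fd.span_Basis by simp
  have basis: "lie_algebra_basis scale bracket e (card Basis) crd"
  proof (intro lie_algebra_basis.intro lie_algebra_basis_axioms.intro lie)
    fix v w c i j
    show "crd (v + w) i = crd v i + crd w i"
      by (simp add: crd_def fd.representation_add[OF fd.independent_Basis span span])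
    show "crd (scale c v) i = c * crd v i"
      by (simp add: crd_def fd.representation_scale[OF fd.independent_Basis span])
    have "(\<Sum>i<card Basis. scale (crd v i) (e i)) = (\<Sum>b\<in>Basis. scale (fd.representation Basis v b) b)"
      unfolding crd_def by (rule sum.reindex_bij_betw[OF e])
    also have "\<dots> = v"
      by (rule fd.sum_representation_eq[OF fd.independent_Basis span fd.finite_Basis subset_refl])
    finally show "(\<Sum>i<card Basis. scale (crd v i) (e i)) = v" .
    assume i: "i < card Basis" and j: "j < card Basis"
    have "e i \<in> Basis" using e i by (auto simp: bij_betw_def)
    moreover have "e j = e i \<longleftrightarrow> i = j"
      using e i j by (auto simp: bij_betw_def inj_on_def)
    ultimately show "crd (e i) j = (if i = j then 1 else 0)"
      by (simp add: crd_def fd.representation_basis[OF fd.independent_Basis])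
  qed
  interpret lie_group_action scale bracket e "card Basis" crd G
    by (intro lie_group_action.intro lie_group_action_axioms.intro basis not_semidirect subgroup fin)
  show ?thesis
    unfolding R_def \<Gamma>_def \<phi>_def by (rule skew_natural_map_iso)
qed

end
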